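(* Let $d\ge 2$ and let $\mathcal L,\mathcal L_0\subset\mathbb R^d$ be unimodular lattices. There is a set $P\subset\mathbb R^d$ of full Lebesgue measure such that for every $\vec\alpha\in P$, every $\vec\alpha_0\in\mathbb R^d$ and every sub-exponential sequence $(N_i)_i$, $$\limsup_{i\to\infty} g_{N_i}(\vec\alpha,\mathcal L)\ \ge\ \sup_{N\in\mathbb N} g_N(\vec\alpha_0,\mathcal L_0).$$
   Context: A unimodular lattice is a lattice in $\mathbb R^d$ of covolume $1$. For $\vec\alpha\in\mathbb R^d$, a unimodular lattice $\mathcal L$ and $1\le n\le N$, set $\delta_{n,N}=\min\{|(m-n)\vec\alpha+\vec\ell|>0 : 1\le m\le N,\ \vec\ell\in\mathcal L\}$ (Euclidean norm), the distance from $n\vec\alpha+\mathcal L$ to its nearest neighbour among $\{m\vec\alpha+\mathcal L:1\le m\le N\}$ in the torus $\mathbb R^d/\mathcal L$, and $g_N(\vec\alpha,\mathcal L)=|\{\delta_{n,N}:1\le n\le N\}|$. A sequence of integers $N_1<N_2<\cdots$ is sub-exponential if $N_{i+1}/N_i\to 1$ as $i\to\infty$. *)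

theory Defs
  imports "HOL-Analysis.Analysis"
begin

definition unimodular_lattice :: "(real ^ 'n) set \<Rightarrow> bool" where
  "unimodular_lattice L \<longleftrightarrow>
     (\<exists>A :: real ^ 'n ^ 'n. \<bar>det A\<bar> = 1 \<and>
        L = range (\<lambda>z :: int ^ 'n. A *v (\<chi> i. real_of_int (z $ i))))"

definition nn_dist :: "real ^ 'n \<Rightarrow> (real ^ 'n) set \<Rightarrow> nat \<Rightarrow> nat \<Rightarrow> real" where
  "nn_dist \<alpha> L N n = Inf {norm ((real m - real n) *\<^sub>R \<alpha> + l) | m l.
       1 \<le> m \<and> m \<le> N \<and> l \<in> L \<and> norm ((real m - real n) *\<^sub>R \<alpha> + l) > 0}"

definition gap_count :: "nat \<Rightarrow> real ^ 'n \<Rightarrow> (real ^ 'n) set \<Rightarrow> nat" where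
  "gap_count N \<alpha> L = card ((\<lambda>n. nn_dist \<alpha> L N n) ` {1..N})"

definition sub_exponential :: "(nat \<Rightarrow> nat) \<Rightarrow> bool" where
  "sub_exponential Ns \<longleftrightarrow> strict_mono Ns \<and>
     (\<lambda>i. real (Ns (Suc i)) / real (Ns i)) \<longlonglongrightarrow> 1"

end

theory Submission
  imports Defs
begin

text \<open>
  Let \<open>D(K)\<close> be the least positive length of \<open>k \<alpha> + l\<close> with \<open>\<bar>k\<bar> \<le> K\<close> and \<open>l \<in> L\<close>. By symmetry the
  distance belonging to \<open>n\<close> is \<open>D(max (n - 1) (N - n))\<close>, so the number of distances counts the values
  of \<open>D\<close> on \<open>[(N - 1)/2, N - 1]\<close>. If \<open>\<alpha>\<^sub>0\<close> produces \<open>r + 1\<close> values, then every lattice in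
  \<open>\<real> \<times> \<real>\<^sup>n\<close> that is close to \<open>{(k, k \<alpha>\<^sub>0 + l)}\<close> shows the same strict drops inside a window whose end
  points have ratio strictly below 2, and this persists under scaling the two factors independently.
  A sub-exponential sequence meets every such window far enough out. It therefore suffices that for
  almost every \<open>\<alpha>\<close> the lattices \<open>{(\<epsilon> k, \<delta> (k \<alpha> + l))}\<close>, with \<open>\<epsilon>\<close> arbitrarily small, come close to
  every lattice.

  Moving \<open>\<alpha>\<close> by a small vector acts on a rescaled lattice by a shear of bounded size. Almost every
  \<open>\<alpha>\<close> is not singular, so infinitely many of its rescaled lattices have a basis in a fixed compact
  set; from any lattice a shear followed by a scaling leads into any given open set, hence by
  compactness uniformly. So near such an \<open>\<alpha>\<close> a fixed proportion of each of infinitely many shrinking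
  balls hits the open set, and the points that never hit it have no density points.
\<close>

section \<open>Lattices given by a basis\<close>

text \<open>The obstacle is that shears and scalings form a group far too small to act transitively
  on bases: on the second factor they act only by scalars. What makes every open set of lattices
  accessible is the freedom to change the basis by integer matrices, interleaved with limits. One
  step of a Euclidean algorithm divides a single row by an integer, at the price of a first
  coordinate that can be removed in the limit. A common scale being free, this yields all rational
  and hence, in the limit, all real diagonal matrices; row swaps and additions are changes of basis.
  Together these generate the general linear group. As the two factors are scaled independently, the
  covolume is no invariant, and a target need only have full rank. The other delicate point is a
  rational \<alpha>0: a relation k \<alpha>0 + l = 0 would turn into a new short distance after a
  perturbation. No such relation occurs in the relevant range of k once two distances are present,
  because a short period forces a single distance.\<close>

definition lat :: "('a::real_vector)^'k \<Rightarrow> 'a set" where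
  "lat b = range (\<lambda>z::'k\<Rightarrow>int. \<Sum>k\<in>UNIV. of_int (z k) *\<^sub>R b $ k)"

lemma lat_memI: "(\<Sum>k\<in>UNIV. of_int (z k) *\<^sub>R b $ k) \<in> lat b"
  by (auto simp: lat_def)

lemma lat_zero: "0 \<in> lat b"
  using lat_memI[of "\<lambda>_. 0" b] by simp

lemma lat_add: "x \<in> lat b \<Longrightarrow> y \<in> lat b \<Longrightarrow> x + y \<in> lat b"
proof -
  assume "x \<in> lat b" "y \<in> lat b"
  then obtain z w where "x = (\<Sum>k\<in>UNIV. of_int (z k) *\<^sub>R b $ k)" "y = (\<Sum>k\<in>UNIV. of_int (w k) *\<^sub>R b $ k)"
    by (auto simp: lat_def)
  then have "x + y = (\<Sum>k\<in>UNIV. of_int (z k + w k) *\<^sub>R b $ k)"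
    by (simp add: scaleR_left_distrib sum.distrib)
  then show ?thesis using lat_memI by metis
qed

lemma lat_scale: "x \<in> lat b \<Longrightarrow> of_int c *\<^sub>R x \<in> lat b"
proof -
  assume "x \<in> lat b"
  then obtain z where "x = (\<Sum>k\<in>UNIV. of_int (z k) *\<^sub>R b $ k)"
    by (auto simp: lat_def)
  then have "of_int c *\<^sub>R x = (\<Sum>k\<in>UNIV. of_int (c * z k) *\<^sub>R b $ k)"
    by (simp add: scaleR_right.sum)
  then show ?thesis using lat_memI by metis
qed

lemma lat_uminus: "x \<in> lat b \<Longrightarrow> - x \<in> lat b"
  using lat_scale[of x b "-1"] by simp

lemma lat_diff: "x \<in> lat b \<Longrightarrow> y \<in> lat b \<Longrightarrow> x - y \<in> lat b"
  using lat_add[of x b "-y"] lat_uminus[of y b] by simp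

lemma lat_basis: "b $ k \<in> lat b"
proof -
  have "(\<Sum>j\<in>UNIV. of_int (if j = k then 1 else 0) *\<^sub>R b $ j) = (\<Sum>j\<in>UNIV. if j = k then b $ j else 0)"
    by (rule sum.cong) auto
  also have "\<dots> = b $ k" by simp
  finally show ?thesis using lat_memI by metis
qed

lemma lat_sum: "(\<And>i. i \<in> I \<Longrightarrow> f i \<in> lat b) \<Longrightarrow> sum f I \<in> lat b"
  by (induction I rule: infinite_finite_induct) (auto simp: lat_zero lat_add)

lemma lat_subsetI: "(\<And>k. b' $ k \<in> lat b) \<Longrightarrow> lat b' \<subseteq> lat b"
  by (auto simp: lat_def[of b'] intro!: lat_sum lat_scale)

lemma lat_eqI: "(\<And>k. b' $ k \<in> lat b) \<Longrightarrow> (\<And>k. b $ k \<in> lat b') \<Longrightarrow> lat b' = lat b"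
  by (intro equalityI lat_subsetI)

lemma lat_linear:
  assumes "linear f"
  shows "lat (\<chi> k. f (b $ k)) = f ` lat b"
  unfolding lat_def using assms
  by (force simp: linear_sum linear_scale image_iff)

text \<open>Phrased through the lattice and not through the tuple, so that it passes at once between
  bases of the same lattice.\<close>

definition full_rank :: "('a::real_vector)^'k \<Rightarrow> bool" where
  "full_rank b \<longleftrightarrow> span (lat b) = UNIV"

lemma lincomb_linear: "linear (\<lambda>c::real^'k. \<Sum>k\<in>UNIV. c $ k *\<^sub>R (b::('a::real_vector)^'k) $ k)"
  by (rule linearI) (simp_all add: scaleR_left_distrib sum.distrib scaleR_right.sum)

lemma full_rank_iff_surj:
  "full_rank (b::('a::real_vector)^'k) \<longleftrightarrow> surj (\<lambda>c::real^'k. \<Sum>k\<in>UNIV. c $ k *\<^sub>R b $ k)" (is "_ \<longleftrightarrow>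
      surj ?f")
proof
  assume f: "full_rank b"
  have sub: "subspace (range ?f)"
    using lincomb_linear[of b] by (simp add: subspace_UNIV linear_subspace_image)
  have "lat b \<subseteq> range ?f"
    unfolding lat_def by (force intro: rev_image_eqI[where x="\<chi> k. of_int (_ k)"])
  then have "span (lat b) \<subseteq> range ?f" using sub by (simp add: span_minimal)
  then show "surj ?f" using f by (auto simp: full_rank_def)
next
  assume s: "surj ?f"
  have "?f c \<in> span (lat b)" for c
    by (intro span_sum span_scale span_base lat_basis)
  then have "range ?f \<subseteq> span (lat b)" by blast
  then show "full_rank b" using s by (simp add: full_rank_def top.extremum_unique)
qed

lemma full_rank_iff_inj:
  fixes b :: "('a::euclidean_space)^'k"
  assumes "DIM('a) = CARD('k)"
  shows "full_rank b \<longleftrightarrow> inj (\<lambda>c::real^'k. \<Sum>k\<in>UNIV. c $ k *\<^sub>R b $ k)"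
proof -
  have d: "dim (UNIV :: (real^'k) set) = dim (UNIV :: 'a set)"
    using assms by simp
  show ?thesis unfolding full_rank_iff_surj
    using linear_injective_imp_surjective[OF lincomb_linear[of b]]
      linear_surjective_imp_injective[OF lincomb_linear[of b]] d by auto
qed

lemma full_rank_bounded_below:
  fixes b :: "('a::euclidean_space)^'k"
  assumes "DIM('a) = CARD('k)" "full_rank b"
  obtains B where "B > 0" "\<And>c::real^'k. B * norm c \<le> norm (\<Sum>k\<in>UNIV. c $ k *\<^sub>R b $ k)"
  using linear_inj_bounded_below_pos[OF lincomb_linear[of b]] assms full_rank_iff_inj by blast

lemma full_rank_coeff_unique:
  fixes b :: "('a::euclidean_space)^'k"
  assumes "DIM('a) = CARD('k)" "full_rank b"
    and "(\<Sum>k\<in>UNIV. c k *\<^sub>R b $ k) = (\<Sum>k\<in>UNIV. d k *\<^sub>R b $ k)"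
  shows "c k = d k"
proof -
  have "inj (\<lambda>c::real^'k. \<Sum>k\<in>UNIV. c $ k *\<^sub>R b $ k)" using assms full_rank_iff_inj by blast
  from injD[OF this, of "\<chi> k. c k" "\<chi> k. d k"] assms(3) show ?thesis by (simp add: vec_eq_iff)
qed

lemma full_rank_linear_image:
  assumes "linear f" "surj f" "full_rank b"
    and "lat b' = f ` lat b"
  shows "full_rank b'"
  using assms by (simp add: full_rank_def linear_span_image)

text \<open>Uniqueness of coefficients makes the integer matrix \<open>\<gamma>\<close> invertible
  over the integers. The second conclusion is the point: the same \<open>\<gamma>\<close> is a
  change of basis for every other tuple \<open>b1\<close>, so it can be frozen while
  \<open>b\<close> is perturbed.\<close>

lemma lat_basis_change:
  fixes b :: "('a::euclidean_space)^'k"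
  assumes dim: "DIM('a) = CARD('k)" "full_rank b"
    and f: "linear f" "inj f" and eq: "lat b' = f ` lat b"
  obtains \<gamma> :: "'k \<Rightarrow> 'k \<Rightarrow> int" where "b' = (\<chi> k. f (\<Sum>j\<in>UNIV. of_int (\<gamma> k j) *\<^sub>R b $ j))"
    "\<And>b1::'a^'k. lat (\<chi> k. \<Sum>j\<in>UNIV. of_int (\<gamma> k j) *\<^sub>R b1 $ j) = lat b1"
proof -
  have "\<forall>k. \<exists>z::'k\<Rightarrow>int. b' $ k = f (\<Sum>j\<in>UNIV. of_int (z j) *\<^sub>R b $ j)"
    using lat_basis[of b'] eq by (auto simp: lat_def)
  then obtain \<gamma> :: "'k \<Rightarrow> 'k \<Rightarrow> int" where \<gamma>: "\<And>k. b' $ k = f (\<Sum>j\<in>UNIV. of_int (\<gamma> k j) *\<^sub>R b $ j)"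
    by metis
  have "\<forall>j. \<exists>z::'k\<Rightarrow>int. f (b $ j) = (\<Sum>k\<in>UNIV. of_int (z k) *\<^sub>R b' $ k)"
    using lat_basis[of b] eq by (auto simp: lat_def)
  then obtain \<gamma>' :: "'k \<Rightarrow> 'k \<Rightarrow> int" where \<gamma>': "\<And>j. f (b $ j) = (\<Sum>k\<in>UNIV. of_int (\<gamma>' j k) *\<^sub>R b' $ k)"
    by metis
  have mult: "(\<Sum>k\<in>UNIV. of_int (\<gamma>' j k) *\<^sub>R (\<Sum>i\<in>UNIV. of_int (\<gamma> k i) *\<^sub>R b1 $ i))
       = (\<Sum>i\<in>UNIV. of_int (\<Sum>k\<in>UNIV. \<gamma>' j k * \<gamma> k i) *\<^sub>R b1 $ i)" for j and b1 :: "'a^'k"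
    by (simp add: scaleR_right.sum scaleR_left.sum, subst sum.swap) simp
  have "f (b $ j) = f (\<Sum>i\<in>UNIV. of_int (\<Sum>k\<in>UNIV. \<gamma>' j k * \<gamma> k i) *\<^sub>R b $ i)" for j
    unfolding mult[symmetric] \<gamma>' \<gamma> using f(1) by (simp add: linear_sum linear_scale)
  then have "b $ j = (\<Sum>i\<in>UNIV. of_int (\<Sum>k\<in>UNIV. \<gamma>' j k * \<gamma> k i) *\<^sub>R b $ i)" for j
    using f(2) by (meson injD)
  moreover have delta: "b1 $ j = (\<Sum>i\<in>UNIV. of_int (if i = j then 1 else 0) *\<^sub>R b1 $ i)" for
      j and b1 :: "'a^'k"
  proof -
    have "(\<Sum>i\<in>UNIV. of_int (if i = j then 1 else 0) *\<^sub>R b1 $ i) = (\<Sum>i\<in>UNIV. if i =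
        j then b1 $ i else 0)"
      by (rule sum.cong) auto
    then show ?thesis by simp
  qed
  ultimately have H: "real_of_int (if i = j then 1 else 0) = of_int (\<Sum>k\<in>UNIV. \<gamma>' j k * \<gamma> k i)" for i j
    using full_rank_coeff_unique[OF dim, of "\<lambda>i. of_int (if i = j then 1 else 0)" "\<lambda>i.
        of_int (\<Sum>k\<in>UNIV. \<gamma>' j k * \<gamma> k i)" i]
    by metis
  then have inv: "(\<Sum>k\<in>UNIV. \<gamma>' j k * \<gamma> k i) = (if i = j then 1 else 0)" for i j
    using H[of i j] by (simp only: of_int_eq_iff)
  have "lat (\<chi> k. \<Sum>j\<in>UNIV. of_int (\<gamma> k j) *\<^sub>R b1 $ j) = lat b1" for b1 :: "'a^'k"
  proof (rule lat_eqI)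
    fix k show "(\<chi> k. \<Sum>j\<in>UNIV. of_int (\<gamma> k j) *\<^sub>R b1 $ j) $ k \<in> lat b1"
      by (simp add: lat_memI)
    have e: "b1 $ k = (\<Sum>i\<in>UNIV. of_int (\<gamma>' k i) *\<^sub>R (\<chi> k. \<Sum>j\<in>UNIV. of_int (\<gamma> k j) *\<^sub>R b1 $ j) $ i)"
      using mult[of k b1] delta[of b1 k] inv by simp
    show "b1 $ k \<in> lat (\<chi> k. \<Sum>j\<in>UNIV. of_int (\<gamma> k j) *\<^sub>R b1 $ j)"
      by (subst e) (rule lat_memI)
  qed
  with \<gamma> show ?thesis by (intro that[of \<gamma>]) (auto simp: vec_eq_iff)
qed

section \<open>Shears and independent scalings of the two factors\<close>

definition shear :: "real \<Rightarrow> real \<Rightarrow> 'v::real_vector \<Rightarrow> real \<times> 'v \<Rightarrow> real \<times> 'v" where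
  "shear \<epsilon> \<delta> x p = (\<epsilon> * fst p, \<delta> *\<^sub>R (snd p + fst p *\<^sub>R x))"

lemma shear_linear: "linear (shear \<epsilon> \<delta> x)"
  by (rule linearI) (simp_all add: shear_def algebra_simps prod_eq_iff)

text \<open>An earlier scaling multiplies a later shear vector by \<epsilon>1 / \<delta>1. With a
  small ratio, a shear of bounded size applied to the rescaled lattice is a small shear of the
  original one, that is, a small move of \<alpha>.\<close>

lemma shear_shear:
  assumes "\<delta>1 \<noteq> 0"
  shows "shear \<epsilon>2 \<delta>2 x2 (shear \<epsilon>1 \<delta>1 x1 p) = shear (\<epsilon>2 * \<epsilon>1) (\<delta>2 * \<delta>1) (x1 + (\<epsilon>1 / \<delta>1) *\<^sub>R x2) p"
  using assms by (simp add: shear_def algebra_simps)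

lemma shear_id: "shear 1 1 0 p = p"
  by (simp add: shear_def)

lemma shear_inverse:
  assumes "\<epsilon> \<noteq> 0" "\<delta> \<noteq> 0"
  shows "shear (1/\<epsilon>) (1/\<delta>) (- (\<delta> / \<epsilon>) *\<^sub>R x) (shear \<epsilon> \<delta> x p) = p"
  using assms by (simp add: shear_def prod_eq_iff algebra_simps)

lemma shear_inverse':
  assumes "\<epsilon> \<noteq> 0" "\<delta> \<noteq> 0"
  shows "shear \<epsilon> \<delta> x (shear (1/\<epsilon>) (1/\<delta>) (- (\<delta> / \<epsilon>) *\<^sub>R x) p) = p"
  using assms by (simp add: shear_def algebra_simps prod_eq_iff)

lemma shear_inj: "\<epsilon> \<noteq> 0 \<Longrightarrow> \<delta> \<noteq> 0 \<Longrightarrow> inj (shear \<epsilon> \<delta> x)"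
  by (metis injI shear_inverse)

lemma shear_surj: "\<epsilon> \<noteq> 0 \<Longrightarrow> \<delta> \<noteq> 0 \<Longrightarrow> surj (shear \<epsilon> \<delta> x)"
  by (metis surjI shear_inverse')

text \<open>No relation ties \<epsilon> to \<delta>, so the covolume may change. Both are positive;
  reflections are handled by signs of basis vectors instead.\<close>

definition equivalent :: "(real \<times> 'v::real_vector)^'k \<Rightarrow> (real \<times> 'v)^'k \<Rightarrow> bool" where
  "equivalent b b' \<longleftrightarrow> (\<exists>\<epsilon> \<delta> x. \<epsilon> > 0 \<and> \<delta> > 0 \<and> lat b' = shear \<epsilon> \<delta> x ` lat b)"

lemma equivalent_lat: "lat b' = lat b \<Longrightarrow> equivalent b b'"
  unfolding equivalent_def by (rule exI[of _ 1], rule exI[of _ 1], rule exI[of _ 0]) (simp add: shear_id)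

lemma equivalent_trans: "equivalent a b \<Longrightarrow> equivalent b c \<Longrightarrow> equivalent a c"
  unfolding equivalent_def
proof clarify
  fix \<epsilon> \<delta> x \<epsilon>' \<delta>' x'
  assume *: "\<epsilon> > 0" "\<delta> > 0" "lat b = shear \<epsilon> \<delta> x ` lat a" "\<epsilon>' > 0" "\<delta>' > 0" "lat c =
      shear \<epsilon>' \<delta>' x' ` lat b"
  then have "lat c = shear (\<epsilon>' * \<epsilon>) (\<delta>' * \<delta>) (x + (\<epsilon> / \<delta>) *\<^sub>R x') ` lat a"
    by (simp add: image_image shear_shear)
  then show "\<exists>\<epsilon> \<delta> x. \<epsilon> > 0 \<and> \<delta> > 0 \<and> lat c = shear \<epsilon> \<delta> x ` lat a"
    using * by (metis mult_pos_pos)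
qed

lemma equivalent_sym: "equivalent a b \<Longrightarrow> equivalent b a"
  unfolding equivalent_def
proof clarify
  fix \<epsilon> \<delta> x
  assume *: "\<epsilon> > 0" "\<delta> > 0" "lat b = shear \<epsilon> \<delta> x ` lat a"
  then have "lat a = shear (1/\<epsilon>) (1/\<delta>) (- (\<delta> / \<epsilon>) *\<^sub>R x) ` lat b"
    by (simp add: image_image shear_inverse[simplified])
  then show "\<exists>\<epsilon> \<delta> x. \<epsilon> > 0 \<and> \<delta> > 0 \<and> lat a = shear \<epsilon> \<delta> x ` lat b"
    using * by (metis divide_pos_pos zero_less_one)
qed

lemma equivalent_shear:
  "\<epsilon> > 0 \<Longrightarrow> \<delta> > 0 \<Longrightarrow> equivalent b (\<chi> k. shear \<epsilon> \<delta> x (b $ k))"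
  unfolding equivalent_def using lat_linear[OF shear_linear] by blast

lemma equivalent_full_rank: "equivalent a b \<Longrightarrow> full_rank a \<Longrightarrow> full_rank b"
  unfolding equivalent_def
  by (metis full_rank_linear_image shear_linear shear_surj less_irrefl)

section \<open>Reachability of open sets of bases and its stability\<close>

definition reach :: "((real \<times> 'v::real_vector)^'k) set \<Rightarrow> (real \<times> 'v)^'k \<Rightarrow> bool" where
  "reach U b \<longleftrightarrow> (\<exists>b'\<in>U. equivalent b b')"

lemma reach_equivalent: "equivalent a b \<Longrightarrow> reach U b \<Longrightarrow> reach U a"
  unfolding reach_def using equivalent_trans by blast

lemma continuous_shear_comb:
  fixes \<gamma> :: "'k::finite \<Rightarrow> 'k \<Rightarrow> int"
  shows "continuous_on UNIV (\<lambda>q::((real \<times> 'v::euclidean_space)^'k) \<times> 'v.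
     \<chi> k. shear \<epsilon> \<delta> (snd q) (\<Sum>j\<in>UNIV. of_int (\<gamma> k j) *\<^sub>R fst q $ j))"
  unfolding shear_def by (intro continuous_intros)

text \<open>With the integer change of basis and the scalings frozen, the resulting tuple depends
  continuously on the pair of \<open>b\<close> and \<open>x\<close>. Openness in the shear vector
  matters as much as openness in \<open>b\<close>: it later turns one reachable target into a whole
  ball of good \<alpha>.\<close>

lemma equivalent_stable:
  fixes b b' :: "(real \<times> 'v::euclidean_space)^'k"
  assumes dim: "DIM(real \<times> 'v) = CARD('k)" "full_rank b"
    and U: "open U" "b' \<in> U" and \<epsilon>: "\<epsilon> > 0" "\<delta> > 0" and eq: "lat b' = shear \<epsilon> \<delta> x ` lat b"
  obtains \<rho> where "\<rho> > 0"
    "\<And>b1 x1. dist b1 b < \<rho> \<Longrightarrow> dist x1 x < \<rho> \<Longrightarrow> \<exists>b2\<in>U. lat b2 = shear \<epsilon> \<delta> x1 ` lat b1"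
proof -
  have inj: "inj (shear \<epsilon> \<delta> x)" using \<epsilon> by (simp add: shear_inj)
  obtain \<gamma> :: "'k \<Rightarrow> 'k \<Rightarrow> int" where \<gamma>: "b' = (\<chi> k. shear \<epsilon> \<delta> x (\<Sum>j\<in>UNIV. of_int (\<gamma> k j) *\<^sub>R b $ j))"
    "\<And>b1::(real \<times> 'v)^'k. lat (\<chi> k. \<Sum>j\<in>UNIV. of_int (\<gamma> k j) *\<^sub>R b1 $ j) = lat b1"
    using lat_basis_change[OF dim shear_linear inj eq] by blast
  define F where "F = (\<lambda>q::((real \<times> 'v)^'k) \<times> 'v.
     \<chi> k. shear \<epsilon> \<delta> (snd q) (\<Sum>j\<in>UNIV. of_int (\<gamma> k j) *\<^sub>R fst q $ j))"
  have "continuous_on UNIV F" unfolding F_def by (rule continuous_shear_comb)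
  then have "open (F -` U)" using U(1) by (simp add: open_vimage)
  moreover have "(b, x) \<in> F -` U" using \<gamma>(1) U by (simp add: F_def)
  ultimately obtain \<rho> where \<rho>: "\<rho> > 0" "ball (b,x) \<rho> \<subseteq> F -` U"
    by (meson open_contains_ball)
  show ?thesis
  proof (rule that[of "\<rho>/2"])
    show "\<rho>/2 > 0" using \<rho> by simp
    fix b1 x1 assume d: "dist b1 b < \<rho>/2" "dist x1 x < \<rho>/2"
    have "dist (b1,x1) (b,x) \<le> dist b1 b + dist x1 x"
      unfolding dist_Pair_Pair by (rule sqrt_sum_squares_le_sum) auto
    then have "(b1,x1) \<in> ball (b,x) \<rho>" using d by (simp add: dist_commute)
    then have "F (b1,x1) \<in> U" using \<rho> by blast
    moreover have "lat (F (b1,x1)) = shear \<epsilon> \<delta> x1 ` lat b1"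
      using lat_linear[OF shear_linear, of \<epsilon> \<delta> x1 "\<chi> k. \<Sum>j\<in>UNIV. of_int (\<gamma> k j) *\<^sub>R b1 $ j"] \<gamma>(2)[of b1]
      by (simp add: F_def)
    ultimately show "\<exists>b2\<in>U. lat b2 = shear \<epsilon> \<delta> x1 ` lat b1" by blast
  qed
qed

lemma reach_open:
  fixes b :: "(real \<times> 'v::euclidean_space)^'k"
  assumes dim: "DIM(real \<times> 'v) = CARD('k)" "full_rank b"
    and U: "open U" "reach U b"
  shows "\<forall>\<^sub>F b1 in nhds b. reach U b1"
proof -
  obtain b' \<epsilon> \<delta> x where *: "b' \<in> U" "\<epsilon> > 0" "\<delta> > 0" "lat b' = shear \<epsilon> \<delta> x ` lat b"
    using U(2) by (auto simp: reach_def equivalent_def)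
  from equivalent_stable[OF dim U(1) *] obtain \<rho> where \<rho>: "\<rho> > 0"
    "\<And>b1 x1. dist b1 b < \<rho> \<Longrightarrow> dist x1 x < \<rho> \<Longrightarrow> \<exists>b2\<in>U. lat b2 = shear \<epsilon> \<delta> x1 ` lat b1" by blast
  have "reach U b1" if "dist b1 b < \<rho>" for b1
    using \<rho>(2)[OF that, of x] \<rho>(1) * unfolding reach_def equivalent_def by auto
  then show ?thesis using \<rho>(1) by (metis eventually_nhds_metric)
qed

section \<open>Reaching every lattice\<close>

text \<open>The index type \<open>'n option\<close> has one element more than \<open>'n\<close>,
  matching the dimension of the product; \<open>None\<close> marks the vector that shears can bring
  to (1, 0).\<close>

definition normal_basis :: "real^'n \<Rightarrow> real^'n^'n \<Rightarrow> (real \<times> (real^'n))^('n option)" where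
  "normal_basis u v = (\<chi> k. case k of None \<Rightarrow> (1, 0) | Some i \<Rightarrow> (u $ i, v $ i))"

lemma normal_basis_simps [simp]: "normal_basis u v $ None = (1, 0)" "normal_basis u v $ Some i =
    (u $ i, v $ i)"
  by (simp_all add: normal_basis_def)

lemma dim_option: "DIM(real \<times> (real^'n)) = CARD('n option)"
  by (simp add: UNIV_option_conv card_image)

lemma sum_option: "(\<Sum>k\<in>(UNIV::'n::finite option set). f k) = f None + (\<Sum>i\<in>UNIV. f (Some i))"
  by (simp add: UNIV_option_conv sum.reindex)

lemma full_rank_normal_basis:
  fixes v :: "real^'n^'n"
  shows "full_rank (normal_basis u v) \<longleftrightarrow> det v \<noteq> 0"
proof -
  have "full_rank (normal_basis u v) \<longleftrightarrow> (\<forall>c::real^('n option). (\<Sum>k\<in>UNIV.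
      c $ k *\<^sub>R normal_basis u v $ k) = 0 \<longrightarrow> c = 0)"
    using full_rank_iff_inj[OF dim_option, of "normal_basis u v"] linear_injective_0[OF lincomb_linear[of "normal_basis u v"]] by simp
  also have "\<dots> \<longleftrightarrow> (\<forall>c. (\<Sum>i\<in>UNIV. c i *s row i v) = 0 \<longrightarrow> (\<forall>i. c i = 0))"
  proof safe
    fix c i assume *: "\<forall>c::real^('n option). (\<Sum>k\<in>UNIV. c $ k *\<^sub>R normal_basis u v $ k) = 0 \<longrightarrow> c = 0"
      and c: "(\<Sum>i\<in>UNIV. c i *s row i v) = 0"
    \<comment> \<open>The coefficient of (1, 0) is chosen to cancel the first coordinates, so that
      only the relation among the rows of \<open>v\<close> remains.\<close>
    define d :: "real^('n option)" where "d = (\<chi> k. case k of None \<Rightarrow> - (\<Sum>i\<in>UNIV.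
        c i * u $ i) | Some i \<Rightarrow> c i)"
    have "(\<Sum>k\<in>UNIV. d $ k *\<^sub>R normal_basis u v $ k) = 0"
      using c by (simp add: sum_option d_def prod_eq_iff fst_sum snd_sum row_def scalar_mult_eq_scaleR vec_lambda_eta)
    then have "d = 0" using * by blast
    then have "d $ Some i = 0" by simp
    then show "c i = 0" by (simp add: d_def)
  next
    fix c :: "real^('n option)"
    assume *: "\<forall>c. (\<Sum>i\<in>UNIV. c i *s row i v) = 0 \<longrightarrow> (\<forall>i. c i = 0)"
      and c: "(\<Sum>k\<in>UNIV. c $ k *\<^sub>R normal_basis u v $ k) = 0"
    have c': "c $ None + (\<Sum>i\<in>UNIV. c $ Some i * u $ i) = 0" "(\<Sum>i\<in>UNIV. c $ Some i *s row i v) = 0"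
      using c by (simp_all add: sum_option prod_eq_iff fst_sum snd_sum row_def scalar_mult_eq_scaleR vec_lambda_eta)
    have s: "c $ Some i = 0" for i using *[rule_format, of "\<lambda>i. c $ Some i" i] c'(2) by simp
    with c'(1) have "c $ None = 0" by simp
    with s have "c $ k = 0" for k by (cases k) auto
    then show "c = 0" by (simp add: vec_eq_iff)
  qed
  also have "\<dots> \<longleftrightarrow> det v \<noteq> 0"
    by (simp add: matrix_right_invertible_independent_rows[symmetric] invertible_right_inverse[symmetric] invertible_det_nz)
  finally show ?thesis .
qed

lemma lat_swap: "lat (\<chi> k. b $ (Transposition.transpose i j k)) = lat b"
proof (rule lat_eqI)
  fix k
  show "(\<chi> k. b $ (Transposition.transpose i j k)) $ k \<in> lat b" by (simp add: lat_basis)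
  have "b $ k = (\<chi> k. b $ (Transposition.transpose i j k)) $ (Transposition.transpose i j k)" by simp
  then show "b $ k \<in> lat (\<chi> k. b $ (Transposition.transpose i j k))" by (metis lat_basis)
qed

lemma lat_signs:
  assumes "\<And>k. b' $ k = b $ k \<or> b' $ k = - b $ k"
  shows "lat b' = lat b"
proof (rule lat_eqI)
  fix k
  show "b' $ k \<in> lat b" using assms[of k] lat_basis[of b k] lat_uminus by metis
  show "b $ k \<in> lat b'" using assms[of k] lat_basis[of b' k] lat_uminus by (metis minus_minus)
qed

text \<open>The vector at \<open>k0\<close> is swapped to \<open>None\<close>, made positive in its
  first coordinate, scaled and sheared to (1, 0). If it was the only one with a nonzero first
  coordinate, the lattice splits as a product; this is the second conclusion.\<close>

lemma equivalent_normal_basis: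
  fixes b :: "(real \<times> (real^'n))^('n option)"
  assumes "fst (b $ k0) \<noteq> 0"
  obtains u v where "equivalent b (normal_basis u v)" "(\<And>k. k \<noteq> k0 \<Longrightarrow> fst (b $ k) = 0) \<Longrightarrow> u = 0"
proof -
  define b1 where "b1 = (\<chi> k. b $ (Transposition.transpose k0 None k))"
  define b2 where "b2 = (\<chi> k. if k = None \<and> fst (b1 $ None) < 0 then - b1 $ k else b1 $ k)"
  define g where "g = fst (b2 $ None)"
  have g: "g > 0" using assms by (simp add: g_def b2_def b1_def)
  have l2: "lat b2 = lat b1" by (rule lat_signs) (simp add: b2_def)
  have l1: "lat b1 = lat b" unfolding b1_def by (rule lat_swap)
  define b3 where "b3 = (\<chi> k. shear (1/g) 1 (- (1/g) *\<^sub>R snd (b2 $ None)) (b2 $ k))"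
  have e: "equivalent b b3"
    using equivalent_trans[OF equivalent_lat equivalent_shear[of "1/g" 1 b2]] l1 l2 g
    by (simp add: b3_def)
  have n: "b3 $ None = (1, 0)" using g by (simp add: b3_def shear_def g_def)
  have b3: "b3 = normal_basis (\<chi> i. fst (b3 $ Some i)) (\<chi> i. snd (b3 $ Some i))"
    using n by (auto simp: vec_eq_iff normal_basis_def split: option.split)
  show ?thesis
  proof (rule that)
    show "equivalent b (normal_basis (\<chi> i. fst (b3 $ Some i)) (\<chi> i. snd (b3 $ Some i)))"
        using e b3 by simp
    assume *: "\<And>k. k \<noteq> k0 \<Longrightarrow> fst (b $ k) = 0"
    have "fst (b3 $ Some i) = 0" for i
    proof -
      have "Transposition.transpose k0 None (Some i) \<noteq> k0"
        by (metis option.distinct(1) transpose_apply_second transpose_involutory)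
      then show ?thesis using * by (simp add: b3_def b2_def b1_def shear_def)
    qed
    then show "(\<chi> i. fst (b3 $ Some i)) = 0" by (simp add: vec_eq_iff)
  qed
qed

text \<open>
  The basis is changed to \<open>b\<^sub>i + s b\<^sub>0\<close>, \<open>b\<^sub>0\<close> in place of \<open>b\<^sub>0\<close>, \<open>b\<^sub>i\<close> (with \<open>b\<^sub>0\<close> the vector of index
  \<open>None\<close>), and a shear brings the first vector back to \<open>(1, 0)\<close>.
\<close>

lemma equivalent_step:
  fixes u :: "real^'n" and s :: nat
  assumes "real s + u $ i > 0"
  shows "equivalent (normal_basis u v)
     (normal_basis (\<chi> j. (1 / (s + u $ i)) * (if j = i then 1 else u $ j))
         (\<chi> j. if j = i then - (1 / (s + u $ i)) *\<^sub>R v $ i else v $ j - (1 / (s + u $ i)) *\<^sub>R u $ j *\<^sub>R v $ i))"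
    (is "equivalent _ ?R")
proof -
  define b where "b = normal_basis u v"
  define b2 where "b2 = (\<chi> k. if k = None then b $ Some i + of_int (int s) *\<^sub>R b $ None else if k =
      Some i then b $ None else b $ k)"
  have "lat b2 = lat b"
  proof (rule lat_eqI)
    fix k
    show "b2 $ k \<in> lat b"
        by (auto simp: b2_def simp del: of_int_of_nat_eq intro!: lat_add lat_scale lat_basis)
    have "b $ Some i = b2 $ None - of_int (int s) *\<^sub>R b2 $ Some i" "b $ None = b2 $ Some i"
      "k \<noteq> None \<Longrightarrow> k \<noteq> Some i \<Longrightarrow> b $ k = b2 $ k"
      by (auto simp: b2_def)
    then show "b $ k \<in> lat b2"
      by (metis lat_basis lat_diff lat_scale)
  qed
  moreover have "?R = (\<chi> k. shear (1 / (s + u $ i)) 1 (- (1 / (s + u $ i)) *\<^sub>R v $ i) (b2 $ k))"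
    using assms
    by (auto simp: vec_eq_iff normal_basis_def b2_def b_def shear_def field_simps split: option.split)
  moreover have "1 / (s + u $ i) > 0" using assms by simp
  ultimately show ?thesis
    using equivalent_trans[OF equivalent_lat equivalent_shear] b_def zero_less_one by metis
qed

text \<open>
  Each index in \<open>I\<close> is treated once, with the same \<open>s\<close>; every step shrinks one of the \<open>v\<^sub>i\<close> by the factor
  \<open>s\<close>, so that after all steps a single rescaling yields a limit as \<open>s\<close> tends to infinity. The limit is
  a product of \<open>\<int>\<close> with a lattice.
\<close>

lemma equivalent_steps:
  fixes u :: "real^'n" and I :: "'n set"
  shows "\<exists>U V. (\<forall>\<^sub>F s in sequentially. equivalent (normal_basis u v) (normal_basis (U s) (V s))) \<and>
     (\<forall>i. convergent (\<lambda>s. U s $ i)) \<and>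
     (\<forall>i\<in>I. (\<lambda>s. U s $ i) \<longlonglongrightarrow> 0 \<and> (\<lambda>s. real s *\<^sub>R V s $ i) \<longlonglongrightarrow> - v $ i) \<and>
     (\<forall>i. i \<notin> I \<longrightarrow> (\<lambda>s. V s $ i) \<longlonglongrightarrow> v $ i)"
proof (induction I rule: infinite_finite_induct)
  case (infinite A)
  then show ?case by simp
next
  case empty
  have "equivalent (normal_basis u v) (normal_basis u v)" by (rule equivalent_lat) simp
  then show ?case by (intro exI[of _ "\<lambda>_. u"] exI[of _ "\<lambda>_. v"]) (auto intro: convergent_const)
next
  case (insert j I)
  then obtain U V where eq: "\<forall>\<^sub>F s in sequentially.
      equivalent (normal_basis u v) (normal_basis (U s) (V s))"
    and conv: "\<And>i. convergent (\<lambda>s. U s $ i)"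
    and I: "\<And>i. i \<in> I \<Longrightarrow> (\<lambda>s. U s $ i) \<longlonglongrightarrow> 0" "\<And>i. i \<in> I \<Longrightarrow> (\<lambda>s. real s *\<^sub>R V s $ i) \<longlonglongrightarrow> - v $ i"
    and nI: "\<And>i. i \<notin> I \<Longrightarrow> (\<lambda>s. V s $ i) \<longlonglongrightarrow> v $ i"
    by blast
  have Vj: "(\<lambda>s. V s $ j) \<longlonglongrightarrow> v $ j" using nI insert by blast
  define q where "q = (\<lambda>s::nat. 1 / (real s + U s $ j))"
  obtain l where l: "(\<lambda>s. U s $ j) \<longlonglongrightarrow> l" using conv by (auto simp: convergent_def)
  have top: "filterlim (\<lambda>s. real s + U s $ j) at_top sequentially"
    using filterlim_tendsto_add_at_top[OF l filterlim_real_sequentially] by (simp add: add.commute)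
  have q0: "q \<longlonglongrightarrow> 0" unfolding q_def
    using real_tendsto_divide_at_top[OF tendsto_const top] by simp
  have pos: "\<forall>\<^sub>F s in sequentially. real s + U s $ j > 0"
    using top by (simp add: filterlim_at_top_dense)
  \<comment> \<open>By the definition of \<open>q\<close>, (s + U) q = 1, hence s q = 1 - U q, and U
    stays bounded while q tends to 0.\<close>
  have "(\<lambda>s. 1 - U s $ j * q s) \<longlonglongrightarrow> 1 - l * 0"
    by (intro tendsto_intros l q0)
  then have q1: "(\<lambda>s. real s * q s) \<longlonglongrightarrow> 1"
  proof (rule tendsto_eq_rhs[OF tendsto_cong[THEN iffD1, rotated]])
    show "\<forall>\<^sub>F s in sequentially. 1 - U s $ j * q s = real s * q s"
      using pos by eventually_elim (simp add: q_def field_simps)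
  qed simp
  define U' where "U' = (\<lambda>s. \<chi> i. q s * (if i = j then 1 else U s $ i))"
  define V' where "V' = (\<lambda>s. \<chi> i. if i =
      j then - q s *\<^sub>R V s $ j else V s $ i - q s *\<^sub>R U s $ i *\<^sub>R V s $ j)"
  have "\<forall>\<^sub>F s in sequentially. equivalent (normal_basis u v) (normal_basis (U' s) (V' s))"
    using eq pos
  proof eventually_elim
    case (elim s)
    then show ?case using equivalent_trans[OF elim(1) equivalent_step[of s "U s" j "V s"]]
      unfolding U'_def V'_def q_def by simp
  qed
  moreover have U'0: "(\<lambda>s. U' s $ i) \<longlonglongrightarrow> 0" for i
  proof -
    obtain m where m: "(\<lambda>s. U s $ i) \<longlonglongrightarrow> m" using conv by (auto simp: convergent_def)
    show ?thesis
    proof (cases "i = j")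
      case True then show ?thesis using q0 by (simp add: U'_def)
    next
      case False then show ?thesis using tendsto_mult[OF q0 m] by (simp add: U'_def)
    qed
  qed
  moreover have "(\<lambda>s. real s *\<^sub>R V' s $ j) \<longlonglongrightarrow> - v $ j"
    using tendsto_minus[OF tendsto_scaleR[OF q1 Vj]] by (simp add: V'_def)
  moreover have "(\<lambda>s. real s *\<^sub>R V' s $ i) \<longlonglongrightarrow> - v $ i" if "i \<in> I" for i
  proof -
    have "(\<lambda>s. real s *\<^sub>R V s $ i - (real s * q s) *\<^sub>R U s $ i *\<^sub>R V s $ j) \<longlonglongrightarrow> - v $ i - 1 *\<^sub>R 0 *\<^sub>R v $ j"
      using that by (intro tendsto_intros I q1 Vj)
    moreover have "i \<noteq> j" using that insert by blast
    ultimately show ?thesis by (simp add: V'_def algebra_simps)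
  qed
  moreover have "(\<lambda>s. V' s $ i) \<longlonglongrightarrow> v $ i" if "i \<notin> I" "i \<noteq> j" for i
  proof -
    obtain m where m: "(\<lambda>s. U s $ i) \<longlonglongrightarrow> m" using conv by (auto simp: convergent_def)
    have "(\<lambda>s. V s $ i - q s *\<^sub>R U s $ i *\<^sub>R V s $ j) \<longlonglongrightarrow> v $ i - 0 *\<^sub>R m *\<^sub>R v $ j"
      using that by (intro tendsto_intros nI m q0 Vj)
    then show ?thesis using that by (simp add: V'_def)
  qed
  ultimately show ?case
    by (intro exI[of _ U'] exI[of _ V']) (auto simp: convergent_def)
qed

text \<open>Treating every index and stretching the second factor by s leads from the given lattice
  to tuples converging to \<open>normal_basis 0 (- v)\<close>, which has the same lattice as
  \<open>normal_basis 0 v\<close>. Since reaching \<open>U\<close> is an open condition, some tuple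
  far along the sequence reaches \<open>U\<close>.\<close>

lemma reach_normal_basis:
  fixes v :: "real^'n^'n"
  assumes U: "open U" and v: "det v \<noteq> 0" and r: "reach U (normal_basis 0 v)"
  shows "reach U (normal_basis u v)"
proof -
  obtain X V where eq: "\<forall>\<^sub>F s in sequentially. equivalent (normal_basis u v) (normal_basis (X s) (V s))"
    and X: "\<And>i. (\<lambda>s. X s $ i) \<longlonglongrightarrow> 0" and V: "\<And>i. (\<lambda>s. real s *\<^sub>R V s $ i) \<longlonglongrightarrow> - v $ i"
    using equivalent_steps[of u v UNIV] by auto
  have sg: "lat (normal_basis 0 (- v)) = lat (normal_basis 0 v)"
    by (rule lat_signs) (auto simp: normal_basis_def split: option.split)
  then have r': "reach U (normal_basis 0 (- v))" using r reach_equivalent[OF equivalent_lat] by metis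
  have "full_rank (normal_basis 0 v)" using v full_rank_normal_basis by blast
  then have "full_rank (normal_basis 0 (- v))" using sg by (simp add: full_rank_def)
  from reach_open[OF dim_option this U r']
  have ev: "\<forall>\<^sub>F b in nhds (normal_basis 0 (- v)). reach U b" .
  have lim: "(\<lambda>s. normal_basis (X s) (\<chi> i. real s *\<^sub>R V s $ i)) \<longlonglongrightarrow> normal_basis 0 (- v)"
  proof (rule vec_tendstoI)
    fix k :: "'n option"
    show "(\<lambda>s. normal_basis (X s) (\<chi> i. real s *\<^sub>R V s $ i) $ k) \<longlonglongrightarrow> normal_basis 0 (- v) $ k"
      using X V by (cases k) (auto intro!: tendsto_intros)
  qed
  have "\<forall>\<^sub>F s in sequentially. reach U (normal_basis (X s) (\<chi> i. real s *\<^sub>R V s $ i))"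
    using ev lim unfolding filterlim_iff by blast
  moreover have "\<forall>\<^sub>F s in sequentially. s > 0" by (rule eventually_gt_at_top)
  ultimately have "\<forall>\<^sub>F s in sequentially. reach U (normal_basis u v)"
    using eq
  proof eventually_elim
    case (elim s)
    have "normal_basis (X s) (\<chi> i. real s *\<^sub>R V s $ i) = (\<chi> k.
        shear 1 (real s) 0 (normal_basis (X s) (V s) $ k))"
      by (auto simp: vec_eq_iff normal_basis_def shear_def split: option.split)
    then have "equivalent (normal_basis (X s) (V s)) (normal_basis (X s) (\<chi> i. real s *\<^sub>R V s $ i))"
      using elim equivalent_shear[of 1 "real s" "normal_basis (X s) (V s)" 0] by simp
    then show ?case using elim reach_equivalent equivalent_trans by blast
  qed
  then show ?thesis by simp
qed

section \<open>Generating all linear maps of the second factor\<close>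

lemma det_scale_rows: "det (\<chi> j. c j *\<^sub>R (v::real^'n^'n) $ j) = prod c UNIV * det v"
  using det_rows_mul[of c "\<lambda>j. v $ j"] by (simp add: scalar_mult_eq_scaleR vec_lambda_eta)

lemma reach_lat_cong: "lat a = lat b \<Longrightarrow> reach U b \<Longrightarrow> reach U a"
  by (metis reach_equivalent equivalent_lat)

text \<open>A Euclidean step with s = n on the product lattice divides row i by -n and leaves 1/n as
  a first coordinate, which \<open>reach_normal_basis\<close> removes; the sign is invisible to the
  lattice.\<close>

lemma reach_div_row:
  fixes v :: "real^'n^'n"
  assumes U: "open U" and v: "det v \<noteq> 0" and n: "n > 0"
    and r: "reach U (normal_basis 0 (\<chi> j. if j = i then (1 / real n) *\<^sub>R v $ i else v $ j))"
  shows "reach U (normal_basis 0 v)"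
proof -
  let ?v1 = "\<chi> j. if j = i then - (1 / real n) *\<^sub>R v $ i else v $ j"
  obtain u where e: "equivalent (normal_basis 0 v) (normal_basis u ?v1)"
    using equivalent_step[of n 0 i v] n by (simp cong: if_cong)
  then have "det ?v1 \<noteq> 0" using v full_rank_normal_basis equivalent_full_rank by blast
  moreover have "reach U (normal_basis 0 ?v1)"
    by (rule reach_lat_cong[OF lat_signs r]) (auto simp: normal_basis_def split: option.split)
  ultimately show ?thesis using reach_normal_basis[OF U] reach_equivalent[OF e] by blast
qed

lemma reach_div_rows:
  fixes v :: "real^'n^'n" and n :: "'n \<Rightarrow> nat"
  assumes U: "open U" and v: "det v \<noteq> 0" and n: "\<And>j. n j > 0"
    and r: "reach U (normal_basis 0 (\<chi> j. (1 / real (n j)) *\<^sub>R v $ j))"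
  shows "reach U (normal_basis 0 v)"
proof -
  have "reach U (normal_basis 0 (\<chi> j. (if j \<in> I then 1 / real (n j) else 1) *\<^sub>R v $ j)) \<Longrightarrow>
      reach U (normal_basis 0 v)" for I
  proof (induction I rule: infinite_finite_induct)
    case (infinite A)
    then show ?case by simp
  next
    case empty
    then show ?case by (simp add: vec_lambda_eta)
  next
    case (insert i I)
    let ?w = "\<chi> j. (if j \<in> I then 1 / real (n j) else 1) *\<^sub>R v $ j"
    have "det ?w \<noteq> 0" unfolding det_scale_rows using v n by (auto simp: less_imp_neq)
    moreover have "(\<chi> j. (if j \<in> insert i I then 1 / real (n j) else 1) *\<^sub>R v $ j)
       = (\<chi> j. if j = i then (1 / real (n i)) *\<^sub>R ?w $ i else ?w $ j)"
      using insert.hyps by (auto simp: vec_eq_iff)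
    ultimately have "reach U (normal_basis 0 ?w)"
      using reach_div_row[OF U _ n[of i], of ?w i] insert.prems by simp
    then show ?case by (rule insert.IH)
  qed
  from this[of UNIV] r show ?thesis by simp
qed

lemma equivalent_scale: "c > 0 \<Longrightarrow> equivalent (normal_basis 0 v) (normal_basis 0 (c *\<^sub>R v))"
proof -
  assume "c > 0"
  have "normal_basis 0 (c *\<^sub>R v) = (\<chi> k. shear 1 c 0 (normal_basis 0 v $ k))"
    by (auto simp: vec_eq_iff normal_basis_def shear_def split: option.split)
  then show ?thesis using equivalent_shear[of 1 c "normal_basis 0 v" 0] \<open>c > 0\<close> by simp
qed

text \<open>Only divisions of single rows are available, but a common factor is free: multiplying by
  n j is multiplying by the product N of all n i and dividing by the product m j of the
  others.\<close>

lemma reach_int_diagonal: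
  fixes v :: "real^'n^'n" and p :: "'n \<Rightarrow> int"
  assumes U: "open U" and v: "det v \<noteq> 0" and p: "\<And>j. p j \<noteq> 0"
    and r: "reach U (normal_basis 0 (\<chi> j. of_int (p j) *\<^sub>R v $ j))"
  shows "reach U (normal_basis 0 v)"
proof -
  define n where "n = (\<lambda>j. nat \<bar>p j\<bar>)"
  define N where "N = (\<Prod>j\<in>UNIV. n j)"
  define m where "m = (\<lambda>j. \<Prod>i\<in>UNIV - {j}. n i)"
  have n: "n j > 0" for j using p by (simp add: n_def)
  then have N: "N > 0" by (simp add: N_def prod_pos)
  have m: "m j > 0" for j using n by (simp add: m_def prod_pos)
  have nm: "N = n j * m j" for j
    unfolding N_def m_def by (rule prod.remove) auto
  have nmr: "real N / real (m j) = real (n j)" for j using nm[of j] m[of j] by simp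
  have "reach U (normal_basis 0 (\<chi> j. real (n j) *\<^sub>R v $ j))"
    by (rule reach_lat_cong[OF lat_signs r]) (auto simp: normal_basis_def n_def split: option.split)
  moreover have "(\<chi> j. real (n j) *\<^sub>R v $ j) = real N *\<^sub>R (\<chi> j. (1 / real (m j)) *\<^sub>R v $ j)"
    by (simp add: vec_eq_iff nmr[symmetric])
  ultimately have "reach U (normal_basis 0 (\<chi> j. (1 / real (m j)) *\<^sub>R v $ j))"
    using reach_equivalent[OF equivalent_scale[of "real N" "\<chi> j. (1 / real (m j)) *\<^sub>R v $ j"]] N by simp
  with U v m show ?thesis by (rule reach_div_rows)
qed

lemma floor_scaled_tendsto: "(\<lambda>s::nat. of_int \<lfloor>real s * c\<rfloor> / real s) \<longlonglongrightarrow> c"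
proof (rule tendsto_sandwich)
  show "(\<lambda>s::nat. c - 1 / real s) \<longlonglongrightarrow> c"
    using tendsto_diff[OF tendsto_const lim_1_over_n] by simp
  show "\<forall>\<^sub>F s in sequentially. c - 1 / real s \<le> of_int \<lfloor>real s * c\<rfloor> / real s"
    using eventually_gt_at_top[of 0]
  proof eventually_elim
    case (elim s)
    have "real s * c - 1 \<le> of_int \<lfloor>real s * c\<rfloor>" by linarith
    then have "(real s * c - 1) / real s \<le> of_int \<lfloor>real s * c\<rfloor> / real s"
      by (rule divide_right_mono) simp
    then show ?case using elim by (simp add: diff_divide_distrib)
  qed
  show "\<forall>\<^sub>F s in sequentially. of_int \<lfloor>real s * c\<rfloor> / real s \<le> c"
    using eventually_gt_at_top[of 0]
  proof eventually_elim
    case (elim s)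
    have "of_int \<lfloor>real s * c\<rfloor> \<le> real s * c" by linarith
    then show ?case using elim by (simp add: field_simps)
  qed
qed (rule tendsto_const)

text \<open>Rational diagonal entries with common denominator s differ from integer ones by the free
  common factor 1/s. They are dense, and reaching \<open>U\<close> is open.\<close>

lemma reach_diagonal:
  fixes v :: "real^'n^'n" and c :: "'n \<Rightarrow> real"
  assumes U: "open U" and v: "det v \<noteq> 0" and c: "\<And>j. c j \<noteq> 0"
    and r: "reach U (normal_basis 0 (\<chi> j. c j *\<^sub>R v $ j))"
  shows "reach U (normal_basis 0 v)"
proof -
  define p where "p = (\<lambda>s j. \<lfloor>real s * c j\<rfloor>)"
  have lim1: "(\<lambda>s. of_int (p s j) / real s) \<longlonglongrightarrow> c j" for j
    unfolding p_def by (rule floor_scaled_tendsto)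
  let ?X = "\<lambda>s. normal_basis 0 (\<chi> j. (of_int (p s j) / real s) *\<^sub>R v $ j)"
  have lim: "?X \<longlonglongrightarrow> normal_basis 0 (\<chi> j. c j *\<^sub>R v $ j)"
  proof (rule vec_tendstoI)
    fix k :: "'n option"
    show "(\<lambda>s. ?X s $ k) \<longlonglongrightarrow> normal_basis 0 (\<chi> j. c j *\<^sub>R v $ j) $ k"
      by (cases k) (auto intro!: tendsto_intros lim1)
  qed
  have "det (\<chi> j. c j *\<^sub>R v $ j) \<noteq> 0" unfolding det_scale_rows using v c by simp
  then have "full_rank (normal_basis 0 (\<chi> j. c j *\<^sub>R v $ j))" by (simp add: full_rank_normal_basis)
  then have "\<forall>\<^sub>F b in nhds (normal_basis 0 (\<chi> j. c j *\<^sub>R v $ j)). reach U b"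
    using reach_open[OF dim_option _ U r] by blast
  then have "\<forall>\<^sub>F s in sequentially. reach U (?X s)"
    using lim unfolding filterlim_iff by blast
  moreover have "\<forall>\<^sub>F s in sequentially. \<forall>j. of_int (p s j) / real s \<noteq> 0"
    by (intro eventually_all_finite tendsto_imp_eventually_ne[OF lim1 c])
  moreover have "\<forall>\<^sub>F s in sequentially. s > 0" by (rule eventually_gt_at_top)
  ultimately have "\<forall>\<^sub>F s in sequentially. reach U (normal_basis 0 v)"
  proof eventually_elim
    case (elim s)
    have "(\<chi> j. (of_int (p s j) / real s) *\<^sub>R v $ j) = (1 / real s) *\<^sub>R (\<chi> j. of_int (p s j) *\<^sub>R v $ j)"
      by (simp add: vec_eq_iff)
    then have "reach U (normal_basis 0 (\<chi> j. of_int (p s j) *\<^sub>R v $ j))"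
      using elim(1,3) reach_equivalent[OF equivalent_scale[of "1 / real s" "\<chi> j.
          of_int (p s j) *\<^sub>R v $ j"]] by simp
    moreover have "p s j \<noteq> 0" for j using elim(2) by auto
    ultimately show ?case using reach_int_diagonal[OF U v, of "p s"] by blast
  qed
  then show ?thesis by simp
qed

text \<open>Decomposition into elementary matrices: swaps and row additions with coefficient 1 keep
  the lattice, and diagonal matrices were treated above. The quantifier over \<open>v\<close> sits
  inside the induction because a product acts first by B on \<open>v\<close> and then by A on B
  v.\<close>

lemma reach_matrix_mult:
  fixes T :: "real^'n^'n"
  assumes U: "open U"
  shows "det T \<noteq> 0 \<longrightarrow> (\<forall>v. det v \<noteq> 0 \<longrightarrow> reach U (normal_basis 0 (T ** v)) \<longrightarrow> reach U (normal_basis 0 v))"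
proof (induction T rule: induct_matrix_elementary_alt)
  case (1 A B)
  show ?case
  proof (intro impI allI)
    fix v assume d: "det (A ** B) \<noteq> 0" "det v \<noteq> 0" and r: "reach U (normal_basis 0 (A ** B ** v))"
    have "det A \<noteq> 0" "det B \<noteq> 0" "det (B ** v) \<noteq> 0" using d by (auto simp: det_mul)
    then show "reach U (normal_basis 0 v)" using 1 d r by (metis matrix_mul_assoc)
  qed
next
  case (2 A i)
  then show ?case by (simp add: det_zero_row)
next
  case (3 A)
  show ?case
  proof (intro impI allI)
    fix v assume d: "det A \<noteq> 0" "det v \<noteq> 0" and r: "reach U (normal_basis 0 (A ** v))"
    have "det A = (\<Prod>i\<in>UNIV. A $ i $ i)" using det_diagonal 3 by blast
    with d have nz: "A $ i $ i \<noteq> 0" for i by auto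
    have "(A ** v) $ i = A $ i $ i *\<^sub>R v $ i" for i
    proof -
      have "(\<Sum>k\<in>UNIV. A $ i $ k * v $ k $ j) = A $ i $ i * v $ i $ j" for j
        using 3 by (subst sum.remove[of _ i]) (auto intro!: sum.neutral)
      then show ?thesis by (simp add: matrix_matrix_mult_def vec_eq_iff)
    qed
    then have "A ** v = (\<chi> i. A $ i $ i *\<^sub>R v $ i)" by (simp add: vec_eq_iff)
    then show "reach U (normal_basis 0 v)" using reach_diagonal[OF U d(2), of "\<lambda>i.
        A $ i $ i"] nz r by simp
  qed
next
  case (4 m n)
  show ?case
  proof (intro impI allI)
    fix v :: "real^'n^'n" assume r: "reach U (normal_basis 0 ((\<chi> i j.
        mat 1 $ i $ Transposition.transpose m n j) ** v))"
    have "((\<chi> i j. mat 1 $ i $ Transposition.transpose m n j) ** v) $ i =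
        v $ (Transposition.transpose m n i)" for i
    proof -
      have "(\<Sum>k\<in>UNIV. mat 1 $ i $ Transposition.transpose m n k * v $ k $ j)
         = (\<Sum>k\<in>UNIV. if k = Transposition.transpose m n i then v $ k $ j else 0)" for j
        by (rule sum.cong) (auto simp: mat_def)
      then show ?thesis by (simp add: matrix_matrix_mult_def vec_eq_iff)
    qed
    then have e: "normal_basis 0 ((\<chi> i j. mat 1 $ i $ Transposition.transpose m n j) ** v)
       = (\<chi> k. normal_basis 0 v $ (Transposition.transpose (Some m) (Some n) k))"
      by (auto simp: vec_eq_iff normal_basis_def Transposition.transpose_def split: option.split)
    show "reach U (normal_basis 0 v)"
        using r unfolding e by (rule reach_lat_cong[rotated]) (simp add: lat_swap)
  qed
next
  case (5 m n)
  show ?case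
  proof (intro impI allI)
    fix v :: "real^'n^'n" assume r: "reach U (normal_basis 0 ((\<chi> i j. of_bool (i = m \<and> j = n \<or> i =
        j)) ** v))"
    have E: "((\<chi> i j. of_bool (i = m \<and> j = n \<or> i = j)) ** v) $ i = (if i =
        m then v $ m + v $ n else v $ i)" for i
    proof -
      have "(\<Sum>k\<in>UNIV. of_bool (i = m \<and> k = n \<or> i = k) * v $ k $ j)
         = (\<Sum>k\<in>UNIV. (if k = i then v $ k $ j else 0) + (if k = n \<and> i = m then v $ k $ j else 0))" for j
        using 5 by (intro sum.cong) auto
      then show ?thesis by (simp add: matrix_matrix_mult_def vec_eq_iff sum.distrib)
    qed
    show "reach U (normal_basis 0 v)"
    proof (rule reach_lat_cong[OF _ r], rule lat_eqI)
      fix k :: "'n option"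
      define b where "b = normal_basis 0 v"
      define b' where "b' = normal_basis 0 ((\<chi> i j. of_bool (i = m \<and> j = n \<or> i = j)) ** v)"
      have h: "b $ Some m = b' $ Some m - b' $ Some n" "k \<noteq> Some m \<Longrightarrow> b $ k = b' $ k"
        using 5 E unfolding b_def b'_def by (cases k; simp)+
      have "b $ k \<in> lat b'" using h by (metis lat_diff lat_basis)
      then show "normal_basis 0 v $ k \<in> lat (normal_basis 0 ((\<chi> i j. of_bool (i = m \<and> j = n \<or> i =
          j)) ** v))"
        by (simp only: b_def b'_def)
      have h': "b' $ Some m = b $ Some m + b $ Some n" "k \<noteq> Some m \<Longrightarrow> b' $ k = b $ k"
        using 5 E unfolding b_def b'_def by (cases k; simp)+
      have "b' $ k \<in> lat b" using h' by (metis lat_add lat_basis)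
      then show "normal_basis 0 ((\<chi> i j. of_bool (i = m \<and> j = n \<or> i =
          j)) ** v) $ k \<in> lat (normal_basis 0 v)"
        by (simp only: b_def b'_def)
    qed
  qed
qed

text \<open>Commensurable first coordinates allow the subtractive Euclidean algorithm: as long as
  two of them are nonzero, the smaller is subtracted from the larger, which lowers the sum of the
  absolute values of \<open>p\<close>.\<close>

lemma lat_euclid:
  fixes b :: "(real \<times> 'v::real_vector)^'k"
  assumes "\<And>k. fst (b $ k) = of_int (p k) * c"
  shows "\<exists>(b'::(real \<times> 'v)^'k) k0. lat b' = lat b \<and> (\<forall>k. k \<noteq> k0 \<longrightarrow> fst (b' $ k) = 0)"
  using assms
proof (induction "\<Sum>k\<in>UNIV. nat \<bar>p k\<bar>" arbitrary: p b rule: less_induct)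
  case less
  show ?case
  proof (cases "\<exists>i j. i \<noteq> j \<and> p i \<noteq> 0 \<and> p j \<noteq> 0")
    case False
    then obtain k0 where "\<forall>k. k \<noteq> k0 \<longrightarrow> p k = 0" by metis
    then have "\<forall>k. k \<noteq> k0 \<longrightarrow> fst (b $ k) = 0" using less.prems by simp
    then show ?thesis by blast
  next
    case True
    then obtain i j where ij: "i \<noteq> j" "p j \<noteq> 0" "\<bar>p j\<bar> \<le> \<bar>p i\<bar>"
      by (metis linear)
    \<comment> \<open>With this sign, s p j points in the direction of p i, so the subtraction moves
      p i towards zero.\<close>
    define s where "s = sgn (p i) * sgn (p j)"
    define p' where "p' = (\<lambda>k. if k = i then p i - s * p j else p k)"
    define b' where "b' = (\<chi> k. if k = i then b $ i - of_int s *\<^sub>R b $ j else b $ k)"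
    have "\<bar>p i - s * p j\<bar> < \<bar>p i\<bar>"
      using ij unfolding s_def by (auto simp: sgn_if split: if_splits)
    then have "(\<Sum>k\<in>UNIV. nat \<bar>p' k\<bar>) < (\<Sum>k\<in>UNIV. nat \<bar>p k\<bar>)"
      by (intro sum_strict_mono_ex1) (auto simp: p'_def)
    moreover have "fst (b' $ k) = of_int (p' k) * c" for k
      using less.prems by (simp add: b'_def p'_def algebra_simps)
    ultimately obtain b2 :: "(real \<times> 'v)^'k" and k0
      where b2: "lat b2 = lat b'" "\<forall>k. k \<noteq> k0 \<longrightarrow> fst (b2 $ k) = 0"
      using less.hyps[of p' b'] by blast
    have "lat b' = lat b"
    proof (rule lat_eqI)
      fix k
      show "b' $ k \<in> lat b" by (auto simp: b'_def intro!: lat_diff lat_scale lat_basis)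
      have h: "b $ i = b' $ i + of_int s *\<^sub>R b' $ j" "k \<noteq> i \<Longrightarrow> b $ k = b' $ k"
        using ij by (auto simp: b'_def)
      show "b $ k \<in> lat b'"
        using h by (metis lat_add lat_scale lat_basis)
    qed
    then show ?thesis using b2 by blast
  qed
qed

text \<open>A lower bound for linear combinations survives a perturbation of the basis uniformly in
  the coefficients. This yields openness of full rank, and later a bound on the coefficients of
  short vectors valid for all nearby bases.\<close>

lemma lincomb_perturb:
  fixes b h :: "('a::euclidean_space)^'k"
  assumes "B * norm c \<le> norm (\<Sum>k\<in>UNIV. c $ k *\<^sub>R h $ k)"
  shows "(B - (\<Sum>k\<in>UNIV. norm (b $ k - h $ k))) * norm c \<le> norm (\<Sum>k\<in>UNIV. c $ k *\<^sub>R b $ k)"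
proof -
  have "norm (\<Sum>k\<in>UNIV. c $ k *\<^sub>R (b $ k - h $ k)) \<le> (\<Sum>k\<in>UNIV. norm c * norm (b $ k - h $ k))"
    by (intro sum_norm_le) (auto intro!: mult_right_mono simp: component_le_norm_cart)
  moreover have "(\<Sum>k\<in>UNIV. c $ k *\<^sub>R b $ k) = (\<Sum>k\<in>UNIV. c $ k *\<^sub>R h $ k) + (\<Sum>k\<in>UNIV.
      c $ k *\<^sub>R (b $ k - h $ k))"
    by (simp add: sum.distrib[symmetric] algebra_simps)
  ultimately show ?thesis using assms norm_diff_ineq[of "\<Sum>k\<in>UNIV. c $ k *\<^sub>R h $ k" "\<Sum>k\<in>UNIV.
      c $ k *\<^sub>R (b $ k - h $ k)"]
    by (simp add: sum_distrib_left algebra_simps)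
qed

lemma full_rank_perturb:
  fixes h :: "('a::euclidean_space)^'k"
  assumes dim: "DIM('a) = CARD('k)" and h: "full_rank h"
  shows "\<forall>\<^sub>F b in nhds h. full_rank b"
proof -
  obtain B where B: "B > 0" "\<And>c::real^'k. B * norm c \<le> norm (\<Sum>k\<in>UNIV. c $ k *\<^sub>R h $ k)"
    using full_rank_bounded_below[OF dim h] by blast
  have "full_rank b" if b: "(\<Sum>k\<in>UNIV. norm (b $ k - h $ k)) < B" for b
  proof -
    have "c = 0" if "(\<Sum>k\<in>UNIV. c $ k *\<^sub>R b $ k) = 0" for c :: "real^'k"
      using lincomb_perturb[OF B(2)[of c], of b] that b
      by (metis diff_gt_0_iff_gt mult_pos_pos norm_zero not_le zero_less_norm_iff)
    then show ?thesis
      using full_rank_iff_inj[OF dim, of b] linear_injective_0[OF lincomb_linear[of b]] by blast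
  qed
  moreover have "((\<lambda>b. \<Sum>k\<in>UNIV. norm (b $ k - h $ k)) \<longlongrightarrow> (\<Sum>k\<in>UNIV. norm (h $ k - h $ k))) (nhds h)"
    by (intro tendsto_intros tendsto_vec_nth) (simp add: filterlim_ident)
  then have "\<forall>\<^sub>F b in nhds h. (\<Sum>k\<in>UNIV. norm (b $ k - h $ k)) < B"
    by (rule order_tendstoD) (use B in simp)
  ultimately show ?thesis by (rule eventually_mono[rotated])
qed

lemma full_rank_fst:
  fixes b :: "(real \<times> 'v::real_vector)^'k"
  assumes "full_rank b" shows "\<exists>k. fst (b $ k) \<noteq> 0"
proof (rule ccontr)
  assume "\<nexists>k. fst (b $ k) \<noteq> 0"
  moreover obtain c :: "real^'k" where "(\<Sum>k\<in>UNIV. c $ k *\<^sub>R b $ k) = (1, 0)"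
    using assms unfolding full_rank_iff_surj surj_def by metis
  then have "fst (\<Sum>k\<in>UNIV. c $ k *\<^sub>R b $ k) = 1" by simp
  ultimately show False by (simp add: fst_sum)
qed

text \<open>Both lattices are put in normal form, and the matrix v w' carries the rows of one to
  those of the other. The two sides are not symmetric: the first coordinates of \<open>b\<close> may
  be removed in a limit, while the target must be an exact product, hence its approximation by
  one.\<close>

theorem reach_full_rank:
  fixes b h :: "(real \<times> (real^'n))^('n option)"
  assumes U: "open U" "h \<in> U" "full_rank h" and b: "full_rank b"
  shows "reach U b"
proof -
  \<comment> \<open>Rounding the first coordinates of \<open>h\<close> to rationals lets the Euclidean algorithm split its lattice.\<close>
  let ?h = "\<lambda>s::nat. (\<chi> k. (of_int \<lfloor>real s * fst (h $ k)\<rfloor> / real s, snd (h $ k)))"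
  have lim: "?h \<longlonglongrightarrow> h"
  proof (rule vec_tendstoI)
    fix k
    have "(\<lambda>s. ?h s $ k) \<longlonglongrightarrow> (fst (h $ k), snd (h $ k))"
      unfolding vec_lambda_beta by (intro tendsto_Pair floor_scaled_tendsto tendsto_const)
    then show "(\<lambda>s. ?h s $ k) \<longlonglongrightarrow> h $ k" by simp
  qed
  have "\<forall>\<^sub>F s in sequentially. full_rank (?h s)"
    using full_rank_perturb[OF dim_option U(3)] lim unfolding filterlim_iff by blast
  moreover have "\<forall>\<^sub>F s in sequentially. ?h s \<in> U"
    using topological_tendstoD[OF lim U(1,2)] .
  ultimately have "\<forall>\<^sub>F s in sequentially. full_rank (?h s) \<and> ?h s \<in> U" by eventually_elim simp
  then obtain s where s: "full_rank (?h s)" "?h s \<in> U"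
    by (auto simp: eventually_sequentially)
  obtain a :: "(real \<times> (real^'n))^('n option)" and k0 where a: "lat a = lat (?h s)" "\<forall>k. k \<noteq> k0 \<longrightarrow>
      fst (a $ k) = 0"
    using lat_euclid[of "?h s" "\<lambda>k. \<lfloor>real s * fst (h $ k)\<rfloor>" "1 / real s"] by auto
  have "full_rank a" using a s by (simp add: full_rank_def)
  then have "fst (a $ k0) \<noteq> 0" using full_rank_fst a(2) by metis
  then obtain v where v: "equivalent a (normal_basis 0 v)"
    using equivalent_normal_basis[of a k0] a(2) by metis
  then have dv: "det v \<noteq> 0" using \<open>full_rank a\<close> equivalent_full_rank full_rank_normal_basis by blast
  have "equivalent (normal_basis 0 v) (?h s)"
    using equivalent_sym[OF equivalent_trans[OF equivalent_lat[OF a(1)] v]] .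
  then have rv: "reach U (normal_basis 0 v)" using s by (auto simp: reach_def)
  obtain k1 where "fst (b $ k1) \<noteq> 0" using full_rank_fst b by blast
  then obtain u w where w: "equivalent b (normal_basis u w)"
    using equivalent_normal_basis[of b k1] by metis
  then have dw: "det w \<noteq> 0" using b equivalent_full_rank full_rank_normal_basis by blast
  then obtain w' where w': "w' ** w = mat 1"
    using invertible_det_nz invertible_left_inverse by metis
  have "(v ** w') ** w = v" by (simp add: matrix_mul_assoc[symmetric] w')
  moreover have "det (v ** w') \<noteq> 0" using dv w' by (metis calculation det_mul mult_zero_left)
  ultimately have "reach U (normal_basis 0 w)"
    using reach_matrix_mult[OF U(1), of "v ** w'"] dw rv by metis
  then show ?thesis using reach_normal_basis[OF U(1) dw] reach_equivalent[OF w] by blast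
qed

section \<open>Density points and singular vectors\<close>

text \<open>
  With \<open>m\<close> the outer measure of \<open>S\<close>, a Vitali cover inside a slightly larger open set gives
  \<open>m \<le> c m\<close> up to an arbitrarily small error.
\<close>

lemma negligible_if_small_density_bounded:
  fixes S :: "'a::euclidean_space set"
  assumes c: "0 < c" "c < 1" and S: "bounded S"
    and dens: "\<And>x r. x \<in> S \<Longrightarrow> r > 0 \<Longrightarrow> \<exists>d U. 0 < d \<and> d < r \<and> S \<inter> ball x d \<subseteq> U \<and> U \<in> lmeasurable \<and>
                 measure lebesgue U \<le> c * measure lebesgue (ball x d)"
  shows "negligible S"
proof -
  define m where "m = Inf (measure lebesgue ` {U. S \<subseteq> U \<and> U \<in> lmeasurable})"
  obtain a R where R: "S \<subseteq> cball a R" using S by (auto simp: bounded_subset_cball)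
  have ne: "measure lebesgue ` {U. S \<subseteq> U \<and> U \<in> lmeasurable} \<noteq> {}" using R by auto
  have bdd: "bdd_below (measure lebesgue ` {U. S \<subseteq> U \<and> U \<in> lmeasurable})"
    by (rule bdd_belowI[of _ 0]) auto
  have mle: "m \<le> measure lebesgue U" if "S \<subseteq> U" "U \<in> lmeasurable" for U
    unfolding m_def using that bdd by (intro cInf_lower) auto
  have "m \<ge> 0" unfolding m_def by (rule cInf_greatest[OF ne]) auto
  have "m \<le> 0"
  proof (rule ccontr)
    assume "\<not> m \<le> 0"
    \<comment> \<open>This leaves room for an open superset of measure below m / c; \<open>c\<close>
      times its measure bounds a cover of \<open>S\<close> up to a null set, which then has measure
      below m.\<close>
    then have "m < m / c" using c by (simp add: field_simps)
    then obtain U0 where U0: "S \<subseteq> U0" "U0 \<in> lmeasurable" "measure lebesgue U0 < m / c"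
      using cInf_lessD[OF ne] unfolding m_def by blast
    obtain V where V: "open V" "U0 \<subseteq> V" "V \<in> lmeasurable" "measure lebesgue V < m / c"
    proof -
      let ?e = "m / c - measure lebesgue U0"
      have e0: "?e > 0" using U0(3) by simp
      obtain V where V: "open V" "U0 \<subseteq> V" "V - U0 \<in> lmeasurable"
          "emeasure lebesgue (V - U0) < ennreal ?e"
        using sets_lebesgue_outer_open[OF fmeasurableD[OF U0(2)] e0] by metis
      have "measure lebesgue (V - U0) < ?e"
        using V(3,4) e0 by (simp add: emeasure_eq_measure2 ennreal_less_iff)
      then have "V \<in> lmeasurable" "measure lebesgue V < m / c"
        using V U0(2) by (auto simp: measurable_measure_Diff dest!: fmeasurable_Diff_D)
      with V show ?thesis using that by blast
    qed
    define good where "good = (\<lambda>x d U. S \<inter> ball x d \<subseteq> U \<and> U \<in> lmeasurable \<and>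
                 measure lebesgue U \<le> c * measure lebesgue (ball x d))"
    define K where "K = {(x, d). 0 < d \<and> ball x d \<subseteq> V \<and> (\<exists>U. good x d U)}"
    have "\<exists>i. i \<in> K \<and> x \<in> ball (fst i) (snd i) \<and> snd i < r" if xS: "x \<in> S" and r0: "r > 0" for x r
    proof -
      obtain e where e: "e > 0" "ball x e \<subseteq> V" using openE[OF V(1), of x] V(2) U0(1) xS by blast
      obtain d U where "0 < d" "d < min r e" "good x d U"
        using dens[OF xS, of "min r e"] r0 e(1) unfolding good_def by auto
      moreover have "ball x d \<subseteq> V" using e \<open>d < min r e\<close> subset_ball[of d e x] by auto
      ultimately show ?thesis by (intro exI[of _ "(x, d)"]) (auto simp: K_def)
    qed
    then obtain C where C: "countable C" "C \<subseteq> K"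
      and disj: "pairwise (\<lambda>i j. disjnt (ball (fst i) (snd i)) (ball (fst j) (snd j))) C"
      and neg: "negligible (S - (\<Union>i \<in> C. ball (fst i) (snd i)))"
      by (rule Vitali_covering_theorem_balls)
    have "\<forall>i\<in>C. \<exists>U. good (fst i) (snd i) U" using C by (auto simp: K_def)
    then obtain U where U: "\<And>i. i \<in> C \<Longrightarrow> good (fst i) (snd i) (U i)" by metis
    have bd: "measure lebesgue (\<Union>i\<in>D. U i) \<le> c * measure lebesgue V" if D: "D \<subseteq> C" "finite D" for D
    proof -
      have "measure lebesgue (\<Union>i\<in>D. U i) \<le> (\<Sum>i\<in>D. measure lebesgue (U i))"
        using D U unfolding good_def by (intro measure_UNION_le) auto
      also have "\<dots> \<le> (\<Sum>i\<in>D. c * measure lebesgue (ball (fst i) (snd i)))"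
        using D U unfolding good_def by (intro sum_mono) auto
      also have "\<dots> = c * measure lebesgue (\<Union>i\<in>D. ball (fst i) (snd i))"
      proof -
        have "measure lebesgue (\<Union>i\<in>D. ball (fst i) (snd i)) = (\<Sum>i\<in>D.
            measure lebesgue (ball (fst i) (snd i)))"
          using D disj by (intro measure_UNION') (auto intro: pairwise_subset)
        then show ?thesis by (simp add: sum_distrib_left)
      qed
      also have "\<dots> \<le> c * measure lebesgue V"
      proof -
        have "ball (fst i) (snd i) \<subseteq> V" if "i \<in> D" for i
        proof -
          have "i \<in> K" using that D C by blast
          then show ?thesis by (simp add: K_def case_prod_beta)
        qed
        then have "(\<Union>i\<in>D. ball (fst i) (snd i)) \<subseteq> V" by blast
        moreover have "(\<Union>i\<in>D. ball (fst i) (snd i)) \<in> sets lebesgue"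
          using D(2) by (intro sets.finite_UN) auto
        ultimately show ?thesis using c V(3) by (intro mult_left_mono measure_mono_fmeasurable) auto
      qed
      finally show ?thesis .
    qed
    have Um: "U i \<in> lmeasurable" if "i \<in> C" for i using U that by (auto simp: good_def)
    have WL: "(\<Union>i\<in>C. U i) \<in> lmeasurable"
      by (rule fmeasurable_UN_bound[OF C(1) Um bd])
    have WB: "measure lebesgue (\<Union>i\<in>C. U i) \<le> c * measure lebesgue V"
      by (rule measure_UN_bound[OF C(1) Um bd])
    let ?N = "S - (\<Union>i \<in> C. ball (fst i) (snd i))"
    have N: "?N \<in> lmeasurable" "measure lebesgue ?N = 0"
      using neg negligible_iff_measure by blast+
    have "S \<inter> ball (fst i) (snd i) \<subseteq> U i" if "i \<in> C" for i using U[OF that] by (simp add: good_def)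
    then have sub: "S \<subseteq> (\<Union>i\<in>C. U i) \<union> ?N" by blast
    have "m \<le> measure lebesgue ((\<Union>i\<in>C. U i) \<union> ?N)"
      using WL N(1) sub by (intro mle) auto
    also have "\<dots> \<le> measure lebesgue (\<Union>i\<in>C. U i) + measure lebesgue ?N"
      using WL N(1) by (intro measure_Un_le) auto
    also have "\<dots> \<le> c * measure lebesgue V" using WB N(2) by simp
    also have "\<dots> < c * (m / c)" by (intro mult_strict_left_mono V(4) c(1))
    finally show False using c by simp
  qed
  show ?thesis unfolding negligible_outer
  proof (intro allI impI)
    fix e :: real assume "e > 0"
    then have "Inf (measure lebesgue ` {U. S \<subseteq> U \<and> U \<in> lmeasurable}) < e" using \<open>m \<le> 0\<close> m_def by simp
    then show "\<exists>T. S \<subseteq> T \<and> T \<in> lmeasurable \<and> measure lebesgue T < e"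
      using cInf_lessD[OF ne] by blast
  qed
qed

text \<open>Cutting with balls of integer radius reduces to the bounded case. The supersets
  \<open>U\<close> stand in for the intersections with \<open>S\<close>, whose measurability is not
  assumed.\<close>

lemma negligible_if_small_density:
  fixes S :: "'a::euclidean_space set"
  assumes c: "0 < c" "c < 1"
    and dens: "\<And>x r. x \<in> S \<Longrightarrow> r > 0 \<Longrightarrow> \<exists>d U. 0 < d \<and> d < r \<and> S \<inter> ball x d \<subseteq> U \<and> U \<in> lmeasurable \<and>
                 measure lebesgue U \<le> c * measure lebesgue (ball x d)"
  shows "negligible S"
proof -
  have "negligible (S \<inter> ball 0 (real n))" for n
  proof (rule negligible_if_small_density_bounded[OF c])
    show "bounded (S \<inter> ball 0 (real n))" by (simp add: bounded_Int)
    fix x and r :: real assume "x \<in> S \<inter> ball 0 (real n)" "r > 0"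
    then show "\<exists>d U. 0 < d \<and> d < r \<and> (S \<inter> ball 0 (real n)) \<inter> ball x d \<subseteq> U \<and> U \<in> lmeasurable \<and>
                 measure lebesgue U \<le> c * measure lebesgue (ball x d)"
      using dens[of x r] by (meson IntD1 Int_mono inf_le1 order_refl order_trans)
  qed
  then have "negligible (\<Union>n. S \<inter> ball 0 (real n))" by (rule negligible_Union_nat)
  moreover have "S \<subseteq> (\<Union>n. S \<inter> ball 0 (real n))"
    by (auto simp: reals_Archimedean2)
  ultimately show ?thesis using negligible_subset by blast
qed

section \<open>Singular vectors form a null set\<close>

lemma card_int_interval_le:
  fixes a b :: real
  assumes "a \<le> b"
  shows "finite {z::int. a \<le> of_int z \<and> of_int z \<le> b}" "real (card {z::int. a \<le> of_int z \<and>
      of_int z \<le> b}) \<le> b - a + 1"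
proof -
  have eq: "{z::int. a \<le> of_int z \<and> of_int z \<le> b} = {\<lceil>a\<rceil>..\<lfloor>b\<rfloor>}"
    by (auto simp: le_floor_iff ceiling_le_iff)
  show "finite {z::int. a \<le> of_int z \<and> of_int z \<le> b}" by (simp add: eq)
  have "real (nat (\<lfloor>b\<rfloor> - \<lceil>a\<rceil> + 1)) \<le> b - a + 1"
    using assms by linarith
  then show "real (card {z::int. a \<le> of_int z \<and> of_int z \<le> b}) \<le> b - a + 1" by (simp add: eq)
qed

text \<open>If k \<beta> is within \<tau> of an integer vector, then \<beta> lies in a cube of side
  2 \<tau> / k around a point of (1/k) \<int>^n. At most 2 k r + 2 \<tau> + 1 \<le> 2 k r + 2
  integers per coordinate are possible for \<beta> in the ball.\<close>

lemma near_integer_cover: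
  fixes x :: "real^'n" and k :: nat
  assumes r: "r > 0" and t: "0 \<le> \<tau>" "\<tau> \<le> 1/2" and k: "k \<ge> 1"
  obtains U where "{\<beta> \<in> ball x r. \<exists>z::'n\<Rightarrow>int. \<forall>i. \<bar>real k * \<beta> $ i + of_int (z i)\<bar> \<le> \<tau>} \<subseteq> U"
    "U \<in> lmeasurable" "measure lebesgue U \<le> (2 * \<tau> * (2 * r + 2 / real k)) ^ CARD('n)"
proof -
  define Zi where "Zi = (\<lambda>i. {z::int. - real k * (x $ i + r) - \<tau> \<le> of_int z \<and> of_int z \<le>
      - real k * (x $ i - r) + \<tau>})"
  define Z where "Z = PiE UNIV Zi"
  define Q where "Q = (\<lambda>z::'n\<Rightarrow>int. cbox (\<chi> i. (- of_int (z i) - \<tau>) / real k) (\<chi> i.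
      (- of_int (z i) + \<tau>) / real k))"
  have le: "- real k * (x $ i + r) - \<tau> \<le> - real k * (x $ i - r) + \<tau>" for i
    using r t k by (simp add: algebra_simps)
  have fin: "finite (Zi i)" for i using card_int_interval_le[OF le] by (simp add: Zi_def)
  have cardi: "real (card (Zi i)) \<le> 2 * real k * r + 2" for i
    using card_int_interval_le(2)[OF le, of i] t by (simp add: Zi_def algebra_simps)
  have finZ: "finite Z" unfolding Z_def by (intro finite_PiE fin) auto
  have "real (card Z) = (\<Prod>i\<in>UNIV. real (card (Zi i)))" by (simp add: Z_def card_PiE)
  also have "\<dots> \<le> (\<Prod>i\<in>(UNIV::'n set). 2 * real k * r + 2)" by (intro prod_mono) (auto simp: cardi)
  finally have cardZ: "real (card Z) \<le> (2 * real k * r + 2) ^ CARD('n)" by simp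
  have Q: "measure lebesgue (Q z) = (2 * \<tau> / real k) ^ CARD('n)" for z
  proof -
    have "Q z \<noteq> {}" unfolding Q_def using t k
      by (simp add: interval_ne_empty_cart divide_right_mono)
    then have "measure lebesgue (Q z) = (\<Prod>i\<in>(UNIV::'n set).
        (- of_int (z i) + \<tau>) / real k - (- of_int (z i) - \<tau>) / real k)"
      unfolding Q_def using content_cbox_cart by fastforce
    also have "\<dots> = (\<Prod>i\<in>(UNIV::'n set). 2 * \<tau> / real k)"
        by (intro prod.cong) (simp_all add: diff_divide_distrib add_divide_distrib)
    finally show ?thesis by simp
  qed
  show ?thesis
  proof (rule that[of "\<Union>z\<in>Z. Q z"])
    show "(\<Union>z\<in>Z. Q z) \<in> lmeasurable" using finZ by (intro fmeasurable.finite_UN) (auto simp: Q_def)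
    have "measure lebesgue (\<Union>z\<in>Z. Q z) \<le> (\<Sum>z\<in>Z. measure lebesgue (Q z))"
      using finZ by (intro measure_UNION_le) (auto simp: Q_def)
    also have "\<dots> = real (card Z) * (2 * \<tau> / real k) ^ CARD('n)" by (simp add: Q)
    also have "\<dots> \<le> (2 * real k * r + 2) ^ CARD('n) * (2 * \<tau> / real k) ^ CARD('n)"
      using cardZ t by (intro mult_right_mono) auto
    also have "\<dots> = (2 * \<tau> * (2 * r + 2 / real k)) ^ CARD('n)"
    proof -
      have "(2 * real k * r + 2) * (2 * \<tau> / real k) = 2 * \<tau> * (2 * r + 2 / real k)"
        using k by (simp add: field_simps)
      then show ?thesis by (simp only: power_mult_distrib[symmetric])
    qed
    finally show "measure lebesgue (\<Union>z\<in>Z. Q z) \<le> (2 * \<tau> * (2 * r + 2 / real k)) ^ CARD('n)" .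
    show "{\<beta> \<in> ball x r. \<exists>z::'n\<Rightarrow>int. \<forall>i. \<bar>real k * \<beta> $ i + of_int (z i)\<bar> \<le> \<tau>} \<subseteq> (\<Union>z\<in>Z. Q z)"
    proof clarify
      fix \<beta> z assume b: "\<beta> \<in> ball x r" and z: "\<forall>i. \<bar>real k * \<beta> $ i + of_int (z i)\<bar> \<le> \<tau>"
      have bi: "\<bar>\<beta> $ i - x $ i\<bar> \<le> r" for i
        using component_le_norm_cart[of "\<beta> - x" i] b by (simp add: dist_norm norm_minus_commute)
      have "z i \<in> Zi i" for i
      proof -
        have "real k * (x $ i - r) \<le> real k * \<beta> $ i" "real k * \<beta> $ i \<le> real k * (x $ i + r)"
          using bi[of i] by (intro mult_left_mono; simp add: abs_le_iff)+
        moreover have "\<bar>real k * \<beta> $ i + of_int (z i)\<bar> \<le> \<tau>" using z by blast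
        ultimately show ?thesis unfolding Zi_def by simp linarith
      qed
      then have "z \<in> Z" by (auto simp: Z_def)
      moreover have "\<beta> \<in> Q z"
        using z k by (auto simp: Q_def mem_box_cart field_simps abs_le_iff)
      ultimately show "\<beta> \<in> (\<Union>z\<in>Z. Q z)" by blast
    qed
  qed
qed

text \<open>Dirichlet's theorem on simultaneous approximation cannot be improved by the factor
  \<eta> at height H.\<close>

definition nonsingular_at :: "real \<Rightarrow> nat \<Rightarrow> real^'n \<Rightarrow> bool" where
  "nonsingular_at \<eta> H \<beta> \<longleftrightarrow> (\<forall>k\<in>{1..H}. \<forall>z::'n\<Rightarrow>int. \<exists>i.
      \<bar>real k * \<beta> $ i + of_int (z i)\<bar> > \<eta> / root CARD('n) (real H))"

text \<open>At a single height H the exceptional \<beta> in a ball of radius r are covered by the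
  cubes for k = 1, ..., H. For k beyond about 1/r the cover has size proportional to the ball, with
  a factor controlled by \<eta>; the finitely many smaller k contribute O(1/H). Hence \<eta> can be
  fixed once for all balls, and every ball is at most half filled.\<close>

lemma singular_negligible:
  "\<exists>\<eta>>0. \<eta> < 1 \<and> negligible {\<beta>::real^'n. \<exists>H0. \<forall>H\<ge>H0. \<not> nonsingular_at \<eta> H \<beta>}"
proof -
  let ?d = "CARD('n)"
  define \<omega> where "\<omega> = measure lebesgue (ball (0::real^'n) 1)"
  have w: "\<omega> > 0" unfolding \<omega>_def by (simp add: content_ball_pos)
  \<comment> \<open>The two contributions below add up to at most 2 (8 \<eta> r)^d, which must not
    exceed half of \<omega> r^d. As \<eta> < 1 gives \<eta>^d \<le> \<eta>, a linear bound on \<eta>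
    is enough.\<close>
  define \<eta> where "\<eta> = min (1/2) (\<omega> / (4 * 8 ^ ?d))"
  have e: "\<eta> > 0" "\<eta> \<le> 1/2" using w by (auto simp: \<eta>_def)
  have "\<eta> ^ ?d \<le> \<eta> ^ 1" using e by (intro power_decreasing) auto
  also have "\<dots> \<le> \<omega> / (4 * 8 ^ ?d)" by (simp add: \<eta>_def)
  finally have ed: "4 * (8 * \<eta>) ^ ?d \<le> \<omega>" by (simp add: field_simps power_mult_distrib)
  define S where "S = (\<lambda>H0. {\<beta>::real^'n. \<forall>H\<ge>H0. \<exists>k\<in>{1..H}. \<exists>z::'n\<Rightarrow>int.
       \<forall>i. \<bar>real k * \<beta> $ i + of_int (z i)\<bar> \<le> \<eta> / root ?d (real H)})"
  have "negligible (S H0)" for H0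
  proof (rule negligible_if_small_density[of "1/2"])
    fix x :: "real^'n" and r0 :: real assume "r0 > 0"
    define r where "r = r0 / 2"
    have r: "r > 0" "r < r0" using \<open>r0 > 0\<close> by (auto simp: r_def)
    \<comment> \<open>Beyond K the term 2/k is at most 2 r. The terms up to K add up to at most M /
      H, and H1 is chosen to make this at most (8 \<eta> r)^d.\<close>
    define K where "K = nat \<lceil>1 / r\<rceil>"
    define M where "M = real K * (2 ^ ?d * (2 * r + 2) ^ ?d) * \<eta> ^ ?d"
    obtain H1 :: nat where H1: "M / (8 * \<eta> * r) ^ ?d < real H1" using reals_Archimedean2 by blast
    define H where "H = max (max H0 H1) 1"
    have H: "H \<ge> H0" "H \<ge> 1" "M \<le> real H * (8 * \<eta> * r) ^ ?d"
    proof -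
      have "M < real H1 * (8 * \<eta> * r) ^ ?d" using H1 e r by (simp add: field_simps)
      also have "\<dots> \<le> real H * (8 * \<eta> * r) ^ ?d" using e r by (intro mult_right_mono) (auto simp: H_def)
      finally show "M \<le> real H * (8 * \<eta> * r) ^ ?d" by simp
    qed (auto simp: H_def)
    define \<tau> where "\<tau> = \<eta> / root ?d (real H)"
    have rt: "root ?d (real H) \<ge> 1" using H by simp
    have t: "0 \<le> \<tau>" "\<tau> \<le> 1/2" "\<tau> ^ ?d = \<eta> ^ ?d / real H"
    proof -
      show "0 \<le> \<tau>" using rt e by (simp add: \<tau>_def)
      have "\<tau> \<le> \<eta> / 1" unfolding \<tau>_def using rt e by (intro divide_left_mono) auto
      then show "\<tau> \<le> 1/2" using e by simp
      show "\<tau> ^ ?d = \<eta> ^ ?d / real H" unfolding \<tau>_def by (simp add: power_divide)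
    qed
    define B where "B = (\<lambda>k. {\<beta> \<in> ball x r. \<exists>z::'n\<Rightarrow>int. \<forall>i. \<bar>real k * \<beta> $ i + of_int (z i)\<bar> \<le> \<tau>})"
    have "\<exists>U. B k \<subseteq> U \<and> U \<in> lmeasurable \<and> measure lebesgue U \<le> (2 * \<tau> * (2 * r + 2 / real k)) ^ ?d"
      if "k \<in> {1..H}" for k
    proof -
      have "k \<ge> 1" using that by simp
      show ?thesis unfolding B_def
        by (rule near_integer_cover[OF r(1) t(1,2) \<open>k \<ge> 1\<close>, of x]) (intro exI conjI)
    qed
    then obtain U where U: "\<And>k. k \<in> {1..H} \<Longrightarrow> B k \<subseteq> U k"
      "\<And>k. k \<in> {1..H} \<Longrightarrow> U k \<in> lmeasurable"
      "\<And>k. k \<in> {1..H} \<Longrightarrow> measure lebesgue (U k) \<le> (2 * \<tau> * (2 * r + 2 / real k)) ^ ?d"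
      by metis
    have "measure lebesgue (\<Union>k\<in>{1..H}. U k) \<le> (\<Sum>k\<in>{1..H}. measure lebesgue (U k))"
      using U by (intro measure_UNION_le) auto
    also have "\<dots> \<le> (\<Sum>k\<in>{1..H}. (if k \<le>
        K then (2 * \<tau> * (2 * r + 2)) ^ ?d else 0) + (2 * \<tau> * (4 * r)) ^ ?d)"
    proof (rule sum_mono)
      fix k assume k: "k \<in> {1..H}"
      have "(2 * \<tau> * (2 * r + 2 / real k)) ^ ?d \<le> (if k \<le>
          K then (2 * \<tau> * (2 * r + 2)) ^ ?d else 0) + (2 * \<tau> * (4 * r)) ^ ?d"
      proof (cases "k \<le> K")
        case True
        have "2 / real k \<le> 2" using k by (simp add: field_simps)
        then have "(2 * \<tau> * (2 * r + 2 / real k)) ^ ?d \<le> (2 * \<tau> * (2 * r + 2)) ^ ?d"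
          using t r k by (intro power_mono mult_left_mono) auto
        moreover have "0 \<le> (2 * \<tau> * (4 * r)) ^ ?d" using t r by simp
        ultimately show ?thesis using True by (simp only: if_True)
      next
        case False
        then have "1 / r \<le> real k" unfolding K_def by linarith
        then have "2 / real k \<le> 2 * r" using r k by (simp add: field_simps)
        then have "(2 * \<tau> * (2 * r + 2 / real k)) ^ ?d \<le> (2 * \<tau> * (4 * r)) ^ ?d"
          using t r k by (intro power_mono mult_left_mono) auto
        then show ?thesis using False by simp
      qed
      then show "measure lebesgue (U k) \<le> (if k \<le>
          K then (2 * \<tau> * (2 * r + 2)) ^ ?d else 0) + (2 * \<tau> * (4 * r)) ^ ?d"
        using U(3)[OF k] by linarith
    qed
    also have "\<dots> = (\<Sum>k\<in>{1..H}. (if k \<le>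
        K then (2 * \<tau> * (2 * r + 2)) ^ ?d else 0)) + real H * (2 * \<tau> * (4 * r)) ^ ?d"
      by (simp add: sum.distrib)
    also have "(\<Sum>k\<in>{1..H}. (if k \<le> K then (2 * \<tau> * (2 * r + 2)) ^ ?d else 0)) \<le>
        real K * (2 * \<tau> * (2 * r + 2)) ^ ?d"
    proof -
      have "(\<Sum>k\<in>{1..H}. (if k \<le> K then (2 * \<tau> * (2 * r + 2)) ^ ?d else 0)) =
          real (card ({1..H} \<inter> {k. k \<le> K})) * (2 * \<tau> * (2 * r + 2)) ^ ?d"
        by (simp add: sum.If_cases)
      moreover have "card ({1..H} \<inter> {k. k \<le> K}) \<le> card {1..K}" by (rule card_mono) auto
      ultimately show ?thesis using t r by (simp add: mult_right_mono)
    qed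
    also have "real K * (2 * \<tau> * (2 * r + 2)) ^ ?d = M / real H"
      by (simp add: M_def power_mult_distrib t(3))
    also have "real H * (2 * \<tau> * (4 * r)) ^ ?d = (8 * \<eta> * r) ^ ?d"
    proof -
      have "(8::real) ^ ?d = 2 ^ ?d * 4 ^ ?d" by (simp flip: power_mult_distrib)
      then show ?thesis using H by (simp add: power_mult_distrib t(3))
    qed
    also have "M / real H + (8 * \<eta> * r) ^ ?d \<le> 2 * (8 * \<eta> * r) ^ ?d"
      using H(2,3) by (simp add: field_simps)
    also have "\<dots> \<le> 1/2 * (r ^ ?d * \<omega>)"
      using ed r by (simp add: power_mult_distrib field_simps)
    also have "r ^ ?d * \<omega> = measure lebesgue (ball x r)"
      unfolding \<omega>_def using content_ball_conv_unit_ball[of r x] r by simp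
    finally have bound: "measure lebesgue (\<Union>k\<in>{1..H}. U k) \<le> 1/2 * measure lebesgue (ball x r)" by simp
    have "S H0 \<inter> ball x r \<subseteq> (\<Union>k\<in>{1..H}. U k)"
    proof
      fix \<beta> assume b: "\<beta> \<in> S H0 \<inter> ball x r"
      then obtain k z where "k \<in> {1..H}" "\<forall>i. \<bar>real k * \<beta> $ i + of_int (z i)\<bar> \<le> \<tau>"
        using H(1) unfolding S_def \<tau>_def by blast
      then have "\<beta> \<in> B k" using b by (auto simp: B_def)
      then show "\<beta> \<in> (\<Union>k\<in>{1..H}. U k)" using U(1) \<open>k \<in> {1..H}\<close> by blast
    qed
    moreover have "(\<Union>k\<in>{1..H}. U k) \<in> lmeasurable" using U(2) by (intro fmeasurable.finite_UN) auto
    ultimately show "\<exists>d U. 0 < d \<and> d < r0 \<and> S H0 \<inter> ball x d \<subseteq> U \<and> U \<in> lmeasurable \<and>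
                 measure lebesgue U \<le> 1/2 * measure lebesgue (ball x d)"
      using r bound by blast
  qed auto
  then have "negligible (\<Union>H0. S H0)" by (rule negligible_Union_nat)
  moreover have "(\<Union>H0. S H0) = {\<beta>. \<exists>H0. \<forall>H\<ge>H0. \<not> nonsingular_at \<eta> H \<beta>}"
    by (auto simp: S_def nonsingular_at_def not_less)
  ultimately show ?thesis using e by (intro exI[of _ \<eta>]) auto
qed

section \<open>Bounded lattice bases\<close>

lemma lat_finite_bounded:
  fixes b :: "('a::euclidean_space)^'k"
  assumes "DIM('a) = CARD('k)" "full_rank b"
  shows "finite {x \<in> lat b. norm x \<le> R}"
proof -
  obtain B where B: "B > 0" "\<And>c::real^'k. B * norm c \<le> norm (\<Sum>k\<in>UNIV. c $ k *\<^sub>R b $ k)"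
    using full_rank_bounded_below[OF assms] by blast
  define N where "N = \<lceil>R / B\<rceil>"
  define F where "F = (\<lambda>z::'k\<Rightarrow>int. \<Sum>k\<in>UNIV. of_int (z k) *\<^sub>R b $ k)"
  have "{x \<in> lat b. norm x \<le> R} \<subseteq> F ` PiE UNIV (\<lambda>_. {-N..N})"
  proof
    fix x assume "x \<in> {x \<in> lat b. norm x \<le> R}"
    then obtain z where z: "x = F z" "norm (F z) \<le> R" by (auto simp: lat_def F_def)
    have "z k \<in> {-N..N}" for k
    proof -
      have "\<bar>(\<chi> k. real_of_int (z k)) $ k\<bar> \<le> norm (\<chi> k. real_of_int (z k))"
        by (rule component_le_norm_cart)
      also have "\<dots> \<le> R / B"
        using B(2)[of "\<chi> k. real_of_int (z k)"] z(2) B(1) by (simp add: F_def field_simps)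
      finally have "\<bar>real_of_int (z k)\<bar> \<le> real_of_int N" unfolding N_def by simp linarith
      then have "- N \<le> z k" "z k \<le> N" by linarith+
      then show ?thesis by simp
    qed
    then show "x \<in> F ` PiE UNIV (\<lambda>_. {-N..N})" using z by auto
  qed
  then show ?thesis by (rule finite_subset) (intro finite_imageI finite_PiE, auto)
qed

text \<open>
  Adding \<open>a\<close> to \<open>S\<close>, the new basis vector is one whose coefficient at \<open>a\<close> is positive and minimal.
\<close>

lemma lat_adapted_basis:
  fixes B :: "('a::euclidean_space)^'k" and S :: "'a set"
  assumes disc: "\<And>R. finite {x \<in> lat B. norm x \<le> R}"
    and "finite S" "independent S" "S \<subseteq> lat B"
  shows "\<exists>f. (\<forall>s\<in>S. f s \<in> lat B \<and> norm (f s) \<le> (\<Sum>s\<in>S. norm s)) \<and>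
     (\<forall>x \<in> lat B \<inter> span S. \<exists>z::'a\<Rightarrow>int. x = (\<Sum>s\<in>S. of_int (z s) *\<^sub>R f s))"
  using assms(2-)
proof (induction S rule: finite_induct)
  case empty
  then show ?case by auto
next
  case (insert a S)
  have a: "a \<notin> span S" and ind: "independent S"
    using insert.prems(1) insert.hyps by (auto simp: independent_insert)
  have aL: "a \<in> lat B" and SL: "S \<subseteq> lat B" using insert.prems by auto
  obtain f where f: "\<And>s. s \<in> S \<Longrightarrow> f s \<in> lat B" "\<And>s. s \<in> S \<Longrightarrow> norm (f s) \<le> (\<Sum>s\<in>S. norm s)"
    and fz: "\<And>x. x \<in> lat B \<Longrightarrow> x \<in> span S \<Longrightarrow> \<exists>z::'a\<Rightarrow>int. x = (\<Sum>s\<in>S. of_int (z s) *\<^sub>R f s)"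
    using insert.IH[OF ind SL] by blast
  have uniq: "c = c'" if "x - c *\<^sub>R a \<in> span S" "x - c' *\<^sub>R a \<in> span S" for x c c'
  proof (rule ccontr)
    assume "c \<noteq> c'"
    have "(x - c *\<^sub>R a) - (x - c' *\<^sub>R a) \<in> span S" using that by (rule span_diff)
    moreover have "(x - c *\<^sub>R a) - (x - c' *\<^sub>R a) = (c' - c) *\<^sub>R a" by (simp add: algebra_simps)
    ultimately have "(1 / (c' - c)) *\<^sub>R (c' - c) *\<^sub>R a \<in> span S" by (metis span_scale)
    with \<open>c \<noteq> c'\<close> a show False by simp
  qed
  define R where "R = norm a + (\<Sum>s\<in>S. norm s)"
  define F where "F = {x \<in> lat B. norm x \<le> R}"
  define C where "C = {c. 0 < c \<and> c \<le> 1 \<and> (\<exists>x \<in> lat B. x - c *\<^sub>R a \<in> span S)}"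
  \<comment> \<open>Removing the integer parts of the coefficients along \<open>S\<close> leaves a
    lattice vector of norm at most R with the same coefficient at \<open>a\<close>. There are
    finitely many such vectors, so \<open>C\<close> is finite and has a minimum.\<close>
  have red: "\<exists>x\<in>F. x - c *\<^sub>R a \<in> span S" if cC: "c \<in> C" for c
  proof -
    obtain x where x: "0 < c" "c \<le> 1" "x \<in> lat B" "x - c *\<^sub>R a \<in> span S" using cC by (auto simp: C_def)
    then obtain t where t: "x - c *\<^sub>R a = (\<Sum>s\<in>S. t s *\<^sub>R s)"
      using span_finite[OF insert.hyps(1)] by auto
    define y where "y = x - (\<Sum>s\<in>S. of_int \<lfloor>t s\<rfloor> *\<^sub>R s)"
    have y: "y - c *\<^sub>R a = (\<Sum>s\<in>S. frac (t s) *\<^sub>R s)"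
      using t by (simp add: y_def frac_def scaleR_left_diff_distrib sum_subtractf algebra_simps)
    have "y \<in> lat B" unfolding y_def using x SL by (intro lat_diff lat_sum lat_scale) auto
    moreover have "norm y \<le> R"
    proof -
      have "norm (\<Sum>s\<in>S. frac (t s) *\<^sub>R s) \<le> (\<Sum>s\<in>S. norm s)"
      proof (rule sum_norm_le)
        fix s
        have "frac (t s) * norm s \<le> 1 * norm s"
          by (intro mult_right_mono) (auto simp: frac_lt_1 less_imp_le)
        then show "norm (frac (t s) *\<^sub>R s) \<le> norm s" by (simp add: frac_ge_0)
      qed
      moreover have "norm (c *\<^sub>R a) \<le> norm a" using x by (simp add: mult_left_le_one_le)
      moreover have yeq: "y = c *\<^sub>R a + (\<Sum>s\<in>S. frac (t s) *\<^sub>R s)" using y by (simp add: algebra_simps)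
      ultimately show ?thesis unfolding R_def yeq
        using norm_triangle_ineq[of "c *\<^sub>R a" "\<Sum>s\<in>S. frac (t s) *\<^sub>R s"] by linarith
    qed
    moreover have "y - c *\<^sub>R a \<in> span S" unfolding y by (intro span_sum span_scale span_base)
    ultimately show ?thesis by (auto simp: F_def)
  qed
  then obtain g where g: "\<And>c. c \<in> C \<Longrightarrow> g c \<in> F" "\<And>c. c \<in> C \<Longrightarrow> g c - c *\<^sub>R a \<in> span S" by metis
  have "inj_on g C" by (rule inj_onI) (metis g(2) uniq)
  moreover have "g ` C \<subseteq> F" using g by blast
  moreover have "finite F" unfolding F_def by (rule disc)
  ultimately have finC: "finite C" by (meson inj_on_finite)
  have "1 \<in> C" using aL by (auto simp: C_def intro!: bexI[of _ a] span_zero)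
  define c where "c = Min C"
  have cC: "c \<in> C" unfolding c_def using finC \<open>1 \<in> C\<close> by (intro Min_in) auto
  have cmin: "c \<le> c'" if "c' \<in> C" for c' unfolding c_def using finC that by simp
  have c: "0 < c" "c \<le> 1" using cC by (auto simp: C_def)
  define x0 where "x0 = g c"
  have x0: "x0 \<in> lat B" "norm x0 \<le> R" "x0 - c *\<^sub>R a \<in> span S"
    using g[OF cC] by (auto simp: x0_def F_def)
  define f' where "f' = f(a := x0)"
  have f'S: "s \<in> S \<Longrightarrow> f' s = f s" for s using insert.hyps by (auto simp: f'_def)
  have "\<exists>z::'a\<Rightarrow>int. x = (\<Sum>s\<in>insert a S. of_int (z s) *\<^sub>R f' s)" if x: "x \<in> lat B"
      "x \<in> span (insert a S)" for x
  proof -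
    obtain k where k: "x - k *\<^sub>R a \<in> span S" using x(2) by (auto simp: span_breakdown_eq)
    define q where "q = \<lfloor>k / c\<rfloor>"
    define y where "y = x - of_int q *\<^sub>R x0"
    have yL: "y \<in> lat B" unfolding y_def using x x0 by (intro lat_diff lat_scale)
    have "(x - k *\<^sub>R a) - of_int q *\<^sub>R (x0 - c *\<^sub>R a) \<in> span S"
      using span_diff[OF k span_scale[OF x0(3)]] .
    then have ys: "y - (k - of_int q * c) *\<^sub>R a \<in> span S" by (simp add: y_def algebra_simps)
    have "of_int q \<le> k / c" "k / c < of_int q + 1" unfolding q_def by linarith+
    then have q: "0 \<le> k - of_int q * c" "k - of_int q * c < c" using c by (simp_all add: field_simps)
    \<comment> \<open>Division with remainder: a nonzero remainder would be an element of
      \<open>C\<close> below its minimum.\<close>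
    have "k - of_int q * c = 0"
    proof (rule ccontr)
      assume "k - of_int q * c \<noteq> 0"
      then have "k - of_int q * c \<in> C" using q c yL ys by (auto simp: C_def)
      then show False using cmin q by fastforce
    qed
    with ys have "y \<in> span S" by simp
    then obtain z :: "'a \<Rightarrow> int" where z: "y = (\<Sum>s\<in>S. of_int (z s) *\<^sub>R f s)" using fz yL by blast
    have "x = (\<Sum>s\<in>insert a S. of_int ((z(a := q)) s) *\<^sub>R f' s)"
    proof -
      have "(\<Sum>s\<in>S. of_int ((z(a := q)) s) *\<^sub>R f' s) = (\<Sum>s\<in>S. of_int (z s) *\<^sub>R f s)"
        using insert.hyps by (intro sum.cong) (auto simp: f'_def)
      then have "(\<Sum>s\<in>insert a S. of_int ((z(a := q)) s) *\<^sub>R f' s) = of_int q *\<^sub>R x0 + y"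
        using insert.hyps z by (simp add: f'_def)
      then show ?thesis by (simp add: y_def)
    qed
    then show ?thesis by blast
  qed
  moreover have "f' s \<in> lat B \<and> norm (f' s) \<le> (\<Sum>s\<in>insert a S. norm s)" if "s \<in> insert a S" for s
  proof (cases "s = a")
    case True
    then show ?thesis using x0 insert.hyps by (simp add: f'_def R_def)
  next
    case False
    then have "s \<in> S" using that by simp
    then have "f s \<in> lat B" "norm (f s) \<le> (\<Sum>s\<in>S. norm s)" using f by auto
    then show ?thesis using False insert.hyps norm_ge_zero[of a]
      by (auto simp: f'_def simp del: norm_ge_zero)
  qed
  ultimately show ?case by (intro exI[of _ f']) blast
qed

text \<open>Independent short lattice vectors may span a proper sublattice. The adapted basis
  repairs this at the cost of bounding each vector by the sum of their norms.\<close>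

lemma lat_bounded_basis:
  fixes B :: "('a::euclidean_space)^'k"
  assumes dim: "DIM('a) = CARD('k)" and B: "full_rank B"
    and sp: "span {x \<in> lat B. norm x \<le> C} = UNIV"
  obtains b :: "'a^'k" where "lat b = lat B" "\<And>k. norm (b $ k) \<le> real CARD('k) * C"
proof -
  let ?V = "{x \<in> lat B. norm x \<le> C}"
  obtain S where S: "S \<subseteq> ?V" "independent S" "?V \<subseteq> span S"
    using maximal_independent_subset by blast
  have finS: "finite S" using S(2) by (rule independent_imp_finite)
  have spS: "span S = UNIV" using S(3) sp span_minimal[OF S(3) subspace_span] by auto
  have cS: "card S = CARD('k)"
    using dim_eq_card[OF _ S(2), of UNIV] spS dim by simp
  obtain f where f: "\<And>s. s \<in> S \<Longrightarrow> f s \<in> lat B" "\<And>s. s \<in> S \<Longrightarrow> norm (f s) \<le> (\<Sum>s\<in>S. norm s)"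
    and fz: "\<And>x. x \<in> lat B \<Longrightarrow> \<exists>z::'a\<Rightarrow>int. x = (\<Sum>s\<in>S. of_int (z s) *\<^sub>R f s)"
  proof -
    have "S \<subseteq> lat B" using S(1) by blast
    from lat_adapted_basis[OF lat_finite_bounded[OF dim B] finS S(2) this] obtain f where
      "\<forall>s\<in>S. f s \<in> lat B \<and> norm (f s) \<le> (\<Sum>s\<in>S. norm s)"
      "\<forall>x \<in> lat B. \<exists>z::'a\<Rightarrow>int. x = (\<Sum>s\<in>S. of_int (z s) *\<^sub>R f s)"
      unfolding spS Int_UNIV_right by blast
    then show ?thesis by (intro that[of f]) blast+
  qed
  obtain g where g: "bij_betw g (UNIV::'k set) S"
    using finite_same_card_bij[of "UNIV::'k set" S] finS cS by auto
  define b where "b = (\<chi> k. f (g k))"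
  have gS: "g k \<in> S" for k using g by (auto simp: bij_betw_def)
  show ?thesis
  proof (rule that[of b])
    show "lat b = lat B"
    proof
      show "lat b \<subseteq> lat B" by (rule lat_subsetI) (simp add: b_def f gS)
      show "lat B \<subseteq> lat b"
      proof
        fix x assume "x \<in> lat B"
        then obtain z :: "'a \<Rightarrow> int" where "x = (\<Sum>s\<in>S. of_int (z s) *\<^sub>R f s)" using fz by blast
        also have "\<dots> = (\<Sum>k\<in>UNIV. of_int (z (g k)) *\<^sub>R b $ k)"
          using sum.reindex_bij_betw[OF g, of "\<lambda>s. of_int (z s) *\<^sub>R f s"] by (simp add: b_def)
        finally show "x \<in> lat b" using lat_memI[of "\<lambda>k. z (g k)" b] by simp
      qed
    qed
    fix k
    have "norm (b $ k) \<le> (\<Sum>s\<in>S. norm s)" using f(2)[OF gS] by (simp add: b_def)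
    also have "\<dots> \<le> (\<Sum>s\<in>S. C)" using S(1) by (intro sum_mono) auto
    finally show "norm (b $ k) \<le> real CARD('k) * C" using cS by simp
  qed
qed

section \<open>The lattice of a Kronecker sequence\<close>

text \<open>Only \<int>^n is used at this stage; a general lattice enters at the end through a
  matrix acting on the second factor.\<close>

definition kronecker_basis :: "real^'n \<Rightarrow> (real \<times> (real^'n))^('n option)" where
  "kronecker_basis \<beta> = (\<chi> k. case k of None \<Rightarrow> (1, \<beta>) | Some i \<Rightarrow> (0, axis i 1))"

lemma sum_axis: "(\<Sum>i\<in>UNIV. c i *\<^sub>R axis i (1::real)) = (\<chi> i::'n::finite. c i)"
  by (simp add: vec_eq_iff axis_def if_distrib cong: if_cong)

lemma lat_kronecker_basis:
  fixes \<beta> :: "real^'n"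
  shows "lat (kronecker_basis \<beta>) = {(of_int k, of_int k *\<^sub>R \<beta> + (\<chi> i.
      of_int (z i))) | k (z::'n\<Rightarrow>int). True}"
  (is "_ = ?R")
proof -
  have s: "(\<Sum>k\<in>UNIV. of_int (z k) *\<^sub>R kronecker_basis \<beta> $ k) =
      (of_int (z None), of_int (z None) *\<^sub>R \<beta> + (\<chi> i. of_int (z (Some i))))"
    for z :: "'n option \<Rightarrow> int"
    by (simp add: sum_option kronecker_basis_def prod_eq_iff fst_sum snd_sum sum_axis)
  show ?thesis
  proof (intro equalityI subsetI)
    fix x assume "x \<in> lat (kronecker_basis \<beta>)"
    then obtain z where "x = (of_int (z None), of_int (z None) *\<^sub>R \<beta> + (\<chi> i. of_int (z (Some i))))"
      unfolding lat_def s by blast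
    then show "x \<in> ?R" by (intro CollectI exI[of _ "z None"] exI[of _ "\<lambda>i. z (Some i)"]) simp
  next
    fix x assume "x \<in> ?R"
    then obtain k z where "x = (of_int k, of_int k *\<^sub>R \<beta> + (\<chi> i. of_int (z i)))" by blast
    then have "x = (\<Sum>j\<in>UNIV. of_int (case_option k z j) *\<^sub>R kronecker_basis \<beta> $ j)" unfolding s by simp
    then show "x \<in> lat (kronecker_basis \<beta>)" using lat_memI[of "case_option k z"
        "kronecker_basis \<beta>"] by simp
  qed
qed

lemma kronecker_basis_shear: "lat (kronecker_basis (\<beta> + x)) = shear 1 1 x ` lat (kronecker_basis \<beta>)"
proof -
  have "kronecker_basis (\<beta> + x) = (\<chi> k. shear 1 1 x (kronecker_basis \<beta> $ k))"
    by (auto simp: vec_eq_iff kronecker_basis_def shear_def split: option.split)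
  then show ?thesis using lat_linear[OF shear_linear] by metis
qed

lemma full_rank_kronecker_basis: "full_rank (kronecker_basis \<beta>)"
proof -
  have "kronecker_basis \<beta> = (\<chi> k. shear 1 1 \<beta> (normal_basis 0 (mat 1) $ k))"
    by (auto simp: vec_eq_iff kronecker_basis_def shear_def normal_basis_def mat_def axis_def split: option.split)
  moreover have "full_rank (normal_basis 0 (mat 1 :: real^'n^'n))" by (simp add: full_rank_normal_basis)
  ultimately show ?thesis
    using equivalent_full_rank[OF equivalent_shear[of 1 1 "normal_basis 0 (mat 1)" \<beta>]] by simp
qed

definition coord :: "real \<times> (real^'n) \<Rightarrow> 'n option \<Rightarrow> real" where
  "coord x k = (case k of None \<Rightarrow> fst x | Some i \<Rightarrow> snd x $ i)"

lemma coord_diff: "coord (x - y) k = coord x k - coord y k"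
  by (cases k) (auto simp: coord_def)

lemma inner_coord: "x \<bullet> y = (\<Sum>k\<in>UNIV. coord x k * coord y k)"
  by (simp add: inner_prod_def sum_option coord_def inner_vec_def)

lemma coord_le_norm: "\<bar>coord x k\<bar> \<le> norm x"
proof (cases k)
  case None
  then show ?thesis using norm_fst_le[of "fst x" "snd x"] by (simp add: coord_def)
next
  case (Some i)
  then show ?thesis using component_le_norm_cart[of "snd x" i] norm_snd_le[of "snd x" "fst x"]
    by (simp add: coord_def)
qed

lemma norm_le_coord: "norm (x :: real \<times> (real^'n)) \<le> (\<Sum>k\<in>UNIV. \<bar>coord x k\<bar>)"
proof -
  have "norm x \<le> norm (fst x) + norm (snd x)" by (metis norm_Pair_le prod.collapse)
  also have "\<dots> \<le> \<bar>fst x\<bar> + (\<Sum>i\<in>UNIV. \<bar>snd x $ i\<bar>)" using norm_le_l1_cart[of "snd x"] by simp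
  finally show ?thesis by (simp add: sum_option coord_def)
qed

text \<open>The factors 1/H and H^(1/n) keep the covolume equal to 1 and turn Dirichlet's box at
  height H into a unit cube.\<close>

definition kronecker_lattice :: "nat \<Rightarrow> real^'n \<Rightarrow> (real \<times> (real^'n)) set" where
  "kronecker_lattice H \<beta> = shear (1 / real H) (root CARD('n) (real H)) 0 ` lat (kronecker_basis \<beta>)"

lemma kronecker_lattice_iff:
  fixes \<beta> :: "real^'n"
  shows "x \<in> kronecker_lattice H \<beta> \<longleftrightarrow> (\<exists>k (z::'n\<Rightarrow>int). x =
      (of_int k / real H, root CARD('n) (real H) *\<^sub>R (of_int k *\<^sub>R \<beta> + (\<chi> i. of_int (z i)))))"
  unfolding kronecker_lattice_def lat_kronecker_basis by (force simp: shear_def)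

lemma kronecker_lattice_basis:
  fixes \<beta> :: "real^'n"
  obtains B :: "(real \<times> (real^'n))^('n option)" where "lat B = kronecker_lattice H \<beta>" "H \<ge> 1 \<Longrightarrow>
      full_rank B"
proof
  let ?B = "\<chi> k. shear (1 / real H) (root CARD('n) (real H)) 0 (kronecker_basis \<beta> $ k)"
  show l: "lat ?B = kronecker_lattice H \<beta>"
      unfolding kronecker_lattice_def by (rule lat_linear[OF shear_linear])
  assume "H \<ge> 1"
  then have "1 / real H > 0" "root CARD('n) (real H) > 0" by auto
  then show "full_rank ?B" by (rule equivalent_full_rank[OF equivalent_shear full_rank_kronecker_basis])
qed

text \<open>For k = 0 a nonzero integer vector is stretched, for |k| > H the first coordinate
  exceeds 1, and for the remaining k nonsingularity applies to |k| after a change of sign.\<close>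

lemma kronecker_lattice_min:
  fixes \<beta> :: "real^'n"
  assumes \<eta>: "0 < \<eta>" "\<eta> < 1" and H: "H \<ge> 1" and ns: "nonsingular_at \<eta> H \<beta>"
      and x: "x \<in> kronecker_lattice H \<beta>" "x \<noteq> 0"
  shows "\<exists>k. \<bar>coord x k\<bar> \<ge> \<eta>"
proof -
  let ?\<delta> = "root CARD('n) (real H)"
  have \<delta>: "?\<delta> \<ge> 1" using H by simp
  obtain k and z :: "'n \<Rightarrow> int" where xk: "x = (of_int k / real H, ?\<delta> *\<^sub>R (of_int k *\<^sub>R \<beta> + (\<chi> i.
      of_int (z i))))"
    using x(1) kronecker_lattice_iff by blast
  have sn: "coord x (Some i) = ?\<delta> * (of_int k * \<beta> $ i + of_int (z i))" for i by (simp add: xk coord_def)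
  consider "k = 0" | "\<bar>k\<bar> > int H" | "k \<noteq> 0" "\<bar>k\<bar> \<le> int H" by linarith
  then show ?thesis
  proof cases
    case 1
    then obtain i where "z i \<noteq> 0" using x(2) xk by (auto simp: prod_eq_iff vec_eq_iff)
    then have "\<bar>real_of_int (z i)\<bar> \<ge> 1" by linarith
    then have "?\<delta> * \<bar>real_of_int (z i)\<bar> \<ge> 1 * 1" using \<delta> by (intro mult_mono) auto
    then have "\<bar>coord x (Some i)\<bar> \<ge> \<eta>" using 1 \<eta> \<delta> by (simp add: sn abs_mult)
    then show ?thesis by blast
  next
    case 2
    then have "\<bar>real_of_int k\<bar> \<ge> real H" by linarith
    then have "\<bar>coord x None\<bar> \<ge> 1" using H by (simp add: xk coord_def)
    then show ?thesis using \<eta> by (intro exI[of _ None]) auto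
  next
    case 3
    define m where "m = nat \<bar>k\<bar>"
    have m: "m \<in> {1..H}" "real m = \<bar>real_of_int k\<bar>" using 3 by (auto simp: m_def)
    obtain i where i: "\<bar>real m * \<beta> $ i + of_int (sgn k * z i)\<bar> > \<eta> / ?\<delta>"
      using ns[unfolded nonsingular_at_def, rule_format, OF m(1), of "\<lambda>i. sgn k * z i"] by blast
    have "real m * \<beta> $ i + of_int (sgn k * z i) = of_int (sgn k) * (of_int k * \<beta> $ i + of_int (z i))"
      using m(2) 3(1) by (cases "k > 0") (auto simp: algebra_simps)
    then have "\<bar>real m * \<beta> $ i + of_int (sgn k * z i)\<bar> = \<bar>of_int k * \<beta> $ i + of_int (z i)\<bar>"
      using 3(1) by (simp add: abs_mult sgn_if)
    then have "\<eta> < ?\<delta> * \<bar>of_int k * \<beta> $ i + of_int (z i)\<bar>" using i \<delta> by (simp add: field_simps)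
    moreover have "\<bar>coord x (Some i)\<bar> = ?\<delta> * \<bar>of_int k * \<beta> $ i + of_int (z i)\<bar>"
      unfolding sn abs_mult using \<delta> by simp
    ultimately have "\<bar>coord x (Some i)\<bar> \<ge> \<eta>" by linarith
    then show ?thesis by blast
  qed
qed

lemma prod_option: "(\<Prod>k\<in>(UNIV::'n::finite option set). f k) = f None * (\<Prod>i\<in>UNIV. f (Some i))"
  by (simp add: UNIV_option_conv prod.reindex)

lemma card_option_univ: "CARD('n::finite option) = Suc CARD('n)"
  by (simp add: UNIV_option_conv card_image)

text \<open>
  If all short vectors were orthogonal to some \<open>y\<close>, one would cut a large box into cells that are long
  in the coordinate \<open>j\<close> where \<open>y\<close> is largest and short in all others. The lattice has covolume 1, so two
  of its points share a cell; their difference is short, hence orthogonal to \<open>y\<close>, which also bounds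
  its coordinate \<open>j\<close>, contradicting the lower bound on nonzero vectors.
\<close>

lemma kronecker_lattice_short_span:
  fixes \<beta> :: "real^'n"
  assumes \<eta>: "0 < \<eta>" "\<eta> < 1" and H: "H \<ge> 1" and ns: "nonsingular_at \<eta> H \<beta>"
  defines "C \<equiv> 2 ^ CARD('n option) / (\<eta> / CARD('n option)) ^ CARD('n) + 2"
  shows "span {x \<in> kronecker_lattice H \<beta>. norm x \<le> C} = UNIV"
proof (rule ccontr)
  assume "span {x \<in> kronecker_lattice H \<beta>. norm x \<le> C} \<noteq> UNIV"
  then obtain y where y: "y \<noteq> 0" "\<And>x. x \<in> kronecker_lattice H \<beta> \<Longrightarrow> norm x \<le> C \<Longrightarrow> y \<bullet> x = 0"
    using span_not_UNIV_orthogonal[of "{x \<in> kronecker_lattice H \<beta>. norm x \<le>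
        C}"] span_base by (metis (mono_tags, lifting) mem_Collect_eq)
  let ?d = "CARD('n)" and ?n = "CARD('n option)"
  have n: "?n = Suc ?d" by (rule card_option_univ)
  have "\<exists>j. \<forall>k. \<bar>coord y k\<bar> \<le> \<bar>coord y j\<bar>"
  proof -
    have "Max (range (\<lambda>k. \<bar>coord y k\<bar>)) \<in> range (\<lambda>k. \<bar>coord y k\<bar>)" by (rule Max_in) auto
    then obtain j where "Max (range (\<lambda>k. \<bar>coord y k\<bar>)) = \<bar>coord y j\<bar>" by (rule rangeE)
    then have "\<bar>coord y k\<bar> \<le> \<bar>coord y j\<bar>" for k by (metis Max_ge finite finite_imageI rangeI)
    then show ?thesis by blast
  qed
  then obtain j where j: "\<And>k. \<bar>coord y k\<bar> \<le> \<bar>coord y j\<bar>" by blast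
  have yj: "\<bar>coord y j\<bar> > 0"
  proof (rule ccontr)
    assume "\<not> \<bar>coord y j\<bar> > 0"
    then have "\<bar>coord y k\<bar> = 0" for k using j[of k] by linarith
    then have "norm y \<le> 0" using norm_le_coord[of y] by simp
    with y(1) show False by simp
  qed
  define \<delta> where "\<delta> = root ?d (real H)"
  have \<delta>: "\<delta> \<ge> 1" "\<delta> ^ ?d = real H" using H by (auto simp: \<delta>_def)
  \<comment> \<open>The n coordinates other than j then sum to at most n e < \<eta>; orthogonality
    to \<open>y\<close>, whose largest coordinate is j, passes this bound on to coordinate
    j.\<close>
  define e where "e = \<eta> / real ?n"
  have e: "0 < e" "e \<le> \<eta>" "e < 1" "real ?n * e = \<eta>"
    using \<eta> by (auto simp: e_def n field_simps intro: order_le_less_trans)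
  \<comment> \<open>A cell has volume L e^n > 2^(n+1). The factor 2^(n+1) pays for incomplete cells
    at the boundary of the box, so there are fewer cells than points.\<close>
  define L where "L = 2 ^ ?n / e ^ ?d + 1"
  have L: "L \<ge> 1" "2 ^ ?n / e ^ ?d < L" "C = L + 1" using e by (auto simp: L_def C_def e_def)
  define W where "W = nat \<lceil>L\<rceil>"
  have W: "real W \<ge> L" using L by (simp add: W_def)
  have W0: "W > 0" using W L by (cases "W = 0") auto
  define len where "len = (\<lambda>k. if k = j then L else e)"
  define wid where "wid = (\<lambda>k::'n option. case k of None \<Rightarrow> real W | Some i \<Rightarrow> \<delta> * real W)"
  have len0: "len k > 0" for k using L e by (auto simp: len_def)
  have lenW: "len k \<le> wid k" for k
  proof -
    have "real W \<le> \<delta> * real W" using \<delta>(1) mult_right_mono[of 1 \<delta> "real W"] by simp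
    then have "L \<le> real W" "e \<le> real W" "L \<le> \<delta> * real W" "e \<le> \<delta> * real W"
      using L(1) e(3) W by linarith+
    then show ?thesis by (simp add: len_def wid_def split: option.split)
  qed
  \<comment> \<open>The ceiling moves the coordinates of k \<beta> into [0, 1), and \<open>w\<close>
    distributes translates over [0, W). The number H W W^n of points is the volume W (\<delta> W)^n
    of the box.\<close>
  define pt where "pt = (\<lambda>(k::nat, w::'n\<Rightarrow>nat). (real k / real H,
     \<delta> *\<^sub>R (real k *\<^sub>R \<beta> + (\<chi> i. of_int (\<lceil>- (real k * \<beta> $ i)\<rceil> + int (w i))))))"
  define P where "P = {1..H * W} \<times> PiE (UNIV::'n set) (\<lambda>_. {..<W})"
  have finP: "finite P" unfolding P_def by (intro finite_cartesian_product finite_PiE) auto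
  have cardP: "card P = H * W * W ^ ?d" unfolding P_def card_cartesian_product by (subst card_PiE) auto
  have ptM: "pt p \<in> kronecker_lattice H \<beta>" for p
  proof (cases p)
    case (Pair k w)
    then show ?thesis unfolding kronecker_lattice_iff pt_def \<delta>_def
      by (intro exI[of _ "int k"] exI[of _ "\<lambda>i. \<lceil>- (real k * \<beta> $ i)\<rceil> + int (w i)"]) simp
  qed
  have ptW: "0 \<le> coord (pt p) k \<and> coord (pt p) k \<le> wid k" if pP: "p \<in> P" for p k
  proof -
    obtain m w where p: "p = (m, w)" "m \<ge> 1" "m \<le> H * W" "\<And>i. w i < W"
      using pP by (auto simp: P_def PiE_iff)
    show ?thesis
    proof (cases k)
      case None
      have "real m \<le> real H * real W" using p(3) by (metis of_nat_le_iff of_nat_mult)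
      then show ?thesis using None p H by (simp add: coord_def pt_def wid_def field_simps)
    next
      case (Some i)
      let ?t = "real m * \<beta> $ i + of_int (\<lceil>- (real m * \<beta> $ i)\<rceil> + int (w i))"
      have "real (w i) + 1 \<le> real W" using p(4)[of i] by linarith
      moreover have "0 \<le> real m * \<beta> $ i + of_int \<lceil>- (real m * \<beta> $ i)\<rceil>"
          "real m * \<beta> $ i + of_int \<lceil>- (real m * \<beta> $ i)\<rceil> < 1"
        by linarith+
      ultimately have "0 \<le> ?t" "?t \<le> real W" by auto
      then have "0 \<le> \<delta> * ?t" "\<delta> * ?t \<le> \<delta> * real W" using \<delta> by (auto intro: mult_left_mono)
      then show ?thesis using Some p(1) by (simp add: coord_def pt_def wid_def)
    qed
  qed
  define cell where "cell = (\<lambda>p k. \<lfloor>coord (pt p) k / len k\<rfloor>)"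
  define Q where "Q = PiE (UNIV::'n option set) (\<lambda>k. {0..\<lfloor>wid k / len k\<rfloor>})"
  have finQ: "finite Q" unfolding Q_def by (intro finite_PiE) auto
  have sub: "cell ` P \<subseteq> Q"
    unfolding Q_def cell_def using ptW len0
    by (auto simp: less_imp_le intro!: floor_mono divide_right_mono)
  have "real (card Q) = (\<Prod>k\<in>UNIV. real (nat (\<lfloor>wid k / len k\<rfloor> + 1)))" by (simp add: Q_def card_PiE)
  also have "\<dots> \<le> (\<Prod>k\<in>UNIV. 2 * wid k / len k)"
  proof (intro prod_mono conjI)
    fix k
    \<comment> \<open>Doubling absorbs the extra cell only because the box is at least as long as a
      cell in every coordinate.\<close>
    have "1 \<le> wid k / len k" using lenW[of k] len0[of k] by simp
    then show "real (nat (\<lfloor>wid k / len k\<rfloor> + 1)) \<le> 2 * wid k / len k" by linarith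
  qed simp
  also have "\<dots> = 2 ^ ?n * (\<Prod>k\<in>UNIV. wid k) / (\<Prod>k\<in>UNIV. len k)"
    by (simp add: prod_dividef prod.distrib)
  also have "(\<Prod>k\<in>UNIV. wid k) = real W * (\<delta> * real W) ^ ?d" by (simp add: prod_option wid_def)
  also have "\<dots> = real (card P)" by (simp add: cardP power_mult_distrib \<delta>)
  also have "(\<Prod>k\<in>UNIV. len k) = L * e ^ ?d"
  proof -
    have "(\<Prod>k\<in>UNIV. len k) = len j * (\<Prod>k\<in>UNIV - {j}. len k)" by (rule prod.remove) auto
    also have "(\<Prod>k\<in>UNIV - {j}. len k) = (\<Prod>k\<in>UNIV - {j}. e)" by (rule prod.cong) (auto simp: len_def)
    finally show ?thesis by (simp add: len_def n)
  qed
  also have "2 ^ ?n * real (card P) / (L * e ^ ?d) < real (card P)"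
  proof -
    have "card P > 0" using cardP H W0 by simp
    moreover have "2 ^ ?n < L * e ^ ?d" using L(2) e by (simp add: field_simps)
    moreover have "L * e ^ ?d > 0" using L e by simp
    ultimately show ?thesis by (simp add: divide_less_eq mult.commute)
  qed
  finally have "card Q < card P" by simp
  then have "\<not> inj_on cell P" using sub finQ card_inj_on_le by (metis not_le)
  then obtain p p' where pp: "p \<in> P" "p' \<in> P" "p \<noteq> p'" "cell p = cell p'" by (auto simp: inj_on_def)
  define x where "x = pt p - pt p'"
  have xM: "x \<in> kronecker_lattice H \<beta>"
      using ptM kronecker_lattice_basis lat_diff unfolding x_def by metis
  have x0: "x \<noteq> 0"
  proof
    assume "x = 0"
    then have eq: "pt p = pt p'" by (simp add: x_def)
    obtain m w m' w' where p: "p = (m, w)" "p' = (m', w')" by (metis surj_pair)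
    have m: "m = m'" using eq H by (simp add: p pt_def)
    have "\<delta> * (real m * \<beta> $ i + of_int (\<lceil>- (real m * \<beta> $ i)\<rceil> + int (w i))) =
          \<delta> * (real m * \<beta> $ i + of_int (\<lceil>- (real m * \<beta> $ i)\<rceil> + int (w' i)))" for i
      using eq by (auto simp: p pt_def m vec_eq_iff)
    then have "w = w'" using \<delta> by auto
    then show False using pp m p by simp
  qed
  have xlen: "\<bar>coord x k\<bar> < len k" for k
  proof -
    have "\<lfloor>coord (pt p) k / len k\<rfloor> = \<lfloor>coord (pt p') k / len k\<rfloor>" using pp(4) unfolding cell_def by meson
    then have "\<bar>coord (pt p) k / len k - coord (pt p') k / len k\<bar> < 1" by linarith
    then have "\<bar>coord x k / len k\<bar> < 1" by (simp add: x_def coord_diff diff_divide_distrib)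
    then show ?thesis using len0[of k] by (simp add: abs_divide)
  qed
  have others: "(\<Sum>k\<in>UNIV - {j}. \<bar>coord x k\<bar>) \<le> real ?d * e"
  proof -
    have "(\<Sum>k\<in>UNIV - {j}. \<bar>coord x k\<bar>) \<le> (\<Sum>k\<in>UNIV - {j}. e)"
      using xlen by (intro sum_mono) (metis DiffD2 insertI1 len_def less_imp_le)
    then show ?thesis by (simp add: n)
  qed
  have split: "(\<Sum>k\<in>UNIV. f k) = f j + (\<Sum>k\<in>UNIV - {j}. f k)" for f :: "'n option \<Rightarrow> real"
    by (rule sum.remove) auto
  have de: "real ?d * e < \<eta>" using e(1,4) by (simp add: n algebra_simps)
  have "norm x \<le> C"
    using norm_le_coord[of x] split[of "\<lambda>k.
        \<bar>coord x k\<bar>"] others xlen[of j] de L(3) \<eta> by (simp add: len_def)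
  then have "y \<bullet> x = 0" using y(2) xM by blast
  then have "coord y j * coord x j = - (\<Sum>k\<in>UNIV - {j}. coord y k * coord x k)"
    using split[of "\<lambda>k. coord y k * coord x k"] by (simp add: inner_coord)
  then have "\<bar>coord y j\<bar> * \<bar>coord x j\<bar> \<le> (\<Sum>k\<in>UNIV - {j}. \<bar>coord y k * coord x k\<bar>)"
    using sum_abs[of "\<lambda>k. coord y k * coord x k" "UNIV - {j}"] by (simp flip: abs_mult)
  also have "\<dots> \<le> (\<Sum>k\<in>UNIV - {j}. \<bar>coord y j\<bar> * \<bar>coord x k\<bar>)"
    by (intro sum_mono) (simp add: abs_mult j mult_right_mono)
  also have "\<dots> \<le> \<bar>coord y j\<bar> * (real ?d * e)"
    using others by (simp add: sum_distrib_left[symmetric] mult_left_mono)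
  finally have xj: "\<bar>coord x j\<bar> < \<eta>" using yj de by (simp add: mult_le_cancel_left_pos)
  have "\<bar>coord x k\<bar> < \<eta>" for k
    using xj xlen[of k] e(2) by (cases "k = j") (auto simp: len_def)
  then show False using kronecker_lattice_min[OF \<eta> H ns xM x0] by (metis not_le)
qed

lemma kronecker_lattice_bounded_basis:
  assumes \<eta>: "0 < \<eta>" "\<eta> < 1"
  shows "\<exists>C. \<forall>H (\<beta>::real^'n). H \<ge> 1 \<longrightarrow> nonsingular_at \<eta> H \<beta> \<longrightarrow>
     (\<exists>b::(real \<times> (real^'n))^('n option). lat b = kronecker_lattice H \<beta> \<and> (\<forall>k. norm (b $ k) \<le> C) \<and>
        (\<forall>z. z \<noteq> (\<lambda>_. 0) \<longrightarrow> norm (\<Sum>k\<in>UNIV. of_int (z k) *\<^sub>R b $ k) \<ge> \<eta>))"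
proof (rule exI, intro allI impI)
  fix H and \<beta> :: "real^'n"
  assume H: "H \<ge> 1" and ns: "nonsingular_at \<eta> H \<beta>"
  obtain B :: "(real \<times> (real^'n))^('n option)" where B: "lat B = kronecker_lattice H \<beta>"
      "full_rank B" using kronecker_lattice_basis[of H \<beta>] H by metis
  let ?C = "2 ^ CARD('n option) / (\<eta> / CARD('n option)) ^ CARD('n) + 2"
  have "span {x \<in> lat B. norm x \<le> ?C} = UNIV"
    using kronecker_lattice_short_span[OF \<eta> H ns] B by simp
  then obtain b :: "(real \<times> (real^'n))^('n option)" where b: "lat b = lat B" "\<And>k. norm (b $ k) \<le>
      real CARD('n option) * ?C"
    using lat_bounded_basis[OF dim_option B(2)] by blast
  have fb: "full_rank b" using b(1) B(2) by (simp add: full_rank_def)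
  have "norm (\<Sum>k\<in>UNIV. of_int (z k) *\<^sub>R b $ k) \<ge> \<eta>" if z: "z \<noteq> (\<lambda>_. 0)" for z
  proof -
    let ?x = "\<Sum>k\<in>UNIV. of_int (z k) *\<^sub>R b $ k"
    have "?x \<noteq> 0"
    proof
      assume "?x = 0"
      then have "?x = (\<Sum>k\<in>UNIV. (0::real) *\<^sub>R b $ k)" by simp
      then have "real_of_int (z k) = 0" for k
        using full_rank_coeff_unique[OF dim_option fb, of "\<lambda>k. of_int (z k)" "\<lambda>_. 0" k] by simp
      with z show False by auto
    qed
    moreover have "?x \<in> kronecker_lattice H \<beta>" using lat_memI[of z b] b B by simp
    ultimately obtain k where "\<bar>coord ?x k\<bar> \<ge> \<eta>" using kronecker_lattice_min[OF \<eta> H ns] by blast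
    then show ?thesis using coord_le_norm order_trans by blast
  qed
  then show "\<exists>b::(real \<times> (real^'n))^('n option). lat b = kronecker_lattice H \<beta> \<and> (\<forall>k.
      norm (b $ k) \<le> real CARD('n option) * ?C) \<and>
     (\<forall>z. z \<noteq> (\<lambda>_. 0) \<longrightarrow> norm (\<Sum>k\<in>UNIV. of_int (z k) *\<^sub>R b $ k) \<ge> \<eta>)"
    using b B by (intro exI[of _ b]) auto
qed

section \<open>Almost every orbit is dense\<close>

text \<open>A Mahler-type compact set. The lower bound is imposed on nonzero integer coefficients,
  which makes it a closed condition without mentioning linear independence.\<close>

definition thick :: "real \<Rightarrow> real \<Rightarrow> (('a::real_normed_vector)^'k) set" where
  "thick C \<eta> = {b. (\<forall>k. norm (b $ k) \<le> C) \<and>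
     (\<forall>z::'k\<Rightarrow>int. z \<noteq> (\<lambda>_. 0) \<longrightarrow> \<eta> \<le> norm (\<Sum>k\<in>UNIV. of_int (z k) *\<^sub>R b $ k))}"

lemma compact_thick: "compact (thick C \<eta> :: (('a::euclidean_space)^'k) set)"
proof -
  have "thick C \<eta> = {b. \<forall>k. norm (b $ k) \<le> C} \<inter>
     {b. \<forall>z::'k\<Rightarrow>int. z \<noteq> (\<lambda>_. 0) \<longrightarrow> \<eta> \<le> norm (\<Sum>k\<in>UNIV. of_int (z k) *\<^sub>R (b::'a^'k) $ k)}"
    by (auto simp: thick_def)
  moreover have "closed {b::'a^'k. \<forall>k. norm (b $ k) \<le> C}"
    by (intro closed_Collect_all closed_Collect_le continuous_intros)
  moreover have "closed {b. \<forall>z::'k\<Rightarrow>int. z \<noteq> (\<lambda>_. 0) \<longrightarrow> \<eta> \<le> norm (\<Sum>k\<in>UNIV.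
      of_int (z k) *\<^sub>R (b::'a^'k) $ k)}"
  proof (intro closed_Collect_all)
    fix z :: "'k \<Rightarrow> int"
    show "closed {b. z \<noteq> (\<lambda>_. 0) \<longrightarrow> \<eta> \<le> norm (\<Sum>k\<in>UNIV. of_int (z k) *\<^sub>R (b::'a^'k) $ k)}"
      by (cases "z = (\<lambda>_. 0)") (auto intro!: closed_Collect_le continuous_intros)
  qed
  moreover have "bounded (thick C \<eta> :: ('a^'k) set)"
  proof (rule boundedI)
    fix b :: "'a^'k" assume "b \<in> thick C \<eta>"
    then have "norm (b $ k) \<le> C" for k by (simp add: thick_def)
    then have "(\<Sum>k\<in>UNIV. norm (b $ k)) \<le> (\<Sum>k\<in>(UNIV::'k set). C)" by (intro sum_mono)
    moreover have "norm b \<le> (\<Sum>k\<in>UNIV. norm (b $ k))" unfolding norm_vec_def by (rule L2_set_le_sum) simp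
    ultimately show "norm b \<le> real CARD('k) * C" by simp
  qed
  ultimately show ?thesis by (simp add: compact_eq_bounded_closed closed_Int)
qed

text \<open>A real linear relation, normalised to have coefficient 1 at j, is approximated by
  integers through simultaneous Dirichlet approximation; the integer combination would be nontrivial
  and shorter than \<eta>. The compactness argument needs this for every tuple in the set, not just
  for Kronecker lattices.\<close>

lemma thick_full_rank:
  fixes b :: "('a::euclidean_space)^'k"
  assumes dim: "DIM('a) = CARD('k)" and \<eta>: "\<eta> > 0" and b: "b \<in> thick C \<eta>"
  shows "full_rank b"
proof -
  let ?n = "CARD('k)"
  have "c = 0" if c: "(\<Sum>k\<in>UNIV. c $ k *\<^sub>R b $ k) = 0" for c :: "real^'k"
  proof (rule ccontr)
    assume "c \<noteq> 0"
    then obtain j where j: "c $ j \<noteq> 0" by (auto simp: vec_eq_iff)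
    define \<theta> where "\<theta> = (\<lambda>k. c $ k / c $ j)"
    have "(\<Sum>k\<in>UNIV. \<theta> k *\<^sub>R b $ k) = (1 / c $ j) *\<^sub>R (\<Sum>k\<in>UNIV. c $ k *\<^sub>R b $ k)"
      by (simp add: \<theta>_def scaleR_right.sum)
    then have \<theta>0: "(\<Sum>k\<in>UNIV. \<theta> k *\<^sub>R b $ k) = 0" using c by simp
    obtain e where e: "bij_betw e {0..<?n} (UNIV::'k set)"
        using ex_bij_betw_nat_finite[of "UNIV::'k set"] by auto
    obtain N :: nat where "real ?n * C / \<eta> < real N" using reals_Archimedean2 by blast
    then have N: "real ?n * C < \<eta> * real (Suc N)" using \<eta> by (simp add: field_simps)
    obtain q p where q: "0 < q" "q \<le> int (Suc N ^ ?n)" and p: "\<And>i. i < ?n \<Longrightarrow>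
        \<bar>of_int q * \<theta> (e i) - of_int (p i)\<bar> < 1 / real (Suc N)"
    proof (rule Dirichlet_approx_simult[of "Suc N" ?n "\<lambda>i. \<theta> (e i)"])
      show "0 < Suc N" by simp
      fix q p
      assume "0 < q" "q \<le> int (Suc N ^ ?n)"
        and "\<And>i. i < ?n \<Longrightarrow> \<bar>of_int q * \<theta> (e i) - of_int (p i)\<bar> < 1 / real (Suc N)"
      then show thesis by (rule that)
    qed
    define z where "z = (\<lambda>k. p (inv_into {0..<?n} e k))"
    have z: "\<bar>of_int q * \<theta> k - of_int (z k)\<bar> < 1 / real (Suc N)" for k
    proof -
      have "k \<in> e ` {0..<?n}" using e by (auto simp: bij_betw_def)
      from f_inv_into_f[OF this] inv_into_into[OF this]
      have "e (inv_into {0..<?n} e k) = k" "inv_into {0..<?n} e k < ?n" by auto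
      then show ?thesis using p[of "inv_into {0..<?n} e k"] by (simp add: z_def)
    qed
    have "z j \<noteq> 0"
    proof
      assume "z j = 0"
      then have "\<bar>real_of_int q\<bar> < 1 / real (Suc N)" using z[of j] j by (simp add: \<theta>_def)
      moreover have "1 / real (Suc N) \<le> 1" by simp
      ultimately show False using q(1) by linarith
    qed
    then have "z \<noteq> (\<lambda>_. 0)" by auto
    then have "\<eta> \<le> norm (\<Sum>k\<in>UNIV. of_int (z k) *\<^sub>R b $ k)" using b by (auto simp: thick_def)
    also have "(\<Sum>k\<in>UNIV. of_int (z k) *\<^sub>R b $ k) = (\<Sum>k\<in>UNIV. (of_int (z k) - of_int q * \<theta> k) *\<^sub>R b $ k)"
    proof -
      have "(\<Sum>k\<in>UNIV. (of_int q * \<theta> k) *\<^sub>R b $ k) = of_int q *\<^sub>R (\<Sum>k\<in>UNIV. \<theta> k *\<^sub>R b $ k)"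
        by (simp add: scaleR_right.sum)
      then show ?thesis using \<theta>0 by (simp add: scaleR_left_diff_distrib sum_subtractf)
    qed
    also have "norm \<dots> \<le> (\<Sum>k\<in>(UNIV::'k set). (1 / real (Suc N)) * C)"
    proof (rule sum_norm_le)
      fix k
      have "norm (b $ k) \<le> C" using b by (simp add: thick_def)
      moreover have "\<bar>of_int (z k) - of_int q * \<theta> k\<bar> \<le> 1 / real (Suc N)" using z[of k] by linarith
      ultimately show "norm ((of_int (z k) - of_int q * \<theta> k) *\<^sub>R b $ k) \<le> 1 / real (Suc N) * C"
        unfolding norm_scaleR by (intro mult_mono) auto
    qed
    also have "\<dots> = real ?n * C / real (Suc N)" by simp
    also have "\<dots> < \<eta>" using N by (simp add: field_simps)
    finally show False by simp
  qed
  then show ?thesis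
    using full_rank_iff_inj[OF dim, of b] linear_injective_0[OF lincomb_linear[of b]] by blast
qed

text \<open>A finite subcover makes the data uniform: \<open>R\<close> and \<open>\<rho>\<close>
  will fix the proportion of a ball that hits \<open>U\<close>, and \<open>E\<close> keeps
  \<epsilon>/H small for large H.\<close>

lemma thick_uniform_reach:
  fixes h :: "(real \<times> (real^'n))^('n option)"
  assumes U: "open U" "h \<in> U" "full_rank h" and \<eta>: "\<eta> > 0"
  obtains R E \<rho> where "R > 0" "E > 0" "\<rho> > 0"
    "\<And>b::(real \<times> (real^'n))^('n option). b \<in> thick C \<eta> \<Longrightarrow> \<exists>x \<epsilon> \<delta>. norm x \<le> R \<and> 0 < \<epsilon> \<and> \<epsilon> \<le> E \<and> 0 < \<delta> \<and>
        (\<forall>x1. dist x1 x < \<rho> \<longrightarrow> (\<exists>b2\<in>U. lat b2 = shear \<epsilon> \<delta> x1 ` lat b))"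
proof -
  let ?K = "thick C \<eta> :: ((real \<times> (real^'n))^('n option)) set"
  have "\<exists>x \<epsilon> \<delta> \<rho>. 0 < \<epsilon> \<and> 0 < \<delta> \<and> 0 < \<rho> \<and> (\<forall>b1 x1. dist b1 b < \<rho> \<longrightarrow> dist x1 x < \<rho> \<longrightarrow>
      (\<exists>b2\<in>U. lat b2 = shear \<epsilon> \<delta> x1 ` lat b1))" if "b \<in> ?K" for b
  proof -
    have fb: "full_rank b" using thick_full_rank[OF dim_option \<eta> that] .
    obtain b' \<epsilon> \<delta> x where *: "b' \<in> U" "0 < \<epsilon>" "0 < \<delta>" "lat b' = shear \<epsilon> \<delta> x ` lat b"
      using reach_full_rank[OF U fb] by (auto simp: reach_def equivalent_def)
    obtain \<rho> where "\<rho> > 0" "\<And>b1 x1. dist b1 b < \<rho> \<Longrightarrow> dist x1 x < \<rho> \<Longrightarrow> \<exists>b2\<in>U. lat b2 =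
        shear \<epsilon> \<delta> x1 ` lat b1"
      using equivalent_stable[OF dim_option fb U(1) *] by blast
    with * show ?thesis by blast
  qed
  then obtain x \<epsilon> \<delta> \<rho> where pos: "\<And>b. b \<in> ?K \<Longrightarrow> 0 < \<epsilon> b" "\<And>b. b \<in> ?K \<Longrightarrow> 0 < \<delta> b" "\<And>b. b \<in> ?K \<Longrightarrow> 0 < \<rho> b"
    and st: "\<And>b b1 x1. b \<in> ?K \<Longrightarrow> dist b1 b < \<rho> b \<Longrightarrow> dist x1 (x b) < \<rho> b \<Longrightarrow>
      \<exists>b2\<in>U. lat b2 = shear (\<epsilon> b) (\<delta> b) x1 ` lat b1"
    by metis
  have "?K \<subseteq> (\<Union>b\<in>?K. ball b (\<rho> b))" using pos(3) by auto
  from compactE_image[OF compact_thick open_ball this] obtain D where D: "D \<subseteq> ?K" "finite D" "?K \<subseteq>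
      (\<Union>b\<in>D. ball b (\<rho> b))"
    by blast
  define R where "R = (\<Sum>b\<in>D. norm (x b)) + 1"
  define E where "E = (\<Sum>b\<in>D. \<epsilon> b) + 1"
  define r where "r = Min (insert 1 (\<rho> ` D))"
  have R: "norm (x b) \<le> R" if "b \<in> D" for b
    using member_le_sum[of b D "\<lambda>b. norm (x b)"] D that by (simp add: R_def)
  have E: "\<epsilon> b \<le> E" if "b \<in> D" for b
  proof -
    have "\<epsilon> b \<le> (\<Sum>b\<in>D. \<epsilon> b)"
        using D that pos(1) by (intro member_le_sum) (auto simp: less_imp_le subset_iff)
    then show ?thesis by (simp add: E_def)
  qed
  have "(\<Sum>b\<in>D. \<epsilon> b) \<ge> 0" using D pos(1) by (intro sum_nonneg) (auto simp: less_imp_le subset_iff)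
  then have E0: "E > 0" by (simp add: E_def)
  have R0: "R > 0" unfolding R_def by (simp add: sum_nonneg add_nonneg_pos)
  have r0: "r > 0" unfolding r_def using D pos(3) by (subst Min_gr_iff) auto
  have r: "r \<le> \<rho> b" if "b \<in> D" for b unfolding r_def using D that by (intro Min_le) auto
  show ?thesis
  proof (rule that[OF R0 E0 r0])
    fix b assume "b \<in> ?K"
    then obtain a where a: "a \<in> D" "dist b a < \<rho> a" using D(3) by (auto simp: dist_commute)
    then have aK: "a \<in> ?K" using D(1) by blast
    have "\<forall>x1. dist x1 (x a) < r \<longrightarrow> (\<exists>b2\<in>U. lat b2 = shear (\<epsilon> a) (\<delta> a) x1 ` lat b)"
      using st[OF aK a(2)] r[OF a(1)] by (meson less_le_trans)
    then show "\<exists>x \<epsilon> \<delta>. norm x \<le> R \<and> 0 < \<epsilon> \<and> \<epsilon> \<le> E \<and> 0 < \<delta> \<and>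
        (\<forall>x1. dist x1 x < r \<longrightarrow> (\<exists>b2\<in>U. lat b2 = shear \<epsilon> \<delta> x1 ` lat b))"
      using R[OF a(1)] E[OF a(1)] pos(1,2)[OF aK]
      by (intro exI[of _ "x a"] exI[of _ "\<epsilon> a"] exI[of _ "\<delta> a"] conjI)
  qed
qed

text \<open>Shear vectors within \<rho> of x correspond to a ball of radius s \<rho> inside the ball
  of radius s (R + \<rho>) around \<beta>. Its proportion t does not depend on H, so every \<beta>
  outside the singular set has arbitrarily small balls of which a fixed part avoids the exceptional
  set.\<close>

lemma orbit_misses_negligible:
  fixes h :: "(real \<times> (real^'n))^('n option)" and T :: real
  assumes U: "open U" "h \<in> U" "full_rank h" and T: "T > 0"
  shows "negligible {\<beta>::real^'n. \<not> (\<exists>\<epsilon> \<delta> b. 0 < \<epsilon> \<and> \<epsilon> < 1 / T \<and> 0 < \<delta> \<and> b \<in> U \<and> lat b =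
      shear \<epsilon> \<delta> 0 ` lat (kronecker_basis \<beta>))}"
    (is "negligible ?B")
proof -
  obtain \<eta> where \<eta>: "\<eta> > 0" "\<eta> < 1" and neg: "negligible {\<beta>::real^'n. \<exists>H0. \<forall>H\<ge>H0.
      \<not> nonsingular_at \<eta> H \<beta>}" (is "negligible ?S")
    using singular_negligible[where 'n='n] by blast
  obtain C where C: "\<And>H (\<beta>::real^'n). H \<ge> 1 \<Longrightarrow> nonsingular_at \<eta> H \<beta> \<Longrightarrow>
     \<exists>b::(real \<times> (real^'n))^('n option). lat b = kronecker_lattice H \<beta> \<and> (\<forall>k. norm (b $ k) \<le> C) \<and>
         (\<forall>z. z \<noteq> (\<lambda>_. 0) \<longrightarrow> norm (\<Sum>k\<in>UNIV. of_int (z k) *\<^sub>R b $ k) \<ge> \<eta>)"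
    using kronecker_lattice_bounded_basis[OF \<eta>, where 'n='n] by blast
  obtain R E \<rho> where pos: "R > 0" "E > 0" "\<rho> > 0"
    and unif: "\<And>b::(real \<times> (real^'n))^('n option). b \<in> thick C \<eta> \<Longrightarrow> \<exists>x \<epsilon> \<delta>. norm x \<le> R \<and> 0 < \<epsilon> \<and> \<epsilon> \<le>
        E \<and> 0 < \<delta> \<and>
        (\<forall>x1. dist x1 x < \<rho> \<longrightarrow> (\<exists>b2\<in>U. lat b2 = shear \<epsilon> \<delta> x1 ` lat b))"
    using thick_uniform_reach[OF U \<eta>(1), of C] by blast
  define t where "t = (\<rho> / (R + \<rho>)) ^ CARD('n)"
  have t: "0 < t" "t < 1"
  proof -
    have "0 < \<rho> / (R + \<rho>)" "\<rho> / (R + \<rho>) < 1" using pos by auto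
    then show "0 < t" "t < 1" unfolding t_def by (auto intro!: power_less_one_iff[THEN iffD2])
  qed
  have "negligible (?B - ?S)"
  proof (rule negligible_if_small_density[of "1 - t"])
    show "0 < 1 - t" "1 - t < 1" using t by auto
    fix \<beta> and r :: real assume \<beta>: "\<beta> \<in> ?B - ?S" and r: "r > 0"
    \<comment> \<open>Beyond this height both the radius s (R + \<rho>) is below r and \<epsilon>/H
      is below 1/T.\<close>
    obtain H0 :: nat where H0: "max ((R + \<rho>) / r) (E * T) < real H0" using reals_Archimedean2 by blast
    obtain H where H: "H \<ge> max H0 1" "nonsingular_at \<eta> H \<beta>"
      using \<beta> by blast
   have H1: "H \<ge> 1" "(R + \<rho>) / r < real H" "E * T < real H" using H H0 by auto
    define d where "d = root CARD('n) (real H)"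
    have d: "d \<ge> 1" using H1 by (simp add: d_def)
    \<comment> \<open>The ratio of the two scalings in \<open>kronecker_lattice\<close>: by
      \<open>shear_shear\<close>, moving \<beta> by s x1 shears the rescaled lattice by x1.\<close>
    define s where "s = (1 / real H) / d"
    have "(1 / real H) / d \<le> (1 / real H) / 1" using d H1 by (intro divide_left_mono) auto
    then have s: "0 < s" "s \<le> 1 / real H" using d H1 by (auto simp: s_def)
    obtain b where b: "lat b = kronecker_lattice H \<beta>"
        "b \<in> (thick C \<eta> :: ((real \<times> (real^'n))^('n option)) set)"
      using C[OF H1(1) H(2)] by (auto simp: thick_def)
    obtain x \<epsilon> \<delta> where x: "norm x \<le> R" "0 < \<epsilon>" "\<epsilon> \<le> E" "0 < \<delta>"
      and hit: "\<And>x1. dist x1 x < \<rho> \<Longrightarrow> \<exists>b2\<in>U. lat b2 = shear \<epsilon> \<delta> x1 ` lat b"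
      using unif[OF b(2)] by blast
    have nB: "\<beta> + s *\<^sub>R x1 \<notin> ?B" if x1: "dist x1 x < \<rho>" for x1
    proof -
      obtain b2 where b2: "b2 \<in> U" "lat b2 = shear \<epsilon> \<delta> x1 ` lat b" using hit[OF x1] by blast
      have "lat b2 = shear (\<epsilon> * (1 / real H)) (\<delta> * d) 0 ` lat (kronecker_basis (\<beta> + s *\<^sub>R x1))"
        using b2(2) d by (simp add: b(1) kronecker_lattice_def kronecker_basis_shear image_image shear_shear s_def d_def[symmetric])
      moreover have "0 < \<epsilon> * (1 / real H)" "0 < \<delta> * d" using x H1 d by auto
      moreover have "\<epsilon> * (1 / real H) < 1 / T"
      proof -
        have "\<epsilon> * T \<le> E * T" using x T by (intro mult_right_mono) auto
        then have "\<epsilon> * T < real H" using H1(3) by linarith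
        then show ?thesis using H1(1) T by (simp add: field_simps)
      qed
      ultimately show ?thesis using b2(1) by blast
    qed
    define D where "D = s * (R + \<rho>)"
    have D: "0 < D" "D < r"
    proof -
      show "0 < D" using s pos by (simp add: D_def)
      have "D \<le> (1 / real H) * (R + \<rho>)" unfolding D_def using s pos by (intro mult_right_mono) auto
      also have "\<dots> < r" using H1 r by (simp add: field_simps)
      finally show "D < r" .
    qed
    let ?b = "ball (\<beta> + s *\<^sub>R x) (s * \<rho>)"
    have sub: "?b \<subseteq> ball \<beta> D"
    proof
      fix y assume "y \<in> ?b"
      then have "norm (y - (\<beta> + s *\<^sub>R x)) < s * \<rho>" by (simp add: dist_norm norm_minus_commute)
      moreover have "norm (s *\<^sub>R x) \<le> s * R" using s x by simp
      moreover have "norm (y - \<beta>) \<le> norm (y - (\<beta> + s *\<^sub>R x)) + norm (s *\<^sub>R x)"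
        using norm_triangle_ineq[of "y - (\<beta> + s *\<^sub>R x)" "s *\<^sub>R x"] by simp
      ultimately have "norm (y - \<beta>) < D" by (simp add: D_def algebra_simps)
      then show "y \<in> ball \<beta> D" by (simp add: dist_norm norm_minus_commute)
    qed
    have miss: "y \<notin> ?B" if "y \<in> ?b" for y
    proof -
      define x1 where "x1 = (1 / s) *\<^sub>R (y - \<beta>)"
      have "x1 - x = (1 / s) *\<^sub>R (y - (\<beta> + s *\<^sub>R x))" using s by (simp add: x1_def algebra_simps)
      then have "dist x1 x = dist (\<beta> + s *\<^sub>R x) y / s"
          using s by (simp add: dist_norm norm_minus_commute)
      moreover have "dist (\<beta> + s *\<^sub>R x) y / s < \<rho>"
          using that s(1) by (simp add: pos_divide_less_eq mult.commute)
      ultimately have x1: "dist x1 x < \<rho>" by simp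
      have yeq: "y = \<beta> + s *\<^sub>R x1" using s by (simp add: x1_def)
      show ?thesis by (subst yeq) (rule nB[OF x1])
    qed
    have "measure lebesgue (ball \<beta> D - ?b) = measure lebesgue (ball \<beta> D) - measure lebesgue ?b"
      using sub by (intro measurable_measure_Diff) auto
    also have "measure lebesgue ?b = t * measure lebesgue (ball \<beta> D)"
    proof -
      have "measure lebesgue ?b = (s * \<rho>) ^ CARD('n) * measure lebesgue (ball (0::real^'n) 1)"
        using content_ball_conv_unit_ball[of "s * \<rho>" "\<beta> + s *\<^sub>R x"] s pos by simp
      moreover have "measure lebesgue (ball \<beta> D) =
          D ^ CARD('n) * measure lebesgue (ball (0::real^'n) 1)"
        using content_ball_conv_unit_ball[of D \<beta>] D by simp
      moreover have "(s * \<rho>) ^ CARD('n) = t * D ^ CARD('n)"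
        using s pos by (simp add: t_def D_def power_mult_distrib power_divide)
      ultimately show ?thesis by simp
    qed
    finally have meas: "measure lebesgue (ball \<beta> D - ?b) \<le> (1 - t) * measure lebesgue (ball \<beta> D)"
      by (simp add: algebra_simps)
    have "(?B - ?S) \<inter> ball \<beta> D \<subseteq> ball \<beta> D - ?b" using miss by blast
    moreover have "ball \<beta> D - ?b \<in> lmeasurable" by (intro fmeasurable.Diff) auto
    ultimately show "\<exists>d V. 0 < d \<and> d < r \<and> (?B - ?S) \<inter> ball \<beta> d \<subseteq> V \<and> V \<in> lmeasurable \<and>
                 measure lebesgue V \<le> (1 - t) * measure lebesgue (ball \<beta> d)"
      using D meas by blast
  qed
  then have "negligible ((?B - ?S) \<union> ?S)" using neg by (rule negligible_Un)
  then show ?thesis by (rule negligible_subset) blast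
qed

text \<open>A countable base of the topology and integer bounds T reduce the simultaneous statement
  to a countable union of the previous null sets.\<close>

theorem orbit_dense_negligible:
  "negligible {\<beta>::real^'n. \<not> (\<forall>(h::(real \<times> (real^'n))^('n option)) e T. full_rank h \<longrightarrow> e > 0 \<longrightarrow> T > 0 \<longrightarrow>
     (\<exists>\<epsilon> \<delta> b. 0 < \<epsilon> \<and> \<epsilon> < 1 / T \<and> 0 < \<delta> \<and> dist b h < e \<and> lat b =
         shear \<epsilon> \<delta> 0 ` lat (kronecker_basis \<beta>)))}"
    (is "negligible ?N")
proof -
  obtain \<U> :: "((real \<times> (real^'n))^('n option)) set set" where U: "countable \<U>" "topological_basis \<U>"
    using ex_countable_basis by blast
  define \<V> where "\<V> = {V \<in> \<U>. \<exists>h\<in>V. full_rank h}"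
  define bad where "bad = (\<lambda>(V::((real \<times> (real^'n))^('n option)) set, T::nat). {\<beta>::real^'n.
      \<not> (\<exists>\<epsilon> \<delta> b. 0 < \<epsilon> \<and> \<epsilon> < 1 / real (Suc T) \<and> 0 < \<delta> \<and> b \<in> V \<and> lat b =
      shear \<epsilon> \<delta> 0 ` lat (kronecker_basis \<beta>))})"
  have "bad i \<in> null_sets lebesgue" if iV: "i \<in> \<V> \<times> UNIV" for i
  proof -
    obtain V T where i: "i = (V, T)" by (cases i)
    have "open V" using iV i U(2) by (auto simp: \<V>_def topological_basis_open)
    moreover obtain h where "h \<in> V" "full_rank h" using iV i by (auto simp: \<V>_def)
    ultimately show ?thesis unfolding negligible_iff_null_sets[symmetric] i bad_def prod.case
      by (rule orbit_misses_negligible) simp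
  qed
  moreover have "countable (\<V> \<times> (UNIV::nat set))" using U(1) by (simp add: \<V>_def)
  ultimately have "(\<Union>i\<in>\<V> \<times> UNIV. bad i) \<in> null_sets lebesgue" by (intro null_sets_UN')
  moreover have "?N \<subseteq> (\<Union>i\<in>\<V> \<times> UNIV. bad i)"
  proof
    fix \<beta> assume "\<beta> \<in> ?N"
    then obtain h :: "(real \<times> (real^'n))^('n option)" and e T :: real where h: "full_rank h"
        "e > 0" "T > 0" and
      no: "\<not> (\<exists>\<epsilon> \<delta> b. 0 < \<epsilon> \<and> \<epsilon> < 1 / T \<and> 0 < \<delta> \<and> dist b h < e \<and> lat b =
          shear \<epsilon> \<delta> 0 ` lat (kronecker_basis \<beta>))"
      by auto
    obtain V where V: "V \<in> \<U>" "h \<in> V" "V \<subseteq> ball h e"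
      using topological_basisE[OF U(2) open_ball, of h h e] h by auto
    obtain T' :: nat where T': "T < real T'" using reals_Archimedean2 by blast
    have "\<beta> \<in> bad (V, T')"
    proof (rule ccontr)
      assume "\<beta> \<notin> bad (V, T')"
      then obtain \<epsilon> \<delta> b where *: "0 < \<epsilon>" "\<epsilon> < 1 / real (Suc T')" "0 < \<delta>" "b \<in> V" "lat b =
          shear \<epsilon> \<delta> 0 ` lat (kronecker_basis \<beta>)"
        by (auto simp: bad_def)
      have "1 / real (Suc T') \<le> 1 / T" using T' h by (intro divide_left_mono) auto
      then have "\<epsilon> < 1 / T" using * by linarith
      moreover have "dist b h < e" using V * by (auto simp: dist_commute)
      ultimately show False using no * by blast
    qed
    moreover have "V \<in> \<V>" using V h by (auto simp: \<V>_def)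
    ultimately show "\<beta> \<in> (\<Union>i\<in>\<V> \<times> UNIV. bad i)" by blast
  qed
  ultimately show ?thesis using negligible_subset unfolding negligible_iff_null_sets[symmetric] by blast
qed

section \<open>Distances between nearest neighbours\<close>

lemma unimodular_lattice_lat:
  fixes L :: "(real^'n) set"
  assumes "unimodular_lattice L"
  obtains A :: "real^'n^'n" where "det A \<noteq> 0" "L = lat (\<chi> i. column i A)"
    "L = {A *v (\<chi> i. of_int (z i)) | z::'n\<Rightarrow>int. True}"
proof -
  obtain A :: "real^'n^'n" where A: "\<bar>det A\<bar> = 1" "L = range (\<lambda>z :: int ^ 'n. A *v (\<chi> i.
      real_of_int (z $ i)))"
    using assms unfolding unimodular_lattice_def by blast
  have L: "L = {A *v (\<chi> i. of_int (z i)) | z::'n\<Rightarrow>int. True}"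
  proof (intro equalityI subsetI)
    fix x assume "x \<in> L"
    then obtain z :: "int^'n" where "x = A *v (\<chi> i. real_of_int (z $ i))" using A by blast
    then show "x \<in> {A *v (\<chi> i. of_int (z i)) | z::'n\<Rightarrow>int. True}"
      by (intro CollectI exI[of _ "\<lambda>i. z $ i"]) simp
  next
    fix x assume "x \<in> {A *v (\<chi> i. of_int (z i)) | z::'n\<Rightarrow>int. True}"
    then obtain z :: "'n \<Rightarrow> int" where "x = A *v (\<chi> i. of_int (z i))" by blast
    then have "x = A *v (\<chi> i. real_of_int ((\<chi> i. z i) $ i))" by simp
    then show "x \<in> L" unfolding A(2) by (rule range_eqI)
  qed
  moreover have "lat (\<chi> i. column i A) = {A *v (\<chi> i. of_int (z i)) | z::'n\<Rightarrow>int. True}"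
    by (auto simp: lat_def matrix_mult_sum scalar_mult_eq_scaleR)
  ultimately show ?thesis using A(1) by (intro that[of A]) auto
qed

definition min_dist :: "real^'n \<Rightarrow> (real^'n) set \<Rightarrow> nat \<Rightarrow> real" where
  "min_dist \<alpha> L K = Inf {norm (of_int k *\<^sub>R \<alpha> + l) | k l. \<bar>k\<bar> \<le> int K \<and> l \<in> L \<and>
      norm (of_int k *\<^sub>R \<alpha> + l) > 0}"

lemma nn_dist_eq_min_dist:
  assumes L: "\<And>l. l \<in> L \<Longrightarrow> - l \<in> L" and n: "1 \<le> n" "n \<le> N"
  shows "nn_dist \<alpha> L N n = min_dist \<alpha> L (max (n - 1) (N - n))"
proof -
  let ?A = "{norm ((real m - real n) *\<^sub>R \<alpha> + l) | m l. 1 \<le> m \<and> m \<le> N \<and> l \<in> L \<and>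
      norm ((real m - real n) *\<^sub>R \<alpha> + l) > 0}"
  let ?B = "{norm (of_int k *\<^sub>R \<alpha> + l) | k l. \<bar>k\<bar> \<le> int (max (n - 1) (N - n)) \<and> l \<in> L \<and>
      norm (of_int k *\<^sub>R \<alpha> + l) > 0}"
  have "?A = ?B"
  proof (intro equalityI subsetI)
    fix x assume "x \<in> ?A"
    then obtain m l where *: "x = norm ((real m - real n) *\<^sub>R \<alpha> + l)" "1 \<le> m" "m \<le> N" "l \<in> L"
        "x > 0" by auto
    have "real m - real n = of_int (int m - int n)" by simp
    moreover have "\<bar>int m - int n\<bar> \<le> int (max (n - 1) (N - n))" using * n by auto
    ultimately show "x \<in> ?B" using * by (intro CollectI exI[of _ "int m - int n"] exI[of _ l]) simp
  next
    fix x assume "x \<in> ?B"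
    then obtain k l where *: "x = norm (of_int k *\<^sub>R \<alpha> + l)" "\<bar>k\<bar> \<le> int (max (n - 1) (N - n))"
        "l \<in> L" "x > 0" by auto
    \<comment> \<open>Of k and -k, the one pointing to the longer side of n keeps n + k' within 1,
      ..., N.\<close>
    define k' where "k' = (if N - n \<le> n - 1 then - \<bar>k\<bar> else \<bar>k\<bar>)"
    have "\<exists>l'\<in>L. x = norm (of_int k' *\<^sub>R \<alpha> + l')"
    proof (cases "k' = k")
      case False
      then have "k' = - k" by (auto simp: k'_def abs_if split: if_splits)
      then have "of_int k' *\<^sub>R \<alpha> + - l = - (of_int k *\<^sub>R \<alpha> + l)" by simp
      then have "x = norm (of_int k' *\<^sub>R \<alpha> + - l)" using *(1) norm_minus_cancel by metis
      then show ?thesis using L * by blast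
    qed (use * in blast)
    then obtain l' where l': "l' \<in> L" "x = norm (of_int k' *\<^sub>R \<alpha> + l')" by blast
    define m where "m = nat (int n + k')"
    have "1 \<le> int n + k'" "int n + k' \<le> int N" using * n by (auto simp: k'_def split: if_splits)
    then have m: "1 \<le> m" "m \<le> N" "real m - real n = of_int k'" by (auto simp: m_def)
    show "x \<in> ?A" using l' m * by (intro CollectI exI[of _ m] exI[of _ l']) simp
  qed
  then show ?thesis by (simp add: nn_dist_def min_dist_def)
qed

lemma min_dist_bdd: "bdd_below {norm (of_int k *\<^sub>R \<alpha> + l) | k l. \<bar>k\<bar> \<le> int K \<and> l \<in> L \<and>
    norm (of_int k *\<^sub>R \<alpha> + l) > 0}"
  by (rule bdd_belowI[of _ 0]) auto

text \<open>The thresholds \<open>c\<close> lie between consecutive minimal distances, so r of them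
  separate r + 1 values. Only inequalities enter, which is what a nearby lattice can supply.\<close>

lemma gap_count_ge:
  fixes K :: "nat \<Rightarrow> nat" and c :: "nat \<Rightarrow> real"
  assumes L: "\<And>l. l \<in> L \<Longrightarrow> - l \<in> L" "\<exists>l\<in>L. l \<noteq> 0" and N: "1 \<le> N"
    and K: "\<And>i. i \<le> r \<Longrightarrow> N - 1 \<le> 2 * K i \<and> K i \<le> N - 1"
    and ex: "\<And>i. i < r \<Longrightarrow> \<exists>k. \<exists>l\<in>L. \<bar>k\<bar> \<le> int (K (Suc i)) \<and> 0 < norm (of_int k *\<^sub>R \<alpha> + l) \<and>
        norm (of_int k *\<^sub>R \<alpha> + l) < c i"
    and all: "\<And>i k l. i < r \<Longrightarrow> \<bar>k\<bar> \<le> int (K i) \<Longrightarrow> l \<in> L \<Longrightarrow> 0 < norm (of_int k *\<^sub>R \<alpha> + l) \<Longrightarrow> c i \<le>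
        norm (of_int k *\<^sub>R \<alpha> + l)"
  shows "Suc r \<le> gap_count N \<alpha> L"
proof -
  let ?V = "\<lambda>K. {norm (of_int k *\<^sub>R \<alpha> + l) | k l. \<bar>k\<bar> \<le> int K \<and> l \<in> L \<and> norm (of_int k *\<^sub>R \<alpha> + l) > 0}"
  define D where "D = (\<lambda>i. min_dist \<alpha> L (K i))"
  obtain l0 where l0: "l0 \<in> L" "l0 \<noteq> 0" using L(2) by blast
  have ne: "?V K \<noteq> {}" for K
  proof -
    have "norm (of_int 0 *\<^sub>R \<alpha> + l0) \<in> ?V K" using l0 by (intro CollectI exI[of _ 0] exI[of _ l0]) simp
    then show ?thesis by blast
  qed
  have step: "D (Suc i) < D i" if i: "i < r" for i
  proof -
    obtain k l where "l \<in> L" "\<bar>k\<bar> \<le> int (K (Suc i))" "0 < norm (of_int k *\<^sub>R \<alpha> + l)"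
        "norm (of_int k *\<^sub>R \<alpha> + l) < c i"
      using ex[OF i] by blast
    moreover from this have "D (Suc i) \<le> norm (of_int k *\<^sub>R \<alpha> + l)"
      unfolding D_def min_dist_def by (intro cInf_lower min_dist_bdd) blast
    moreover have "c i \<le> D i" unfolding D_def min_dist_def
      by (rule cInf_greatest[OF ne]) (use all[OF i] in blast)
    ultimately show ?thesis by linarith
  qed
  have less: "D j < D i" if "i < j" "j \<le> r" for i j
    using that
  proof (induction j)
    case (Suc j)
    then show ?case using step[of j] by (cases "i = j") auto
  qed simp
  have "inj_on D {..r}"
    by (rule linorder_inj_onI) (use less in force)+
  then have "Suc r = card (D ` {..r})" by (simp add: card_image)
  also have "\<dots> \<le> card ((\<lambda>n. nn_dist \<alpha> L N n) ` {1..N})"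
  proof (rule card_mono)
    show "D ` {..r} \<subseteq> (\<lambda>n. nn_dist \<alpha> L N n) ` {1..N}"
    proof (clarify)
      fix i assume "i \<le> r"
      then have Ki: "N - 1 \<le> 2 * K i" "K i \<le> N - 1" using K by auto
      \<comment> \<open>The index n = K i + 1 has n - 1 = K i, and N - n \<le> K i because N - 1
        \<le> 2 K i.\<close>
      have "nn_dist \<alpha> L N (K i + 1) = min_dist \<alpha> L (max (K i + 1 - 1) (N - (K i + 1)))"
        using Ki N by (intro nn_dist_eq_min_dist L(1)) auto
      also have "max (K i + 1 - 1) (N - (K i + 1)) = K i" using Ki by auto
      finally have "D i = nn_dist \<alpha> L N (K i + 1)" by (simp add: D_def)
      moreover have "K i + 1 \<in> {1..N}" using Ki N by auto
      ultimately show "D i \<in> (\<lambda>n. nn_dist \<alpha> L N n) ` {1..N}" by blast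
    qed
  qed simp
  finally show ?thesis by (simp add: gap_count_def)
qed

text \<open>With a period p \<le> N - 1 every relevant range of k already covers all residues modulo
  p, so all infima agree. This excludes relations k \<alpha> + l = 0 in the pattern below.\<close>

lemma gap_count_periodic:
  fixes B :: "(real^'n)^'k"
  assumes p: "1 \<le> p" "p \<le> int N - 1" "of_int p *\<^sub>R \<alpha> \<in> lat B"
  shows "gap_count N \<alpha> (lat B) \<le> 1"
proof -
  define c where "c = Inf {norm (of_int k *\<^sub>R \<alpha> + l) | k l. l \<in> lat B \<and> norm (of_int k *\<^sub>R \<alpha> + l) > 0}"
  have min_dist: "min_dist \<alpha> (lat B) K = c" if K: "N - 1 \<le> 2 * K" for K
  proof -
    have "{norm (of_int k *\<^sub>R \<alpha> + l) | k l. \<bar>k\<bar> \<le> int K \<and> l \<in> lat B \<and> norm (of_int k *\<^sub>R \<alpha> + l) > 0} =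
       {norm (of_int k *\<^sub>R \<alpha> + l) | k l. l \<in> lat B \<and> norm (of_int k *\<^sub>R \<alpha> + l) > 0}" (is "?X = ?Y")
    proof (intro equalityI subsetI)
      fix x assume "x \<in> ?Y"
      then obtain k l where *: "x = norm (of_int k *\<^sub>R \<alpha> + l)" "l \<in> lat B" "x > 0" by auto
      \<comment> \<open>Since \<open>p \<le> 2 K\<close>, every residue class modulo \<open>p\<close> meets \<open>[-K, K]\<close>.\<close>
      define q where "q = (k + int K) div p"
      define k' where "k' = (k + int K) mod p - int K"
      have k: "k = k' + q * p" unfolding k'_def q_def by (simp add: algebra_simps)
      have "0 \<le> (k + int K) mod p" "(k + int K) mod p < p" using p by auto
      then have "\<bar>k'\<bar> \<le> int K" using p(2) K unfolding k'_def by linarith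
      moreover have "of_int q *\<^sub>R of_int p *\<^sub>R \<alpha> + l \<in> lat B"
        by (rule lat_add[OF lat_scale[OF p(3)] *(2)])
      moreover have "of_int k *\<^sub>R \<alpha> + l = of_int k' *\<^sub>R \<alpha> + (of_int q *\<^sub>R of_int p *\<^sub>R \<alpha> + l)"
        by (simp add: k algebra_simps)
      ultimately show "x \<in> ?X" using *
        by (intro CollectI exI[of _ k'] exI[of _ "of_int q *\<^sub>R of_int p *\<^sub>R \<alpha> + l"]) (simp add: add.assoc)
    qed blast
    then show ?thesis by (simp add: min_dist_def c_def)
  qed
  have "(\<lambda>n. nn_dist \<alpha> (lat B) N n) ` {1..N} \<subseteq> {c}"
  proof clarify
    fix n assume "n \<in> {1..N}"
    then have n: "1 \<le> n" "n \<le> N" by auto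
    then have "N - 1 \<le> 2 * max (n - 1) (N - n)" by auto
    then show "nn_dist \<alpha> (lat B) N n = c"
      using nn_dist_eq_min_dist[OF lat_uminus n] min_dist by metis
  qed
  then have "gap_count N \<alpha> (lat B) \<le> card {c}" unfolding gap_count_def by (intro card_mono) auto
  then show ?thesis by simp
qed

text \<open>A sharpened converse of \<open>gap_count_ge\<close>: the last bound is strict and holds
  for every nonzero pair, not only where k \<alpha> + l is nonzero. Having at least two distances
  rules out vanishing vectors through \<open>gap_count_periodic\<close>.\<close>

lemma gap_count_pattern:
  fixes B :: "(real^'n)^'k"
  assumes G: "gap_count N \<alpha> (lat B) = Suc r" "r \<ge> 1" and ne: "\<exists>l\<in>lat B. l \<noteq> 0"
  obtains K :: "nat \<Rightarrow> nat" and c :: "nat \<Rightarrow> real" where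
    "\<And>i. i \<le> r \<Longrightarrow> N - 1 \<le> 2 * K i \<and> K i \<le> N - 1"
    "\<And>i. i < r \<Longrightarrow> \<exists>k. \<exists>l\<in>lat B. \<bar>k\<bar> \<le> int (K (Suc i)) \<and> 0 < norm (of_int k *\<^sub>R \<alpha> + l) \<and>
        norm (of_int k *\<^sub>R \<alpha> + l) < c i"
    "\<And>i k l. i < r \<Longrightarrow> \<bar>k\<bar> \<le> int (K i) \<Longrightarrow> l \<in> lat B \<Longrightarrow> k \<noteq> 0 \<or> l \<noteq> 0 \<Longrightarrow> c i < norm (of_int k *\<^sub>R \<alpha> + l)"
proof -
  define V where "V = (\<lambda>n. nn_dist \<alpha> (lat B) N n) ` {1..N}"
  have V: "finite V" "card V = Suc r" using G by (auto simp: V_def gap_count_def)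
  define vs where "vs = sorted_list_of_set V"
  have vs: "length vs = Suc r" "set vs = V" "sorted_wrt (<) vs" using V by (auto simp: vs_def)
  \<comment> \<open>The values in decreasing order; truncated subtraction keeps the position valid
    for i > r too, so that \<open>n\<close> and \<open>K\<close> can be chosen for all i.\<close>
  define v where "v = (\<lambda>i. vs ! (r - i))"
  have vlt: "v (Suc i) < v i" if "i < r" for i
    unfolding v_def using that vs by (intro sorted_wrt_nth_less[OF vs(3)]) auto
  have "\<exists>n\<in>{1..N}. nn_dist \<alpha> (lat B) N n = v i" for i
  proof -
    have "v i \<in> V" unfolding v_def vs(2)[symmetric] using vs(1) by (intro nth_mem) simp
    then show ?thesis by (auto simp: V_def)
  qed
  then obtain n where n: "\<And>i. n i \<in> {1..N}" "\<And>i. nn_dist \<alpha> (lat B) N (n i) = v i" by metis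
  define K where "K = (\<lambda>i. max (n i - 1) (N - n i))"
  have n': "1 \<le> n i" "n i \<le> N" for i using n(1)[of i] by auto
  have gdK: "min_dist \<alpha> (lat B) (K i) = v i" for i
    using nn_dist_eq_min_dist[OF lat_uminus n'] n(2) unfolding K_def by metis
  have K: "N - 1 \<le> 2 * K i \<and> K i \<le> N - 1" for i using n'[of i] unfolding K_def by auto
  \<comment> \<open>Midpoints leave strict room on both sides, which the perturbation
    consumes.\<close>
  define c where "c = (\<lambda>i. (v i + v (Suc i)) / 2)"
  have nonper: "of_int k *\<^sub>R \<alpha> + l \<noteq> 0" if "\<bar>k\<bar> \<le> int (K i)" "l \<in> lat B" "k \<noteq> 0 \<or> l \<noteq> 0" for k l i
  proof
    assume z: "of_int k *\<^sub>R \<alpha> + l = 0"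
    then have k: "k \<noteq> 0" using that by auto
    have l: "of_int k *\<^sub>R \<alpha> = - l" using z by (simp add: eq_neg_iff_add_eq_0)
    have "of_int \<bar>k\<bar> *\<^sub>R \<alpha> \<in> lat B"
      using l lat_uminus[OF that(2)] that(2) by (cases "k \<ge> 0") auto
    moreover have "1 \<le> \<bar>k\<bar>" "\<bar>k\<bar> \<le> int N - 1" using k that(1) K[of i] n'[of i] by auto
    ultimately have "gap_count N \<alpha> (lat B) \<le> 1" by (intro gap_count_periodic)
    then show False using G by simp
  qed
  show ?thesis
  proof (rule that[of K c])
    show "N - 1 \<le> 2 * K i \<and> K i \<le> N - 1" for i by (rule K)
    fix i assume i: "i < r"
    let ?V = "\<lambda>K. {norm (of_int k *\<^sub>R \<alpha> + l) | k l. \<bar>k\<bar> \<le> int K \<and> l \<in> lat B \<and>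
        norm (of_int k *\<^sub>R \<alpha> + l) > 0}"
    obtain l0 where l0: "l0 \<in> lat B" "l0 \<noteq> 0" using ne by blast
    have "norm (of_int 0 *\<^sub>R \<alpha> + l0) \<in> ?V (K (Suc i))"
        using l0 by (intro CollectI exI[of _ 0] exI[of _ l0]) simp
    then have "?V (K (Suc i)) \<noteq> {}" by blast
    moreover have "Inf (?V (K (Suc i))) < c i"
        using gdK[of "Suc i"] vlt[OF i] by (simp add: min_dist_def c_def)
    ultimately obtain y where "y \<in> ?V (K (Suc i))" "y < c i" by (rule cInf_lessD[elim_format]) blast
    then show "\<exists>k. \<exists>l\<in>lat B. \<bar>k\<bar> \<le> int (K (Suc i)) \<and> 0 < norm (of_int k *\<^sub>R \<alpha> + l) \<and>
        norm (of_int k *\<^sub>R \<alpha> + l) < c i"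
      by blast
  next
    fix i k l assume *: "i < r" "\<bar>k\<bar> \<le> int (K i)" "l \<in> lat B" "k \<noteq> 0 \<or> l \<noteq> 0"
    then have "norm (of_int k *\<^sub>R \<alpha> + l) > 0" using nonper by simp
    then have "min_dist \<alpha> (lat B) (K i) \<le> norm (of_int k *\<^sub>R \<alpha> + l)"
      unfolding min_dist_def using * by (intro cInf_lower min_dist_bdd) blast
    then show "c i < norm (of_int k *\<^sub>R \<alpha> + l)" using gdK[of i] vlt[OF *(1)] by (simp add: c_def)
  qed
qed

section \<open>Persistence of the pattern and the choice of the length\<close>

lemma sub_exponential_hits:
  assumes Ns: "sub_exponential Ns" and ab: "0 < a" "a < b"
  obtains X0 where "\<And>X::real. X \<ge> X0 \<Longrightarrow> \<exists>j\<ge>J. a * X \<le> real (Ns j) \<and> real (Ns j) \<le> b * X"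
proof -
  have mono: "strict_mono Ns" and lim: "(\<lambda>i. real (Ns (Suc i)) / real (Ns i)) \<longlonglongrightarrow> 1"
    using Ns by (auto simp: sub_exponential_def)
  have "\<forall>\<^sub>F i in sequentially. real (Ns (Suc i)) / real (Ns i) < b / a"
    using order_tendstoD(2)[OF lim, of "b / a"] ab by simp
  then obtain i0 where i0: "\<And>i. i \<ge> i0 \<Longrightarrow> real (Ns (Suc i)) / real (Ns i) < b / a"
    by (auto simp: eventually_sequentially)
  define i1 where "i1 = max (max i0 J) 1"
  define X0 where "X0 = (real (Ns i1) + 1) / a"
  show ?thesis
  proof (rule that[of X0])
    fix X assume "X \<ge> X0"
    then have X: "a * X > real (Ns i1)" using ab by (simp add: X0_def field_simps)
    have "\<exists>j. a * X \<le> real (Ns j)"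
    proof -
      obtain j :: nat where "a * X \<le> real j" using real_arch_simple by blast
      moreover have "j \<le> Ns j" using mono by (rule strict_mono_imp_increasing)
      ultimately show ?thesis by (intro exI[of _ j]) linarith
    qed
    \<comment> \<open>The first term to reach a X: its predecessor lies below a X, and the ratio of
      the two is below b / a.\<close>
    then obtain j where j: "a * X \<le> real (Ns j)" "\<And>m. m < j \<Longrightarrow> \<not> a * X \<le> real (Ns m)"
      using exists_least_iff[of "\<lambda>j. a * X \<le> real (Ns j)"] by blast
    have "i1 < j"
    proof (rule ccontr)
      assume "\<not> i1 < j"
      then have "Ns j \<le> Ns i1" using mono by (simp add: strict_mono_less_eq)
      then show False using j(1) X by linarith
    qed
    then obtain m where m: "j = Suc m" "m \<ge> i1" by (cases j) auto
    have "Ns m > 0"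
    proof -
      have "m \<le> Ns m" using mono by (rule strict_mono_imp_increasing)
      then show ?thesis using m by (simp add: i1_def)
    qed
    then have "real (Ns j) < b / a * real (Ns m)"
      using i0[of m] m by (simp add: i1_def divide_less_eq)
    also have "\<dots> \<le> b / a * (a * X)" using j(2)[of m] m ab by (intro mult_left_mono) auto
    also have "\<dots> = b * X" using ab by simp
    finally show "\<exists>j\<ge>J. a * X \<le> real (Ns j) \<and> real (Ns j) \<le> b * X"
      using j m by (intro exI[of _ j]) (auto simp: i1_def)
  qed
qed

text \<open>For fixed integer coefficients each condition is open. The universal one concerns
  infinitely many coefficient vectors, but by \<open>lincomb_perturb\<close> only finitely many can
  give a vector inside the box, uniformly for all bases near \<open>h\<close>.\<close>

lemma pattern_stable:
  fixes h :: "(real \<times> (real^'n))^('n option)" and t c :: "nat \<Rightarrow> real"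
  assumes h: "full_rank h"
    and ex: "\<And>i. i < r \<Longrightarrow> \<exists>x\<in>lat h. \<bar>fst x\<bar> < t (Suc i) \<and> 0 < norm (snd x) \<and> norm (snd x) < c i"
    and all: "\<And>i x. i < r \<Longrightarrow> x \<in> lat h \<Longrightarrow> x \<noteq> 0 \<Longrightarrow> \<bar>fst x\<bar> > t i \<or> norm (snd x) > c i"
  shows "\<forall>\<^sub>F b in nhds h. \<forall>i<r. (\<exists>x\<in>lat b. \<bar>fst x\<bar> < t (Suc i) \<and> 0 < norm (snd x) \<and>
      norm (snd x) < c i) \<and>
     (\<forall>x\<in>lat b. x \<noteq> 0 \<longrightarrow> \<bar>fst x\<bar> > t i \<or> norm (snd x) > c i)"
proof -
  define F where "F = (\<lambda>(z::'n option\<Rightarrow>int) (b::(real \<times> (real^'n))^('n option)). \<Sum>k\<in>UNIV.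
      of_int (z k) *\<^sub>R b $ k)"
  have lim: "((\<lambda>b. F z b) \<longlongrightarrow> F z h) (nhds h)" for z unfolding F_def
    by (intro tendsto_intros tendsto_vec_nth) (simp add: filterlim_ident)
  have limf: "((\<lambda>b. \<bar>fst (F z b)\<bar>) \<longlongrightarrow> \<bar>fst (F z h)\<bar>) (nhds h)" for z by (intro tendsto_intros lim)
  have lims: "((\<lambda>b. norm (snd (F z b))) \<longlongrightarrow> norm (snd (F z h))) (nhds h)" for
      z by (intro tendsto_intros lim)
  obtain B where B: "B > 0" "\<And>c::real^('n option). B * norm c \<le> norm (\<Sum>k\<in>UNIV. c $ k *\<^sub>R h $ k)"
    using full_rank_bounded_below[OF dim_option h] by blast
  have near: "\<forall>\<^sub>F b in nhds h. (\<Sum>k\<in>UNIV. norm (b $ k - h $ k)) < B / 2"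
  proof -
    have "((\<lambda>b. \<Sum>k\<in>UNIV. norm (b $ k - h $ k)) \<longlongrightarrow> (\<Sum>k\<in>UNIV. norm (h $ k - h $ k))) (nhds h)"
      by (intro tendsto_intros tendsto_vec_nth) (simp add: filterlim_ident)
    then show ?thesis by (rule order_tendstoD) (use B in simp)
  qed
  have "\<forall>\<^sub>F b in nhds h. (\<exists>x\<in>lat b. \<bar>fst x\<bar> < t (Suc i) \<and> 0 < norm (snd x) \<and> norm (snd x) < c i) \<and>
     (\<forall>x\<in>lat b. x \<noteq> 0 \<longrightarrow> \<bar>fst x\<bar> > t i \<or> norm (snd x) > c i)" if i: "i < r" for i
  proof -
    obtain z where z: "\<bar>fst (F z h)\<bar> < t (Suc i)" "0 < norm (snd (F z h))" "norm (snd (F z h)) < c i"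
      using ex[OF i] by (auto simp: lat_def F_def)
    have 1: "\<forall>\<^sub>F b in nhds h. \<bar>fst (F z b)\<bar> < t (Suc i)" by (rule order_tendstoD(2)[OF limf z(1)])
    have 2: "\<forall>\<^sub>F b in nhds h. 0 < norm (snd (F z b))" by (rule order_tendstoD(1)[OF lims z(2)])
    have 3: "\<forall>\<^sub>F b in nhds h. norm (snd (F z b)) < c i" by (rule order_tendstoD(2)[OF lims z(3)])
    \<comment> \<open>Vectors in the box have norm at most t i + c i, and B / 2 is the lower bound
      that remains for nearby bases.\<close>
    define M where "M = \<lceil>(t i + c i) / (B / 2)\<rceil>"
    define Z where "Z = (PiE (UNIV::'n option set) (\<lambda>_. {-M..M})) - {\<lambda>_. 0}"
    have finZ: "finite Z" unfolding Z_def by (intro finite_Diff finite_PiE) auto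
    have "\<forall>\<^sub>F b in nhds h. \<bar>fst (F z b)\<bar> > t i \<or> norm (snd (F z b)) > c i" if "z \<in> Z" for z
    proof -
      have "F z h \<noteq> 0"
      proof
        assume "F z h = 0"
        then have "F z h = (\<Sum>k\<in>UNIV. (0::real) *\<^sub>R h $ k)" by simp
        then have "real_of_int (z k) = 0" for k
          unfolding F_def using full_rank_coeff_unique[OF dim_option h, of "\<lambda>k. of_int (z k)" "\<lambda>_.
              0" k] by simp
        then show False using that by (auto simp: Z_def)
      qed
      moreover have "F z h \<in> lat h" by (simp add: F_def lat_memI)
      ultimately consider "\<bar>fst (F z h)\<bar> > t i" | "norm (snd (F z h)) > c i" using all[OF i] by blast
      then show ?thesis
      proof cases
        case 1
        from order_tendstoD(1)[OF limf this] show ?thesis by eventually_elim simp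
      next
        case 2
        from order_tendstoD(1)[OF lims this] show ?thesis by eventually_elim simp
      qed
    qed
    then have 4: "\<forall>\<^sub>F b in nhds h. \<forall>z\<in>Z. \<bar>fst (F z b)\<bar> > t i \<or> norm (snd (F z b)) > c i"
      by (intro eventually_ball_finite finZ) auto
    show ?thesis using 1 2 3 4 near
    proof eventually_elim
      case (elim b)
      have "\<bar>fst x\<bar> > t i \<or> norm (snd x) > c i" if x: "x \<in> lat b" "x \<noteq> 0" for x
      proof (rule ccontr)
        assume "\<not> ?thesis"
        then have small: "\<bar>fst x\<bar> \<le> t i" "norm (snd x) \<le> c i" by auto
        obtain w where w: "x = F w b" using x(1) by (auto simp: lat_def F_def)
        have "norm x \<le> \<bar>fst x\<bar> + norm (snd x)" using norm_Pair_le[of "fst x" "snd x"] by simp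
        then have nx: "norm x \<le> t i + c i" using small by linarith
        let ?w = "\<chi> k. real_of_int (w k)"
        have "(B - (\<Sum>k\<in>UNIV. norm (b $ k - h $ k))) * norm ?w \<le> norm (\<Sum>k\<in>UNIV. ?w $ k *\<^sub>R b $ k)"
          by (rule lincomb_perturb[OF B(2)])
        then have "(B - (\<Sum>k\<in>UNIV. norm (b $ k - h $ k))) * norm ?w \<le> norm x" by (simp add: w F_def)
        moreover have "B / 2 * norm ?w \<le> (B - (\<Sum>k\<in>UNIV. norm (b $ k - h $ k))) * norm ?w"
          using elim(5) by (intro mult_right_mono) auto
        ultimately have "B / 2 * norm ?w \<le> t i + c i" using nx by linarith
        then have nw: "norm ?w \<le> (t i + c i) / (B / 2)" using B(1) by (simp add: field_simps)
        have "w k \<in> {-M..M}" for k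
        proof -
          have "\<bar>real_of_int (w k)\<bar> \<le> norm ?w" using component_le_norm_cart[of ?w k] by simp
          then have "\<bar>real_of_int (w k)\<bar> \<le> real_of_int M" using nw unfolding M_def by linarith
          then have "- M \<le> w k" "w k \<le> M" by linarith+
          then show ?thesis by simp
        qed
        moreover have "w \<noteq> (\<lambda>_. 0)" using x(2) w by (auto simp: F_def)
        ultimately have "w \<in> Z" by (auto simp: Z_def)
        then show False using elim(4) small w by (metis not_less)
      qed
      moreover have "F z b \<in> lat b" by (simp add: F_def lat_memI)
      ultimately show ?case using elim(1-3) by blast
    qed
  qed
  then have "\<forall>\<^sub>F b in nhds h. \<forall>i\<in>{..<r}. (\<exists>x\<in>lat b. \<bar>fst x\<bar> < t (Suc i) \<and> 0 < norm (snd x) \<and>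
      norm (snd x) < c i) \<and>
     (\<forall>x\<in>lat b. x \<noteq> 0 \<longrightarrow> \<bar>fst x\<bar> > t i \<or> norm (snd x) > c i)"
    by (intro eventually_ball_finite) auto
  then show ?thesis by eventually_elim blast
qed

section \<open>From \<int>^n to a general lattice, and the conclusion\<close>

definition map_snd_matrix :: "real^'n^'n \<Rightarrow> real \<times> (real^'n) \<Rightarrow> real \<times> (real^'n)" where
  "map_snd_matrix A p = (fst p, A *v snd p)"

lemma map_snd_matrix_linear: "linear (map_snd_matrix A)"
  by (rule linearI) (simp_all add: map_snd_matrix_def matrix_vector_right_distrib matrix_vector_mult_scaleR)

text \<open>Scalars commute with A, so the density statement for \<int>^n transfers to the lattice A
  \<int>^n with the same \<epsilon> and \<delta>.\<close>

lemma map_snd_matrix_shear: "map_snd_matrix A (shear \<epsilon> \<delta> 0 p) = shear \<epsilon> \<delta> 0 (map_snd_matrix A p)"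
  by (simp add: map_snd_matrix_def shear_def matrix_vector_mult_scaleR)

lemma map_snd_matrix_map_snd_matrix: "map_snd_matrix A (map_snd_matrix B p) = map_snd_matrix (A ** B) p"
  by (simp add: map_snd_matrix_def matrix_vector_mul_assoc)

lemma map_snd_matrix_kronecker_basis:
  fixes A :: "real^'n^'n"
  shows "map_snd_matrix A ` lat (kronecker_basis \<beta>) = {(of_int k, of_int k *\<^sub>R (A *v \<beta>) + l) | k l.
      l \<in> {A *v (\<chi> i. of_int (z i)) | z::'n\<Rightarrow>int. True}}"
  unfolding lat_kronecker_basis
proof (intro equalityI subsetI)
  fix x assume "x \<in> map_snd_matrix A ` {(of_int k, of_int k *\<^sub>R \<beta> + (\<chi> i.
      of_int (z i))) | k (z::'n\<Rightarrow>int). True}"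
  then obtain k and z :: "'n \<Rightarrow> int" where "x = map_snd_matrix A (of_int k, of_int k *\<^sub>R \<beta> + (\<chi> i.
      of_int (z i)))" by blast
  then have "x = (of_int k, of_int k *\<^sub>R (A *v \<beta>) + A *v (\<chi> i. of_int (z i)))"
    by (simp add: map_snd_matrix_def matrix_vector_right_distrib matrix_vector_mult_scaleR)
  then show "x \<in> {(of_int k, of_int k *\<^sub>R (A *v \<beta>) + l) | k l. l \<in> {A *v (\<chi> i.
      of_int (z i)) | z::'n\<Rightarrow>int. True}}"
    by blast
next
  fix x :: "real \<times> (real^'n)"
  assume "x \<in> {(of_int k, of_int k *\<^sub>R (A *v \<beta>) + l) | k l. l \<in> {A *v (\<chi> i.
      of_int (z i)) | z::'n\<Rightarrow>int. True}}"
  then obtain k and z :: "'n \<Rightarrow> int" where "x = (of_int k, of_int k *\<^sub>R (A *v \<beta>) + A *v (\<chi> i.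
      of_int (z i)))" by blast
  then have "x = map_snd_matrix A (of_int k, of_int k *\<^sub>R \<beta> + (\<chi> i. of_int (z i)))"
    by (simp add: map_snd_matrix_def matrix_vector_right_distrib matrix_vector_mult_scaleR)
  then show "x \<in> map_snd_matrix A ` {(of_int k, of_int k *\<^sub>R \<beta> + (\<chi> i.
      of_int (z i))) | k (z::'n\<Rightarrow>int). True}"
    by (rule image_eqI) blast
qed

lemma gap_count_pos: "N \<ge> 1 \<Longrightarrow> 1 \<le> gap_count N \<alpha> L"
proof -
  assume "N \<ge> 1"
  then have "(\<lambda>n. nn_dist \<alpha> L N n) ` {1..N} \<noteq> {}" by auto
  then show ?thesis unfolding gap_count_def by (simp add: Suc_le_eq card_gt_0_iff)
qed

text \<open>Density supplies a lattice of pairs (\<epsilon> k, \<delta> (k \<alpha> + l)) that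
  inherits the pattern of \<alpha>0. Read with |k| \<le> t i / \<epsilon> and thresholds c i /
  \<delta>, this pattern satisfies the conditions of \<open>gap_count_ge\<close> for every length in
  a window proportional to 1/\<epsilon>, and the sequence has a term there.\<close>

lemma gap_count_frequently_ge:
  fixes A A0 :: "real^'n^'n" and \<beta> \<alpha>0 :: "real^'n"
  assumes A: "det A \<noteq> 0" "L = lat (\<chi> i. column i A)" "L = {A *v (\<chi> i. of_int (z i)) | z::'n\<Rightarrow>int. True}"
    and A0: "det A0 \<noteq> 0" "L0 = lat (\<chi> i. column i A0)" "L0 = {A0 *v (\<chi> i.
        of_int (z i)) | z::'n\<Rightarrow>int. True}"
    and dense: "\<And>(h::(real \<times> (real^'n))^('n option)) e T. full_rank h \<Longrightarrow> e > 0 \<Longrightarrow> T > 0 \<Longrightarrow>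
     \<exists>\<epsilon> \<delta> b. 0 < \<epsilon> \<and> \<epsilon> < 1 / T \<and> 0 < \<delta> \<and> dist b h < e \<and> lat b = shear \<epsilon> \<delta> 0 ` lat (kronecker_basis \<beta>)"
    and Ns: "sub_exponential Ns"
  shows "\<exists>j\<ge>J. gap_count N0 \<alpha>0 L0 \<le> gap_count (Ns j) (A *v \<beta>) L"
proof (cases "gap_count N0 \<alpha>0 L0 \<le> 1")
  case True
  have "max J 1 \<le> Ns (max J 1)"
      using Ns by (intro strict_mono_imp_increasing) (simp add: sub_exponential_def)
  then have "1 \<le> gap_count (Ns (max J 1)) (A *v \<beta>) L" by (intro gap_count_pos) simp
  then show ?thesis using True by (intro exI[of _ "max J 1"]) simp
next
  case False
  define \<alpha> where "\<alpha> = A *v \<beta>"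
  define r where "r = gap_count N0 \<alpha>0 L0 - 1"
  have r: "gap_count N0 \<alpha>0 L0 = Suc r" "r \<ge> 1" using False by (auto simp: r_def)
  have N0: "N0 \<ge> 1" using r by (cases "N0 = 0") (auto simp: gap_count_def)
  have nz: "\<exists>l\<in>{M *v (\<chi> i. of_int (z i)) | z::'n\<Rightarrow>int. True}. l \<noteq> 0" if "det M \<noteq> 0" for M :: "real^'n^'n"
  proof -
    have "M *v (\<chi> i. of_int 1) \<noteq> M *v 0"
      using inj_matrix_vector_mult[of M] that invertible_det_nz by (metis injD matrix_vector_mult_0_right of_int_1 vec_lambda_beta zero_index zero_neq_one)
    then have "M *v (\<chi> i. of_int 1) \<noteq> 0" by simp
    then show ?thesis by (intro bexI[of _ "M *v (\<chi> i. of_int 1)"] CollectI exI[of _ "\<lambda>_. 1"]) auto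
  qed
  have ne: "\<exists>l\<in>lat (\<chi> i. column i A0). l \<noteq> 0"
    using nz[OF A0(1)] unfolding A0(3)[symmetric] A0(2) .
  obtain K :: "nat \<Rightarrow> nat" and c :: "nat \<Rightarrow> real" where K: "\<And>i. i \<le> r \<Longrightarrow> N0 - 1 \<le> 2 * K i \<and> K i \<le> N0 - 1"
    and ex: "\<And>i. i < r \<Longrightarrow> \<exists>k. \<exists>l\<in>L0. \<bar>k\<bar> \<le> int (K (Suc i)) \<and> 0 < norm (of_int k *\<^sub>R \<alpha>0 + l) \<and>
        norm (of_int k *\<^sub>R \<alpha>0 + l) < c i"
    and all: "\<And>i k l. i < r \<Longrightarrow> \<bar>k\<bar> \<le> int (K i) \<Longrightarrow> l \<in> L0 \<Longrightarrow> k \<noteq> 0 \<or> l \<noteq> 0 \<Longrightarrow>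
        c i < norm (of_int k *\<^sub>R \<alpha>0 + l)"
  proof (rule gap_count_pattern[OF r(1)[unfolded A0(2)] r(2) ne, folded A0(2)])
    fix K :: "nat \<Rightarrow> nat" and c :: "nat \<Rightarrow> real"
    assume "\<And>i. i \<le> r \<Longrightarrow> N0 - 1 \<le> 2 * K i \<and> K i \<le> N0 - 1"
      and "\<And>i. i < r \<Longrightarrow> \<exists>k. \<exists>l\<in>L0. \<bar>k\<bar> \<le> int (K (Suc i)) \<and> 0 < norm (of_int k *\<^sub>R \<alpha>0 + l) \<and>
          norm (of_int k *\<^sub>R \<alpha>0 + l) < c i"
      and "\<And>i k l. i < r \<Longrightarrow> \<bar>k\<bar> \<le> int (K i) \<Longrightarrow> l \<in> L0 \<Longrightarrow> k \<noteq> 0 \<or> l \<noteq> 0 \<Longrightarrow> c i < norm (of_int k *\<^sub>R \<alpha>0 + l)"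
    then show thesis by (rule that)
  qed
  obtain A' where A': "A ** A' = mat 1" "A' ** A = mat 1"
      using A(1) invertible_det_nz unfolding invertible_def by blast
  obtain A0' where A0': "A0 ** A0' = mat 1" "A0' ** A0 = mat 1"
      using A0(1) invertible_det_nz unfolding invertible_def by blast
  define \<beta>0 where "\<beta>0 = A0' *v \<alpha>0"
  have \<alpha>0: "A0 *v \<beta>0 = \<alpha>0" by (simp add: \<beta>0_def matrix_vector_mul_assoc A0')
  \<comment> \<open>No lattice point has first coordinate exactly \<open>\<plusminus> t i\<close>, which makes the pattern stable.\<close>
  define t where "t = (\<lambda>i. real (K i) + 1 / 2)"
  \<comment> \<open>The orbit is dense in its form for \<int>^n, so the desired lattice is pulled
    back by A; its image \<open>h'\<close> carries the pattern of \<alpha>0 and L0.\<close>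
  define h where "h = (\<chi> k. map_snd_matrix (A' ** A0) (kronecker_basis \<beta>0 $ k))"
  define h' where "h' = (\<chi> k. map_snd_matrix A (h $ k))"
  have h': "h' = (\<chi> k. map_snd_matrix A0 (kronecker_basis \<beta>0 $ k))"
    by (simp add: h'_def h_def map_snd_matrix_map_snd_matrix matrix_mul_assoc A' )
  have lath': "lat h' = {(of_int k, of_int k *\<^sub>R \<alpha>0 + l) | k l. l \<in> L0}"
    unfolding h' lat_linear[OF map_snd_matrix_linear] map_snd_matrix_kronecker_basis \<alpha>0 A0(3) by simp
  have surj: "surj (map_snd_matrix M)" if "M ** M' = mat 1" for M M' :: "real^'n^'n"
  proof (rule surjI)
    fix p show "map_snd_matrix M (map_snd_matrix M' p) = p"
        by (simp add: map_snd_matrix_map_snd_matrix that) (simp add: map_snd_matrix_def)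
  qed
  have "full_rank h'" using full_rank_linear_image[OF map_snd_matrix_linear surj[OF A0'(1)] full_rank_kronecker_basis] h' lat_linear[OF map_snd_matrix_linear] by metis
  have "(A' ** A0) ** (A0' ** A) = mat 1"
    by (metis A'(2) A0'(1) matrix_mul_assoc matrix_mul_rid)
  then have fh: "full_rank h"
      using full_rank_linear_image[OF map_snd_matrix_linear surj full_rank_kronecker_basis] h_def lat_linear[OF map_snd_matrix_linear] by metis
  have "\<forall>\<^sub>F b in nhds h'. \<forall>i<r. (\<exists>x\<in>lat b. \<bar>fst x\<bar> < t (Suc i) \<and> 0 < norm (snd x) \<and>
      norm (snd x) < c i) \<and>
     (\<forall>x\<in>lat b. x \<noteq> 0 \<longrightarrow> \<bar>fst x\<bar> > t i \<or> norm (snd x) > c i)"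
  proof (rule pattern_stable[OF \<open>full_rank h'\<close>])
    fix i assume i: "i < r"
    obtain k l where kl: "l \<in> L0" "\<bar>k\<bar> \<le> int (K (Suc i))" "0 < norm (of_int k *\<^sub>R \<alpha>0 + l)"
        "norm (of_int k *\<^sub>R \<alpha>0 + l) < c i"
      using ex[OF i] by blast
    then have "\<bar>real_of_int k\<bar> < t (Suc i)" unfolding t_def by linarith
    moreover have "(of_int k, of_int k *\<^sub>R \<alpha>0 + l) \<in> lat h'" unfolding lath' using kl by blast
    ultimately show "\<exists>x\<in>lat h'. \<bar>fst x\<bar> < t (Suc i) \<and> 0 < norm (snd x) \<and> norm (snd x) < c i"
      using kl by (intro bexI[of _ "(of_int k, of_int k *\<^sub>R \<alpha>0 + l)"]) auto
  next
    fix i x assume i: "i < r" and x: "x \<in> lat h'" "x \<noteq> 0"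
    obtain k l where kl: "x = (of_int k, of_int k *\<^sub>R \<alpha>0 + l)" "l \<in> L0" using x(1) lath' by blast
    have "k \<noteq> 0 \<or> l \<noteq> 0" using x(2) kl(1) by (auto simp: zero_prod_def)
    then have "\<bar>k\<bar> \<le> int (K i) \<Longrightarrow> c i < norm (of_int k *\<^sub>R \<alpha>0 + l)" using all[OF i] kl by blast
    moreover have "\<not> \<bar>k\<bar> \<le> int (K i) \<Longrightarrow> \<bar>real_of_int k\<bar> > t i" unfolding t_def by linarith
    ultimately show "t i < \<bar>fst x\<bar> \<or> c i < norm (snd x)" using kl(1) by auto
  qed
  then obtain S where S: "open S" "h' \<in> S" and
    pat: "\<And>b i. b \<in> S \<Longrightarrow> i < r \<Longrightarrow> (\<exists>x\<in>lat b. \<bar>fst x\<bar> < t (Suc i) \<and> 0 < norm (snd x) \<and>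
        norm (snd x) < c i) \<and>
     (\<forall>x\<in>lat b. x \<noteq> 0 \<longrightarrow> \<bar>fst x\<bar> > t i \<or> norm (snd x) > c i)"
    unfolding eventually_nhds by blast
  define F where "F = (\<lambda>b::(real \<times> (real^'n))^('n option). \<chi> k. map_snd_matrix A (b $ k))"
  have "continuous_on UNIV F" unfolding F_def map_snd_matrix_def
    by (intro continuous_intros bounded_linear.continuous_on[OF matrix_vector_mul_bounded_linear])
  then have "open (F -` S)" using S(1) by (simp add: open_vimage)
  moreover have "h \<in> F -` S" using S(2) by (simp add: F_def h'_def)
  ultimately obtain e where e: "e > 0" "ball h e \<subseteq> F -` S" by (meson open_contains_ball)
  \<comment> \<open>Since N0/2 \<le> t i \<le> N0 - 1/2, a length between (N0 - 1/2) X and N0 X is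
    wanted. The margins X/6 and X/4 left by this smaller window absorb the rounding by 1 as soon as
    X > 6.\<close>
  have ab: "0 < real N0 - 1/3" "real N0 - 1/3 < real N0 - 1/4" using N0 by auto
  obtain X0 where X0: "\<And>X::real. X \<ge> X0 \<Longrightarrow> \<exists>j\<ge>J. (real N0 - 1/3) * X \<le> real (Ns j) \<and> real (Ns j) \<le>
      (real N0 - 1/4) * X"
    using sub_exponential_hits[OF Ns ab] by blast
  define T where "T = max X0 6"
  have T: "T > 0" by (simp add: T_def)
  obtain \<epsilon> \<delta> b where b: "0 < \<epsilon>" "\<epsilon> < 1 / T" "0 < \<delta>" "dist b h < e" "lat b =
      shear \<epsilon> \<delta> 0 ` lat (kronecker_basis \<beta>)"
    using dense[OF fh e(1) T] by blast
  define X where "X = 1 / \<epsilon>"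
  have "T < X" using b T by (simp add: X_def field_simps)
  then have X: "X \<ge> X0" "X > 6" by (auto simp: T_def)
  obtain j where j: "j \<ge> J" "(real N0 - 1/3) * X \<le> real (Ns j)" "real (Ns j) \<le> (real N0 - 1/4) * X"
    using X0[OF X(1)] by blast
  have "b \<in> ball h e" using b(4) by (simp add: dist_commute)
  then have Fb: "F b \<in> S" using e(2) by blast
  have latF: "lat (F b) = {(\<epsilon> * of_int k, \<delta> *\<^sub>R (of_int k *\<^sub>R \<alpha> + l)) | k l. l \<in> L}"
  proof -
    have "lat (F b) = map_snd_matrix A ` lat b"
        unfolding F_def by (rule lat_linear[OF map_snd_matrix_linear])
    also have "\<dots> = shear \<epsilon> \<delta> 0 ` map_snd_matrix A ` lat (kronecker_basis \<beta>)"
        unfolding b(5) by (simp add: image_image map_snd_matrix_shear)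
    also have "map_snd_matrix A ` lat (kronecker_basis \<beta>) = {(of_int k, of_int k *\<^sub>R \<alpha> + l) | k l.
        l \<in> L}"
      unfolding map_snd_matrix_kronecker_basis \<alpha>_def A(3) by simp
    also have "shear \<epsilon> \<delta> 0 ` {(of_int k, of_int k *\<^sub>R \<alpha> + l) | k l. l \<in> L} =
        {(\<epsilon> * of_int k, \<delta> *\<^sub>R (of_int k *\<^sub>R \<alpha> + l)) | k l. l \<in> L}"
      by (force simp: shear_def)
    finally show ?thesis .
  qed
  define Kj where "Kj = (\<lambda>i. nat \<lfloor>t i * X\<rfloor>)"
  have Kj: "\<bar>k\<bar> \<le> int (Kj i) \<longleftrightarrow> \<epsilon> * \<bar>real_of_int k\<bar> \<le> t i" for k i
  proof -
    have "0 \<le> t i * X" using X by (simp add: t_def)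
    then have "\<bar>k\<bar> \<le> int (Kj i) \<longleftrightarrow> \<bar>real_of_int k\<bar> \<le> t i * X"
        unfolding Kj_def by (simp add: le_floor_iff)
    also have "\<dots> \<longleftrightarrow> \<epsilon> * \<bar>real_of_int k\<bar> \<le> t i" using b(1) by (simp add: X_def field_simps)
    finally show ?thesis .
  qed
  have "Suc r \<le> gap_count (Ns j) \<alpha> L"
  proof (rule gap_count_ge[where K = Kj and c = "\<lambda>i. c i / \<delta>"])
    show "- l \<in> L" if "l \<in> L" for l using that unfolding A(2) by (rule lat_uminus)
    show "\<exists>l\<in>L. l \<noteq> 0" using nz[OF A(1)] A(3) by simp
    have N1: "(real N0 - 1/2) * X + 1 \<le> real (Ns j)" using j(2) X(2) by (simp add: algebra_simps)
    have N2: "real (Ns j) \<le> real N0 * X - 1" using j(3) X(2) by (simp add: algebra_simps)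
    have "0 \<le> (real N0 - 1/2) * X" using N0 X by (intro mult_nonneg_nonneg) auto
    then show "1 \<le> Ns j" using N1 by linarith
    fix i assume "i \<le> r"
    then have "N0 - 1 \<le> 2 * K i" "K i \<le> N0 - 1" using K by auto
    then have t: "real N0 / 2 \<le> t i" "t i \<le> real N0 - 1/2" using N0 unfolding t_def by linarith+
    then have tX: "real N0 / 2 * X \<le> t i * X" "t i * X \<le> (real N0 - 1/2) * X"
        using X by (auto intro!: mult_right_mono)
    have "t i * X - 1 < real (Kj i)" "real (Kj i) \<le> t i * X"
      using X(2) unfolding Kj_def by (auto simp: t_def)
    then have "real (Ns j) - 1 \<le> 2 * real (Kj i)" "real (Kj i) \<le> real (Ns j) - 1"
      using tX N1 N2 by linarith+
    then show "Ns j - 1 \<le> 2 * Kj i \<and> Kj i \<le> Ns j - 1" by linarith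
  next
    fix i assume i: "i < r"
    obtain x where x: "x \<in> lat (F b)" "\<bar>fst x\<bar> < t (Suc i)" "0 < norm (snd x)" "norm (snd x) < c i"
      using pat[OF Fb i] by blast
    obtain k l where kl: "x = (\<epsilon> * of_int k, \<delta> *\<^sub>R (of_int k *\<^sub>R \<alpha> + l))" "l \<in> L"
        using x(1) latF by blast
    have "\<bar>k\<bar> \<le> int (Kj (Suc i))" using x(2) kl(1) b(1) by (simp add: Kj abs_mult)
    moreover have nx: "norm (snd x) = \<delta> * norm (of_int k *\<^sub>R \<alpha> + l)" using kl(1) b(3) by simp
    have "0 < norm (of_int k *\<^sub>R \<alpha> + l)"
        using x(3) unfolding nx using b(3) by (simp only: zero_less_mult_pos)
    moreover have "norm (of_int k *\<^sub>R \<alpha> + l) < c i / \<delta>"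
      using x(4) b(3) unfolding nx by (simp only: pos_less_divide_eq mult.commute)
    ultimately show "\<exists>k. \<exists>l\<in>L. \<bar>k\<bar> \<le> int (Kj (Suc i)) \<and> 0 < norm (of_int k *\<^sub>R \<alpha> + l) \<and>
        norm (of_int k *\<^sub>R \<alpha> + l) < c i / \<delta>"
      using kl(2) by blast
  next
    fix i k l assume i: "i < r" and k: "\<bar>k\<bar> \<le> int (Kj i)" and l: "l \<in> L"
        and pos: "0 < norm (of_int k *\<^sub>R \<alpha> + l)"
    let ?x = "(\<epsilon> * of_int k, \<delta> *\<^sub>R (of_int k *\<^sub>R \<alpha> + l))"
    have "?x \<in> lat (F b)" unfolding latF using l by blast
    moreover have "?x \<noteq> 0" using pos b(3) by (auto simp: zero_prod_def)
    ultimately have "\<bar>fst ?x\<bar> > t i \<or> norm (snd ?x) > c i" using pat[OF Fb i] by blast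
    moreover have "\<bar>fst ?x\<bar> \<le> t i" using k b(1) by (simp add: Kj abs_mult)
    ultimately have "c i < \<delta> * norm (of_int k *\<^sub>R \<alpha> + l)" using b(3) by simp
    then show "c i / \<delta> \<le> norm (of_int k *\<^sub>R \<alpha> + l)"
      using b(3) by (simp only: pos_divide_le_eq mult.commute less_imp_le)
  qed
  then show ?thesis using j(1) r(1) \<alpha>_def by (intro exI[of _ j]) simp
qed

theorem theorem1p2:
  fixes L L0 :: "(real ^ 'n) set"
  assumes "CARD('n) \<ge> 2"
    and "unimodular_lattice L" and "unimodular_lattice L0"
  shows "\<exists>P :: (real ^ 'n) set. (UNIV - P) \<in> null_sets lebesgue \<and>
    (\<forall>\<alpha>\<in>P. \<forall>\<alpha>0 :: real ^ 'n. \<forall>Ns. sub_exponential Ns \<longrightarrow>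
       limsup (\<lambda>i. ereal (real (gap_count (Ns i) \<alpha> L)))
         \<ge> (SUP N. ereal (real (gap_count N \<alpha>0 L0))))"
proof -
  obtain A :: "real^'n^'n" where A: "det A \<noteq> 0" "L = lat (\<chi> i. column i A)"
    "L = {A *v (\<chi> i. of_int (z i)) | z::'n\<Rightarrow>int. True}"
    using unimodular_lattice_lat[OF assms(2)] by blast
  obtain A0 :: "real^'n^'n" where A0: "det A0 \<noteq> 0" "L0 = lat (\<chi> i. column i A0)"
    "L0 = {A0 *v (\<chi> i. of_int (z i)) | z::'n\<Rightarrow>int. True}"
    using unimodular_lattice_lat[OF assms(3)] by blast
  obtain A' where A': "A ** A' = mat 1" using A(1) invertible_det_nz unfolding invertible_def by blast
  define dense where "dense = (\<lambda>\<beta>::real^'n. \<forall>(h::(real \<times> (real^'n))^('n option)) e T. full_rank h \<longrightarrow>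
      e > 0 \<longrightarrow> T > 0 \<longrightarrow>
     (\<exists>\<epsilon> \<delta> b. 0 < \<epsilon> \<and> \<epsilon> < 1 / T \<and> 0 < \<delta> \<and> dist b h < e \<and> lat b =
         shear \<epsilon> \<delta> 0 ` lat (kronecker_basis \<beta>)))"
  have "negligible {\<beta>. \<not> dense \<beta>}" unfolding dense_def by (rule orbit_dense_negligible)
  then have neg: "negligible ((*v) A ` {\<beta>. \<not> dense \<beta>})"
    by (intro negligible_differentiable_image_negligible bounded_linear_imp_differentiable_on matrix_vector_mul_bounded_linear) auto
  \<comment> \<open>Built from L alone: L0, \<alpha>0 and the sequence enter only afterwards. The
    complement is null because a linear map preserves null sets.\<close>
  define P where "P = (*v) A ` {\<beta>. dense \<beta>}"
  have "UNIV - P \<subseteq> (*v) A ` {\<beta>. \<not> dense \<beta>}"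
  proof
    fix \<alpha> assume "\<alpha> \<in> UNIV - P"
    moreover have "\<alpha> = A *v (A' *v \<alpha>)" by (simp add: matrix_vector_mul_assoc A')
    ultimately have "\<not> dense (A' *v \<alpha>)" unfolding P_def by blast
    then show "\<alpha> \<in> (*v) A ` {\<beta>. \<not> dense \<beta>}" using \<open>\<alpha> = A *v (A' *v \<alpha>)\<close> by blast
  qed
  then have "UNIV - P \<in> null_sets lebesgue"
    using negligible_subset[OF neg] by (simp add: negligible_iff_null_sets)
  moreover have "(SUP N. ereal (real (gap_count N \<alpha>0 L0))) \<le> limsup (\<lambda>i.
      ereal (real (gap_count (Ns i) \<alpha> L)))"
    if \<alpha>: "\<alpha> \<in> P" and Ns: "sub_exponential Ns" for \<alpha> \<alpha>0 Ns
  proof (rule SUP_least)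
    fix N0 :: nat
    obtain \<beta> where \<beta>: "\<alpha> = A *v \<beta>" "dense \<beta>" using \<alpha> by (auto simp: P_def)
    have D: "\<exists>\<epsilon> \<delta> b. 0 < \<epsilon> \<and> \<epsilon> < 1 / T \<and> 0 < \<delta> \<and> dist b h < e \<and> lat b =
        shear \<epsilon> \<delta> 0 ` lat (kronecker_basis \<beta>)"
      if "full_rank h" "e > 0" "T > 0" for h :: "(real \<times> (real^'n))^('n option)" and e T
      using \<beta>(2) that unfolding dense_def by blast
    show "ereal (real (gap_count N0 \<alpha>0 L0)) \<le> limsup (\<lambda>i. ereal (real (gap_count (Ns i) \<alpha> L)))"
      unfolding limsup_INF_SUP
    proof (rule INF_greatest)
      fix J
      obtain j where "j \<ge> J" "gap_count N0 \<alpha>0 L0 \<le> gap_count (Ns j) \<alpha> L"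
        using gap_count_frequently_ge[OF A A0 D Ns, of J N0 \<alpha>0] \<beta>(1) by auto
      then show "ereal (real (gap_count N0 \<alpha>0 L0)) \<le> (SUP m\<in>{J..}. ereal (real (gap_count (Ns m) \<alpha> L)))"
        by (intro SUP_upper2[of j]) auto
    qed
  qed
  ultimately show ?thesis by (intro exI[of _ P]) blast
qed

end
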